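(* Let $k\ge0$ be an integer, and let $\lambda$ and $\mu$ be $k$-strict partitions such that $|\lambda|=|\mu|+1$ and $w_\lambda=s_iw_\mu$ for some simple reflection $s_i\in W_\infty$ ($i\ge0$). Then $$\partial_i\Theta_\lambda(c\,|\,t)=\Theta_\mu(c\,|\,t)$$ in $\mathbb{Z}[c,t]$.
   Context: Fix an integer $k\ge 0$. Let $c=(c_1,c_2,\ldots)$ and $t=(t_1,t_2,\ldots)$ be two families of independent commuting variables; set $c_0=1$ and $c_p=0$ for $p<0$. For $r\ge1$ and $j\ge 0$ let $e^r_j(t)$ and $h^r_j(t)$ be the elementary and complete homogeneous symmetric polynomials of degree $j$ in $t_1,\ldots,t_r$; set $e^0_j(t)=h^0_j(t)=\delta_{0j}$, and for $r<0$ set $h^r_j(t):=e^{-r}_j(t)$. Here $h^r_j(-t)$ means substituting $-t_i$ for $t_i$. For integers $p,r$ let $c_p^r:=\sum_{j=0}^p c_{p-j}h_j^r(-t)$ (zero for $p<0$). For an integer sequence $\alpha$ with finite support and any integer sequence $\beta$ let $c^\beta_\alpha:=\prod_{i\ge1}c^{\beta_i}_{\alpha_i}$. Raising operators: for $i<j$, $R_{ij}(\alpha):=(\alpha_1,\ldots,\alpha_i+1,\ldots,\alpha_j-1,\ldots)$; a raising operator $R$ is a monomial in the $R_{ij}$, and $R\,c^\beta_\alpha:=c^\beta_{R\alpha}$ (only subscripts change; factors are regarded as noncommuting for this action). Power series in the $R_{ij}$, with $(1+R_{ij})^{-1}=\sum_{s\ge0}(-1)^sR_{ij}^s$, are applied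 term by term; only finitely many terms are nonzero. A partition $\lambda$ is $k$-strict if all its parts greater than $k$ are distinct; $|\lambda|=\sum_i\lambda_i$. For such $\lambda$ (with $\mathbb N$ the positive integers) put $\mathcal C(\lambda):=\{(i,j)\in\mathbb N\times\mathbb N : i<j,\ \lambda_i+\lambda_j>2k+j-i\}$, $\beta_j(\lambda):=k+1-\lambda_j+\#\{i<j : (i,j)\notin\mathcal C(\lambda)\}$ for $j\ge1$, and $R^\lambda:=\prod_{i<j}(1-R_{ij})\prod_{(i,j)\in\mathcal C(\lambda)}(1+R_{ij})^{-1}$. The double theta polynomial is $\Theta_\lambda(c\,|\,t):=R^\lambda\,c^{\beta(\lambda)}_\lambda\in\mathbb Z[c,t]$. Weyl groups: $W_n$ is the hyperoctahedral group of signed permutations of $\{1,\ldots,n\}$, generated by $s_i=(i,i+1)$ for $1\le i\le n-1$ and the sign change $s_0(1)=-1$; $W_n\hookrightarrow W_{n+1}$ by adding the fixed point $n+1$; $W_\infty=\bigcup_nW_n$, with length function $\ell$. An element $w\in W_\infty$ is $k$-Grassmannian if $\ell(ws_i)=\ell(w)+1$ for all $i\ne k$. There is a bijection between $k$-strict partitions $\lambda$ and $k$-Grassmannian elements $w_\lambda$: if $w_\lambda=(w_1,\ldots,w_n)\in W_n$ (so $0<w_1<\cdots<w_k$ and $w_{k+1}<\cdots<w_n$), then for $1\le i\le n-k$, $\lambda_i=k+|w_{k+i}|$ if $w_{k+i}<0$, and $\lambda_i=\#\{p\le k : w_p>w_{k+i}\}$ if $w_{k+i}>0$. Divided differences: $W_\infty$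 acts on $\mathbb Z[c,t]$ by ring automorphisms: for $i\ge1$, $s_i$ interchanges $t_i$ and $t_{i+1}$ and fixes all other variables; $s_0$ maps $t_1$ to $-t_1$, fixes $t_j$ for $j\ge2$, and satisfies $s_0(c_p)=c_p+2\sum_{j=1}^p(-t_1)^jc_{p-j}$ for each $p\ge 0$. Define operators on $\mathbb Z[c,t]$ by $\partial_0f:=(f-s_0f)/(2t_1)$ and $\partial_if:=(f-s_if)/(t_{i+1}-t_i)$ for $i\ge1$. *)

theory Defs
  imports
    "HOL-Library.Poly_Mapping"
    "HOL-Library.Multiset"
    "HOL-Library.Groups_Big_Fun"
    "HOL-Combinatorics.Transposition"
    "HOL-Computational_Algebra.Formal_Power_Series"
begin

subsection \<open>The polynomial ring in the variables c and t\<close>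

text \<open>
  \<open>CVar n\<close> and \<open>TVar n\<close> stand for the variables \<open>c\<close> and \<open>t\<close> with index \<open>n + 1\<close>, so that there are
  no superfluous variables of index \<open>0\<close>. A polynomial maps a monomial (a finitely supported
  exponent function) to its integer coefficient.
\<close>

datatype var = CVar nat | TVar nat

type_synonym zct = "(var \<Rightarrow>\<^sub>0 nat) \<Rightarrow>\<^sub>0 int"

text \<open>
  The order of the variables is only a technical device: it makes the library's \<^class>\<open>idom\<close>
  instance for \<^type>\<open>poly_mapping\<close> applicable to \<^typ>\<open>zct\<close>.
\<close>

fun var_code :: "var \<Rightarrow> nat" where
  "var_code (CVar n) = 2 * n"
| "var_code (TVar n) = Suc (2 * n)"

lemma var_code_inj: "var_code x = var_code y \<Longrightarrow> x = y"
  by (cases x; cases y) (auto, (presburger+)?)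

instantiation var :: linorder
begin

definition less_eq_var :: "var \<Rightarrow> var \<Rightarrow> bool" where
  "less_eq_var x y \<longleftrightarrow> var_code x \<le> var_code y"

definition less_var :: "var \<Rightarrow> var \<Rightarrow> bool" where
  "less_var x y \<longleftrightarrow> var_code x < var_code y"

instance
  by standard (auto simp: less_eq_var_def less_var_def intro: var_code_inj)

end

lemma zct_no_zero_divisors: "f * g = 0 \<Longrightarrow> f = 0 \<or> g = (0 :: zct)"
  by simp

definition poly_var :: "var \<Rightarrow> zct" where
  "poly_var v = Poly_Mapping.single (Poly_Mapping.single v 1) 1"

definition c_poly :: "int \<Rightarrow> zct" where
  "c_poly p = (if p < 0 then 0 else if p = 0 then 1 else poly_var (CVar (nat p - 1)))"

text \<open>Only used for indices \<open>i \<ge> 1\<close>.\<close>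

definition t_poly :: "nat \<Rightarrow> zct" where
  "t_poly i = poly_var (TVar (i - 1))"

definition poly_subst :: "(var \<Rightarrow> zct) \<Rightarrow> zct \<Rightarrow> zct" where
  "poly_subst \<sigma> f = (\<Sum>m\<in>Poly_Mapping.keys f.
     of_int (Poly_Mapping.lookup f m) *
     (\<Prod>v\<in>Poly_Mapping.keys m. \<sigma> v ^ Poly_Mapping.lookup m v))"


subsection \<open>Symmetric polynomials and the elements \<open>c\<^sub>p\<^sup>r\<close>\<close>

text \<open>Both give the Kronecker delta of \<open>0\<close> and \<open>j\<close> for \<open>r = 0\<close>.\<close>

definition elem_sym :: "nat \<Rightarrow> nat \<Rightarrow> (nat \<Rightarrow> 'a::comm_ring_1) \<Rightarrow> 'a" where
  "elem_sym r j x = (\<Sum>S | S \<subseteq> {1..r} \<and> card S = j. \<Prod>i\<in>S. x i)"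

definition complete_sym :: "nat \<Rightarrow> nat \<Rightarrow> (nat \<Rightarrow> 'a::comm_ring_1) \<Rightarrow> 'a" where
  "complete_sym r j x = (\<Sum>M\<in>multisets_of_size {1..r} j. \<Prod>i\<in>#M. x i)"

definition h_sym :: "int \<Rightarrow> nat \<Rightarrow> (nat \<Rightarrow> 'a::comm_ring_1) \<Rightarrow> 'a" where
  "h_sym r j x = (if r < 0 then elem_sym (nat (- r)) j x else complete_sym (nat r) j x)"

definition c_shift :: "int \<Rightarrow> int \<Rightarrow> zct" where
  "c_shift r p = (if p < 0 then 0
     else \<Sum>j = 0..nat p. c_poly (p - int j) * h_sym r j (\<lambda>i. - t_poly i))"

text \<open>
  Integer sequences are indexed by \<open>1, 2, \<dots>\<close>; the entry at \<open>0\<close> is ignored. Since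
  \<open>c_shift r 0 = 1\<close>, the infinite product reduces to the support of \<open>\<alpha>\<close>.
\<close>

lemma c_shift_0 [simp]: "c_shift r 0 = 1"
proof -
  have "{S. S \<subseteq> {Suc 0..n} \<and> card S = 0} = {{}}" for n
    by (auto dest: finite_subset)
  then show ?thesis
    by (simp add: c_shift_def c_poly_def h_sym_def elem_sym_def complete_sym_def)
qed

definition c_prod :: "(nat \<Rightarrow> int) \<Rightarrow> (nat \<Rightarrow> int) \<Rightarrow> zct" where
  "c_prod \<beta> \<alpha> = (\<Prod>i | i \<ge> 1 \<and> \<alpha> i \<noteq> 0. c_shift (\<beta> i) (\<alpha> i))"


subsection \<open>Raising operators\<close>

text \<open>
  A monomial in the \<open>R\<^sub>i\<^sub>j\<close> is a finitely supported exponent function \<open>m\<close> on pairs \<open>(i, j)\<close>;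
  \<open>apply_raising m \<alpha>\<close> is its action on an integer sequence, as confirmed by the three lemmas
  that follow.
\<close>

type_synonym raising = "(nat \<times> nat) \<Rightarrow>\<^sub>0 nat"

definition apply_raising :: "raising \<Rightarrow> (nat \<Rightarrow> int) \<Rightarrow> (nat \<Rightarrow> int)" where
  "apply_raising m \<alpha> = (\<lambda>l. \<alpha> l + (\<Sum>(i, j)\<in>Poly_Mapping.keys m.
     int (Poly_Mapping.lookup m (i, j)) * (of_bool (l = i) - of_bool (l = j))))"

lemma apply_raising_0: "apply_raising 0 \<alpha> = \<alpha>"
  by (simp add: apply_raising_def)

lemma apply_raising_single:
  assumes "i \<noteq> j"
  shows "apply_raising (Poly_Mapping.single (i, j) 1) \<alpha> = \<alpha>(i := \<alpha> i + 1, j := \<alpha> j - 1)"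
  using assms by (auto simp: apply_raising_def fun_eq_iff)

lemma apply_raising_add: "apply_raising (m + m') \<alpha> = apply_raising m (apply_raising m' \<alpha>)"
proof -
  define g :: "raising \<Rightarrow> nat \<Rightarrow> int" where
    "g = (\<lambda>m l. \<Sum>(i, j)\<in>Poly_Mapping.keys m.
       int (Poly_Mapping.lookup m (i, j)) * (of_bool (l = i) - of_bool (l = j)))"
  have ext: "g n l = (\<Sum>(i, j)\<in>Poly_Mapping.keys m \<union> Poly_Mapping.keys m'.
      int (Poly_Mapping.lookup n (i, j)) * (of_bool (l = i) - of_bool (l = j)))"
    if "Poly_Mapping.keys n \<subseteq> Poly_Mapping.keys m \<union> Poly_Mapping.keys m'" for n l
    unfolding g_def by (rule sum.mono_neutral_left) (use that in \<open>auto simp: in_keys_iff\<close>)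
  have "g (m + m') l = g m l + g m' l" for l
    using Poly_Mapping.keys_add[of m m']
    by (simp add: ext lookup_add sum.distrib [symmetric] case_prod_unfold algebra_simps)
  moreover have "apply_raising n \<alpha> = (\<lambda>l. \<alpha> l + g n l)" for n \<alpha>
    by (simp add: apply_raising_def g_def)
  ultimately show ?thesis
    by (simp add: fun_eq_iff)
qed

text \<open>
  A power series in the \<open>R\<^sub>i\<^sub>j\<close> is given by its coefficient function on monomials. It is applied
  term by term; \<^const>\<open>Sum_any\<close> sums the (finitely many) nonzero terms.
\<close>

definition apply_series :: "(raising \<Rightarrow> int) \<Rightarrow> (nat \<Rightarrow> int) \<Rightarrow> (nat \<Rightarrow> int) \<Rightarrow> zct" where
  "apply_series a \<beta> \<alpha> = Sum_any (\<lambda>m. of_int (a m) * c_prod \<beta> (apply_raising m \<alpha>))"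


subsection \<open>Double theta polynomials\<close>

text \<open>
  A partition is a function whose value at \<open>i \<ge> 1\<close> is the \<open>i\<close>-th part; the value at the unused
  index \<open>0\<close> is fixed to \<open>0\<close>.
\<close>

definition is_partition :: "(nat \<Rightarrow> nat) \<Rightarrow> bool" where
  "is_partition lam \<longleftrightarrow> lam 0 = 0 \<and> finite {i. lam i \<noteq> 0} \<and> (\<forall>i\<ge>1. lam (Suc i) \<le> lam i)"

definition partition_size :: "(nat \<Rightarrow> nat) \<Rightarrow> nat" where
  "partition_size lam = (\<Sum>i | lam i \<noteq> 0. lam i)"

definition k_strict :: "nat \<Rightarrow> (nat \<Rightarrow> nat) \<Rightarrow> bool" where
  "k_strict k lam \<longleftrightarrow> is_partition lam \<and> (\<forall>i j. 1 \<le> i \<and> i < j \<and> lam i > k \<longrightarrow> lam i \<noteq> lam j)"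

definition C_set :: "nat \<Rightarrow> (nat \<Rightarrow> nat) \<Rightarrow> (nat \<times> nat) set" where
  "C_set k lam = {(i, j). 1 \<le> i \<and> i < j \<and> lam i + lam j > 2 * k + (j - i)}"

definition beta :: "nat \<Rightarrow> (nat \<Rightarrow> nat) \<Rightarrow> nat \<Rightarrow> int" where
  "beta k lam j = int k + 1 - int (lam j) + int (card {i. 1 \<le> i \<and> i < j \<and> (i, j) \<notin> C_set k lam})"

text \<open>
  The factor of the raising operator \<open>R\<^sup>\<lambda>\<close> belonging to \<open>(i, j)\<close>, as a power series in
  \<open>X = R\<^sub>i\<^sub>j\<close>; the second factor of the product below is the expansion of \<open>(1 + X)\<^sup>-\<^sup>1\<close>.
\<close>

definition R_factor :: "nat \<Rightarrow> (nat \<Rightarrow> nat) \<Rightarrow> nat \<times> nat \<Rightarrow> int fps" where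
  "R_factor k lam = (\<lambda>(i, j).
     if 1 \<le> i \<and> i < j
     then (1 - fps_X) * (if (i, j) \<in> C_set k lam then Abs_fps (\<lambda>s. (-1) ^ s) else 1)
     else 1)"

lemma one_plus_X_inverse: "(1 + fps_X) * Abs_fps (\<lambda>s. (-1) ^ s) = (1 :: int fps)"
proof (rule fps_ext)
  fix n show "fps_nth ((1 + fps_X) * Abs_fps (\<lambda>s. (-1) ^ s)) n = fps_nth (1 :: int fps) n"
    by (cases n) (simp_all add: distrib_right)
qed

text \<open>
  Distinct pairs give series in distinct variables, each with constant term \<open>1\<close>. Hence the
  coefficient of a monomial \<open>m\<close> in the infinite product of all factors is the product over all
  pairs of the coefficients of the individual exponents, and only the pairs occurring in \<open>m\<close>
  contribute a value different from \<open>1\<close>.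
\<close>

lemma R_factor_nth_0: "fps_nth (R_factor k lam ij) 0 = 1"
  by (simp add: R_factor_def split: prod.split)

definition R_series :: "nat \<Rightarrow> (nat \<Rightarrow> nat) \<Rightarrow> raising \<Rightarrow> int" where
  "R_series k lam m = (\<Prod>ij\<in>Poly_Mapping.keys m. fps_nth (R_factor k lam ij) (Poly_Mapping.lookup m ij))"

definition double_theta :: "nat \<Rightarrow> (nat \<Rightarrow> nat) \<Rightarrow> zct" where
  "double_theta k lam = apply_series (R_series k lam) (beta k lam) (\<lambda>i. int (lam i))"


subsection \<open>The infinite hyperoctahedral group\<close>

text \<open>
  Signed permutations are odd bijections of the integers, with composition as product; the
  one-line notation of \<open>w\<close> is \<open>w 1, w 2, \<dots>\<close>
\<close>

definition W :: "nat \<Rightarrow> (int \<Rightarrow> int) set" where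
  "W n = {w. bij w \<and> (\<forall>x. w (- x) = - w x) \<and> (\<forall>x. \<bar>x\<bar> > int n \<longrightarrow> w x = x)}"

definition W_inf :: "(int \<Rightarrow> int) set" where
  "W_inf = (\<Union>n. W n)"

definition simple_refl :: "nat \<Rightarrow> int \<Rightarrow> int" where
  "simple_refl i =
     (if i = 0 then transpose 1 (-1)
      else transpose (int i) (int i + 1) \<circ> transpose (- int i) (- int i - 1))"

definition W_length :: "(int \<Rightarrow> int) \<Rightarrow> nat" where
  "W_length w = (LEAST n. \<exists>is. length is = n \<and> w = foldr (\<lambda>i v. simple_refl i \<circ> v) is id)"

definition k_grassmannian :: "nat \<Rightarrow> (int \<Rightarrow> int) \<Rightarrow> bool" where
  "k_grassmannian k w \<longleftrightarrow>
     w \<in> W_inf \<and> (\<forall>i. i \<noteq> k \<longrightarrow> W_length (w \<circ> simple_refl i) = W_length w + 1)"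

text \<open>
  The map from \<open>k\<close>-Grassmannian elements to partitions does not depend on the \<open>n \<ge> k\<close> with
  \<open>w \<in> W n\<close>: for \<open>i > n - k\<close> the value below is \<open>0\<close>, because \<open>w\<close> fixes \<open>k + i > n\<close>.
\<close>

definition grassmannian_shape :: "nat \<Rightarrow> (int \<Rightarrow> int) \<Rightarrow> nat \<Rightarrow> nat" where
  "grassmannian_shape k w i =
     (if i = 0 then 0
      else if w (int (k + i)) < 0 then k + nat \<bar>w (int (k + i))\<bar>
      else card {p. 1 \<le> p \<and> p \<le> k \<and> w (int p) > w (int (k + i))})"

text \<open>The element \<open>w\<^sub>\<lambda>\<close>.\<close>

definition w_of :: "nat \<Rightarrow> (nat \<Rightarrow> nat) \<Rightarrow> int \<Rightarrow> int" where
  "w_of k = the_inv_into {w. k_grassmannian k w} (grassmannian_shape k)"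


subsection \<open>Divided differences\<close>

fun refl_var :: "nat \<Rightarrow> var \<Rightarrow> zct" where
  "refl_var i (CVar n) =
     (if i = 0
      then c_poly (int (n + 1)) +
        2 * (\<Sum>j = 1..n + 1. (- t_poly 1) ^ j * c_poly (int (n + 1) - int j))
      else poly_var (CVar n))"
| "refl_var i (TVar n) =
     (if i = 0
      then (if n = 0 then - t_poly 1 else poly_var (TVar n))
      else t_poly (transpose i (i + 1) (n + 1)))"

definition refl_act :: "nat \<Rightarrow> zct \<Rightarrow> zct" where
  "refl_act i = poly_subst (refl_var i)"

definition dd_denom :: "nat \<Rightarrow> zct" where
  "dd_denom i = (if i = 0 then 2 * t_poly 1 else t_poly (i + 1) - t_poly i)"

text \<open>
  The exact quotient of \<open>f - s\<^sub>i f\<close> by \<open>2 t\<^sub>1\<close> or \<open>t\<^sub>i\<^sub>+\<^sub>1 - t\<^sub>i\<close>. It always exists, as can be checked on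
  the variables, and is unique because \<^typ>\<open>zct\<close> is an integral domain.
\<close>

definition divided_diff :: "nat \<Rightarrow> zct \<Rightarrow> zct" where
  "divided_diff i f = (THE g. dd_denom i * g = f - refl_act i f)"

end

theory Submission
  imports Defs
begin

text \<open>
  The polynomial \<open>\<Theta>\<^sub>\<lambda>\<close> is a finite linear combination of products of the \<open>c\<^sub>p\<^sup>r\<close>, and a simple reflection
  sees only their upper indices: \<open>s\<^sub>i\<close> fixes \<open>c\<^sub>p\<^sup>r\<close> unless \<open>\<bar>r\<bar> = i\<close>, and in that case \<open>\<partial>\<^sub>i c\<^sub>p\<^sup>r\<close> is
  \<open>c\<close> with upper index \<open>r + 1\<close> and lower index \<open>p - 1\<close> (\<open>refl_act_c_shift_invariant\<close>,
  \<open>c_shift_diff_refl_act\<close>). The upper indices are known: \<open>\<beta>\<^sub>j(\<lambda>)\<close> is the entry of \<open>w\<^sub>\<lambda>\<close> at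
  position \<open>k + j\<close>, increased by one if it is negative (\<open>beta_grassmannian_shape\<close>), and a pair
  \<open>(i, j)\<close> belongs to \<open>C(\<lambda>)\<close> iff the entries at \<open>k + i\<close> and \<open>k + j\<close> have a negative sum
  (\<open>C_set_grassmannian_shape\<close>). So only the rows \<open>j\<close> for which \<open>w\<^sub>\<lambda>\<close> has the entry \<open>i\<close> or \<open>-i-1\<close>
  at position \<open>k + j\<close> are affected by \<open>\<partial>\<^sub>i\<close>, and there are two situations
  (\<open>left_ascent_effect\<close>).

  If there is one such row \<open>r\<close>, then \<open>\<lambda>\<close> and \<open>\<mu>\<close> differ by a box in row \<open>r\<close>, \<open>C(\<lambda>) = C(\<mu>)\<close>, and
  \<open>\<beta>(\<mu>)\<close> arises from \<open>\<beta>(\<lambda>)\<close> by increasing the \<open>r\<close>-th index. Both polynomials use the same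
  series of raising operators, and \<open>\<partial>\<^sub>i\<close> turns each term for \<open>\<lambda>\<close> into the corresponding term for
  \<open>\<mu>\<close>.

  If there are two such rows \<open>r < s\<close>, their upper indices in \<open>\<Theta>\<^sub>\<lambda>\<close> are \<open>-i\<close> and \<open>i\<close>, and the twisted
  Leibniz rule gives two terms: the lower index drops either in row \<open>r\<close> or in row \<open>s\<close>. Thus \<open>\<partial>\<^sub>i\<close> of
  a product is \<open>1 + R\<^sub>r\<^sub>s\<close> applied to the expected product. This is what is needed, because
  \<open>C(\<lambda>)\<close> is \<open>C(\<mu>)\<close> together with \<open>(r, s)\<close>, so that \<open>R\<^sup>\<lambda>\<close> has an additional factor
  \<open>(1 + R\<^sub>r\<^sub>s)\<^sup>-\<^sup>1\<close> (\<open>R_series_remove_pair\<close>).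

  These arguments need \<open>w\<^sub>\<lambda>\<close> explicitly. The length function is half of a count of inversions
  (\<open>W_length_eq\<close>), whence \<open>k\<close>-Grassmannian elements are those increasing on \<open>{1..k}\<close> and beyond
  \<open>k\<close>, with positive entries on \<open>{1..k}\<close>. The passage to the shape is injective because the
  \<open>\<beta>\<^sub>j\<close> recover the entries (\<open>grassmannian_shape_inj\<close>), and every \<open>k\<close>-strict partition is a
  shape by a direct construction (\<open>exists_k_grassmannian_of_shape\<close>).
\<close>

section \<open>The reflections as ring endomorphisms\<close>

definition monom_subst :: "(var \<Rightarrow> zct) \<Rightarrow> (var \<Rightarrow>\<^sub>0 nat) \<Rightarrow> zct" where
  "monom_subst \<sigma> m = (\<Prod>v\<in>Poly_Mapping.keys m. \<sigma> v ^ Poly_Mapping.lookup m v)"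

lemma monom_subst_superset:
  assumes "finite S" "Poly_Mapping.keys m \<subseteq> S"
  shows "monom_subst \<sigma> m = (\<Prod>v\<in>S. \<sigma> v ^ Poly_Mapping.lookup m v)"
  unfolding monom_subst_def
  by (rule prod.mono_neutral_left) (use assms in \<open>auto simp: in_keys_iff\<close>)

lemma monom_subst_add: "monom_subst \<sigma> (m + n) = monom_subst \<sigma> m * monom_subst \<sigma> n"
proof -
  let ?S = "Poly_Mapping.keys m \<union> Poly_Mapping.keys n"
  have "monom_subst \<sigma> l = (\<Prod>v\<in>?S. \<sigma> v ^ Poly_Mapping.lookup l v)"
    if "Poly_Mapping.keys l \<subseteq> ?S" for l
    using that by (intro monom_subst_superset) auto
  then show ?thesis
    using Poly_Mapping.keys_add[of m n]
    by (simp add: lookup_add power_add prod.distrib)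
qed

lemma poly_subst_alt:
  "poly_subst \<sigma> f = (\<Sum>m\<in>Poly_Mapping.keys f. of_int (Poly_Mapping.lookup f m) * monom_subst \<sigma> m)"
  by (simp add: poly_subst_def monom_subst_def)

lemma poly_subst_add: "poly_subst \<sigma> (f + g) = poly_subst \<sigma> f + poly_subst \<sigma> g"
  unfolding poly_subst_alt
  by (rule setsum_keys_plus_distrib) (auto simp: algebra_simps)

lemma poly_subst_0 [simp]: "poly_subst \<sigma> 0 = 0"
  by (simp add: poly_subst_def)

lemma poly_subst_sum: "poly_subst \<sigma> (sum f A) = (\<Sum>x\<in>A. poly_subst \<sigma> (f x))"
  by (induction A rule: infinite_finite_induct) (auto simp: poly_subst_add)

lemma poly_subst_single:
  "poly_subst \<sigma> (Poly_Mapping.single m a) = of_int a * monom_subst \<sigma> m"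
  by (cases "a = 0") (auto simp: poly_subst_alt)

lemma poly_mapping_eq_sum_single:
  "f = (\<Sum>m\<in>Poly_Mapping.keys f. Poly_Mapping.single m (Poly_Mapping.lookup f m))"
proof (rule poly_mapping_eqI)
  fix m
  show "Poly_Mapping.lookup f m = Poly_Mapping.lookup
      (\<Sum>m\<in>Poly_Mapping.keys f. Poly_Mapping.single m (Poly_Mapping.lookup f m)) m"
    by (auto simp: lookup_sum lookup_single when_def in_keys_iff)
qed

lemma poly_subst_mult: "poly_subst \<sigma> (f * g) = poly_subst \<sigma> f * poly_subst \<sigma> g"
proof -
  have "f * g = (\<Sum>m\<in>Poly_Mapping.keys f. Poly_Mapping.single m (Poly_Mapping.lookup f m)) *
      (\<Sum>n\<in>Poly_Mapping.keys g. Poly_Mapping.single n (Poly_Mapping.lookup g n))"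
    using poly_mapping_eq_sum_single[of f] poly_mapping_eq_sum_single[of g] by simp
  also have "\<dots> = (\<Sum>m\<in>Poly_Mapping.keys f. \<Sum>n\<in>Poly_Mapping.keys g.
      Poly_Mapping.single (m + n) (Poly_Mapping.lookup f m * Poly_Mapping.lookup g n))"
    by (simp add: sum_product mult_single)
  finally have "poly_subst \<sigma> (f * g) = (\<Sum>m\<in>Poly_Mapping.keys f. \<Sum>n\<in>Poly_Mapping.keys g.
      (of_int (Poly_Mapping.lookup f m) * monom_subst \<sigma> m) *
      (of_int (Poly_Mapping.lookup g n) * monom_subst \<sigma> n))"
    by (simp add: poly_subst_sum poly_subst_single monom_subst_add algebra_simps)
  then show ?thesis
    by (simp add: poly_subst_alt sum_product)
qed

lemma poly_subst_1 [simp]: "poly_subst \<sigma> 1 = 1"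
  using poly_subst_single[of \<sigma> 0 1] by (simp add: monom_subst_def)

lemma poly_subst_uminus: "poly_subst \<sigma> (- f) = - poly_subst \<sigma> f"
  using poly_subst_add[of \<sigma> f "- f"] by (simp add: eq_neg_iff_add_eq_0 add.commute)

lemma poly_subst_var: "poly_subst \<sigma> (poly_var v) = \<sigma> v"
  by (simp add: poly_var_def poly_subst_single monom_subst_def)

lemma refl_act_add: "refl_act i (f + g) = refl_act i f + refl_act i g"
  and refl_act_mult: "refl_act i (f * g) = refl_act i f * refl_act i g"
  and refl_act_sum: "refl_act i (sum h A) = (\<Sum>x\<in>A. refl_act i (h x))"
  and refl_act_0 [simp]: "refl_act i 0 = 0"
  and refl_act_1 [simp]: "refl_act i 1 = 1"
  and refl_act_uminus: "refl_act i (- f) = - refl_act i f"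
  by (simp_all add: refl_act_def poly_subst_add poly_subst_mult poly_subst_sum poly_subst_uminus)

lemma refl_act_diff: "refl_act i (f - g) = refl_act i f - refl_act i g"
  using refl_act_add[of i f "- g"] by (simp add: refl_act_uminus)

lemma refl_act_prod: "refl_act i (prod h A) = (\<Prod>x\<in>A. refl_act i (h x))"
  by (induction A rule: infinite_finite_induct) (auto simp: refl_act_mult)

lemma refl_act_of_int: "refl_act i (of_int n) = of_int n"
proof -
  have "refl_act i (of_nat m) = of_nat m" for m
    by (induction m) (auto simp: refl_act_add)
  then show ?thesis
    by (cases n) (auto simp: refl_act_uminus refl_act_diff)
qed

lemma refl_act_t_poly:
  assumes "j \<ge> 1"
  shows "refl_act i (t_poly j) =
    (if i = 0 then (if j = 1 then - t_poly 1 else t_poly j) else t_poly (transpose i (i + 1) j))"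
  using assms by (auto simp: t_poly_def refl_act_def poly_subst_var)

lemma refl_act_c_poly: "i \<ge> 1 \<Longrightarrow> refl_act i (c_poly p) = c_poly p"
  by (simp add: c_poly_def refl_act_def poly_subst_var)

lemma refl_act_0_c_poly:
  "refl_act 0 (c_poly (int n)) =
     c_poly (int n) + 2 * (\<Sum>j = 1..n. (- t_poly 1) ^ j * c_poly (int n - int j))"
proof (cases n)
  case 0
  then show ?thesis by (simp add: c_poly_def)
next
  case (Suc m)
  have "c_poly (int n) = poly_var (CVar m)"
    using Suc by (simp add: c_poly_def nat_add_distrib)
  then have "refl_act 0 (c_poly (int n)) = refl_var 0 (CVar m)"
    by (simp add: refl_act_def poly_subst_var)
  then show ?thesis
    using Suc by simp
qed

lemma dd_denom_nonzero: "dd_denom i \<noteq> 0"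
proof (cases "i = 0")
  case True
  have "t_poly 1 \<noteq> 0"
    unfolding t_poly_def poly_var_def by (metis lookup_single_eq lookup_zero zero_neq_one)
  moreover have "(2::zct) \<noteq> 0"
  proof
    assume "(2::zct) = 0"
    then have "Poly_Mapping.lookup (2::zct) 0 = 0" by simp
    then show False by (simp add: lookup_numeral)
  qed
  ultimately show ?thesis
    using True by (auto simp: dd_denom_def dest: zct_no_zero_divisors)
next
  case False
  have "t_poly (i + 1) \<noteq> t_poly i"
  proof
    assume "t_poly (i + 1) = t_poly i"
    then have "Poly_Mapping.lookup (t_poly (i + 1)) (Poly_Mapping.single (TVar i) 1) =
      Poly_Mapping.lookup (t_poly i) (Poly_Mapping.single (TVar i) 1)" by simp
    moreover have "Poly_Mapping.single (TVar (i - 1)) (1::nat) \<noteq> Poly_Mapping.single (TVar i) 1"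
    proof
      assume "Poly_Mapping.single (TVar (i - 1)) (1::nat) = Poly_Mapping.single (TVar i) 1"
      then have "Poly_Mapping.lookup (Poly_Mapping.single (TVar (i - 1)) (1::nat)) (TVar i) = 1"
        by simp
      then show False
        using False by (cases i) (auto simp: lookup_single)
    qed
    ultimately show False
      by (simp add: t_poly_def poly_var_def lookup_single)
  qed
  then show ?thesis
    using False by (simp add: dd_denom_def)
qed

text \<open>
  Exhibiting a quotient determines the divided difference, because the ring is an integral domain.
\<close>

lemma divided_diff_eqI:
  assumes "dd_denom i * g = f - refl_act i f"
  shows "divided_diff i f = g"
  unfolding divided_diff_def
proof (rule the_equality[where P = "\<lambda>g. dd_denom i * g = f - refl_act i f"])
  fix h assume "dd_denom i * h = f - refl_act i f"
  then have "dd_denom i * (h - g) = 0"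
    using assms by (simp only: right_diff_distrib diff_self)
  from zct_no_zero_divisors[OF this] show "h = g"
    using dd_denom_nonzero[of i] by (simp only: right_minus_eq) auto
qed (use assms in simp)

section \<open>Recurrences and reflections of the shifted classes\<close>

lemma elem_sym_0: "elem_sym r 0 x = 1"
proof -
  have "{S. S \<subseteq> {1..r} \<and> card S = 0} = {{}}"
    by (auto dest: finite_subset)
  then show ?thesis by (simp add: elem_sym_def)
qed

lemma complete_sym_0: "complete_sym r 0 x = 1"
  by (simp add: complete_sym_def)

text \<open>
  The subsets of \<open>{1..r+1}\<close> either avoid \<open>r + 1\<close> or arise by inserting it.
\<close>

lemma elem_sym_Suc:
  "elem_sym (Suc r) (Suc j) x = elem_sym r (Suc j) x + x (Suc r) * elem_sym r j x"
proof -
  let ?A = "\<lambda>j. {S. S \<subseteq> {1..r} \<and> card S = j}"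
  have fin: "finite (?A j)" for j
    by simp
  have fS: "finite S \<and> Suc r \<notin> S" if "S \<in> ?A j" for S j
    using that by (auto dest: finite_subset)
  have "{S. S \<subseteq> {1..Suc r} \<and> card S = Suc j} = ?A (Suc j) \<union> insert (Suc r) ` ?A j"
  proof (intro equalityI subsetI)
    fix S assume S: "S \<in> {S. S \<subseteq> {1..Suc r} \<and> card S = Suc j}"
    show "S \<in> ?A (Suc j) \<union> insert (Suc r) ` ?A j"
    proof (cases "Suc r \<in> S")
      case True
      then have "S = insert (Suc r) (S - {Suc r})" "S - {Suc r} \<in> ?A j"
        using S by (auto simp: le_Suc_eq)
      then show ?thesis by blast
    next
      case False
      then show ?thesis using S by (auto simp: atLeastAtMostSuc_conv)
    qed
  next
    fix S assume "S \<in> ?A (Suc j) \<union> insert (Suc r) ` ?A j"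
    then show "S \<in> {S. S \<subseteq> {1..Suc r} \<and> card S = Suc j}"
    proof
      assume "S \<in> insert (Suc r) ` ?A j"
      then obtain T where T: "S = insert (Suc r) T" "T \<in> ?A j" by blast
      then have "card S = Suc j" using fS[OF T(2)] by simp
      then show ?thesis using T by auto
    qed auto
  qed
  moreover have "?A (Suc j) \<inter> insert (Suc r) ` ?A j = {}"
    using fS[of _ "Suc j"] by blast
  moreover have "inj_on (insert (Suc r)) (?A j)"
  proof (rule inj_onI)
    fix S T assume "S \<in> ?A j" "T \<in> ?A j" "insert (Suc r) S = insert (Suc r) T"
    then show "S = T" using fS insert_ident by metis
  qed
  ultimately have "elem_sym (Suc r) (Suc j) x =
      elem_sym r (Suc j) x + (\<Sum>S\<in>?A j. \<Prod>i\<in>insert (Suc r) S. x i)"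
    unfolding elem_sym_def using fin by (simp add: sum.union_disjoint sum.reindex)
  also have "(\<Sum>S\<in>?A j. \<Prod>i\<in>insert (Suc r) S. x i) = (\<Sum>S\<in>?A j. x (Suc r) * (\<Prod>i\<in>S. x i))"
  proof (rule sum.cong)
    fix S assume "S \<in> ?A j"
    from fS[OF this] show "(\<Prod>i\<in>insert (Suc r) S. x i) = x (Suc r) * (\<Prod>i\<in>S. x i)" by simp
  qed simp
  finally show ?thesis
    by (simp add: elem_sym_def sum_distrib_left)
qed

lemma finite_multisets_of_size: "finite A \<Longrightarrow> finite (multisets_of_size A j)"
proof (induction A arbitrary: j rule: finite_induct)
  case empty
  then show ?case by (cases j) auto
qed (simp add: multisets_of_size_insert)

text \<open>
  The multisets over \<open>{1..r+1}\<close> either avoid \<open>r + 1\<close> or arise by adding one copy of it, which may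
  be present already; hence the last term involves \<open>r + 1\<close> variables.
\<close>

lemma complete_sym_Suc:
  "complete_sym (Suc r) (Suc j) x =
     complete_sym r (Suc j) x + x (Suc r) * complete_sym (Suc r) j x"
proof -
  let ?A = "multisets_of_size {1..r} (Suc j)" and ?B = "multisets_of_size {1..Suc r} j"
  have "multisets_of_size {1..Suc r} (Suc j) = ?A \<union> add_mset (Suc r) ` ?B"
  proof (intro equalityI subsetI)
    fix M assume M: "M \<in> multisets_of_size {1..Suc r} (Suc j)"
    show "M \<in> ?A \<union> add_mset (Suc r) ` ?B"
    proof (cases "Suc r \<in># M")
      case True
      then obtain N where "M = add_mset (Suc r) N"
        by (meson multi_member_split)
      then show ?thesis using M by (auto simp: multisets_of_size_def)
    next
      case False
      then show ?thesis using M by (auto simp: multisets_of_size_def atLeastAtMostSuc_conv)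
    qed
  qed (auto simp: multisets_of_size_def)
  moreover have "?A \<inter> add_mset (Suc r) ` ?B = {}"
    by (auto simp: multisets_of_size_def)
  moreover have "inj_on (add_mset (Suc r)) ?B"
    by (rule inj_onI) simp
  ultimately show ?thesis
    by (simp add: complete_sym_def sum.union_disjoint finite_multisets_of_size
        sum.reindex sum_distrib_left)
qed

lemma h_sym_0: "h_sym r 0 x = 1"
  by (simp add: h_sym_def elem_sym_0 complete_sym_0)

lemma h_sym_nonneg_Suc:
  assumes "r \<ge> 0"
  shows "h_sym (r + 1) (Suc j) x = h_sym r (Suc j) x + x (nat (r + 1)) * h_sym (r + 1) j x"
  using assms complete_sym_Suc[of "nat r" j x] by (simp add: h_sym_def nat_add_distrib)

lemma elem_sym_eq_complete_sym_zero: "elem_sym 0 j x = complete_sym 0 j x"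
proof (cases j)
  case 0
  then show ?thesis by (simp add: elem_sym_0 complete_sym_0)
next
  case (Suc n)
  then have "{S. S \<subseteq> {1..0::nat} \<and> card S = j} = {}" by fastforce
  then show ?thesis unfolding elem_sym_def complete_sym_def using Suc by (metis (no_types, lifting)
      atLeastatMost_empty multisets_of_size_empty sum.empty zero_less_Suc zero_less_one)
qed

lemma h_sym_neg_Suc:
  assumes "r < 0"
  shows "h_sym r (Suc j) x = h_sym (r + 1) (Suc j) x + x (nat (- r)) * h_sym (r + 1) j x"
proof -
  have *: "h_sym (r + 1) j x = elem_sym (nat (- r) - 1) j x" for j
    using assms by (cases "r = -1") (auto simp: h_sym_def elem_sym_eq_complete_sym_zero
      intro!: arg_cong[where f = "\<lambda>r. elem_sym r j x"])
  show ?thesis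
    using assms elem_sym_Suc[of "nat (- r) - 1" j x] unfolding * by (simp add: h_sym_def)
qed

lemma c_shift_neg: "p < 0 \<Longrightarrow> c_shift r p = 0"
  by (simp add: c_shift_def)

lemma c_shift_nat:
  "c_shift r (int n) = (\<Sum>j\<le>n. c_poly (int n - int j) * h_sym r j (\<lambda>i. - t_poly i))"
  by (simp add: c_shift_def atLeast0AtMost)

text \<open>
  Convolution with the \<open>c\<^sub>p\<close> carries recurrences for the symmetric polynomials over to the \<open>c\<^sub>p\<^sup>r\<close>.
\<close>

lemma c_shift_add_mult:
  assumes "\<And>j. h_sym r (Suc j) (\<lambda>i. - t_poly i) =
      h_sym s (Suc j) (\<lambda>i. - t_poly i) + a * h_sym u j (\<lambda>i. - t_poly i)"
  shows "c_shift r p = c_shift s p + a * c_shift u (p - 1)"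
proof (cases "p \<le> 0")
  case True
  then show ?thesis by (cases "p = 0") (simp_all add: c_shift_neg)
next
  case False
  then obtain n where p: "p = int (Suc n)"
    by (metis gr0_implies_Suc linorder_not_le pos_int_cases)
  have "c_shift r p = c_poly p +
     (\<Sum>j\<le>n. c_poly (int n - int j) * h_sym r (Suc j) (\<lambda>i. - t_poly i))" for r
    unfolding p c_shift_nat sum.atMost_Suc_shift by (simp add: h_sym_0)
  moreover have "c_shift u (p - 1) = (\<Sum>j\<le>n. c_poly (int n - int j) * h_sym u j (\<lambda>i. - t_poly i))"
    using p by (simp add: c_shift_nat)
  ultimately show ?thesis
    by (simp add: assms algebra_simps sum.distrib sum_distrib_left)
qed

lemma c_shift_rec_nonneg:
  assumes "r \<ge> 0"
  shows "c_shift r p = c_shift (r + 1) p + t_poly (nat (r + 1)) * c_shift (r + 1) (p - 1)"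
  using c_shift_add_mult[where r = "r + 1" and s = r and a = "- t_poly (nat (r + 1))" and u = "r + 1"
      and p = p, OF h_sym_nonneg_Suc[OF assms]] by simp

lemma c_shift_rec_neg:
  assumes "r < 0"
  shows "c_shift r p = c_shift (r + 1) p - t_poly (nat (- r)) * c_shift (r + 1) (p - 1)"
  using c_shift_add_mult[where r = r and s = "r + 1" and a = "- t_poly (nat (- r))" and u = "r + 1"
      and p = p, OF h_sym_neg_Suc[OF assms]] by simp

text \<open>
  In terms of generating series: \<open>1 + a u\<close> is not a zero divisor. This replaces division by
  \<open>1 + t\<^sub>r u\<close> in the computations below.
\<close>

lemma first_order_recurrence_unique:
  fixes f g :: "int \<Rightarrow> 'a::comm_ring_1"
  assumes "\<And>p. p < 0 \<Longrightarrow> f p = g p"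
    and "\<And>p. f p + a * f (p - 1) = g p + a * g (p - 1)"
  shows "f p = g p"
proof (cases "p < 0")
  case False
  define n where "n = nat p"
  have "f (int n) = g (int n)"
  proof (induction n)
    case 0
    have "f 0 + a * f (-1) = g 0 + a * g (-1)"
      using assms(2)[of 0] by simp
    then show ?case
      using assms(1)[of "-1"] by simp
  next
    case (Suc n)
    then show ?case using assms(2)[of "int (Suc n)"] by simp
  qed
  then show ?thesis using False by (simp add: n_def)
qed (use assms in auto)

lemma c_shift_0_left: "c_shift 0 p = c_poly p"
proof (cases "p < 0")
  case False
  then obtain n where p: "p = int n" by (metis nat_0_le not_less)
  have "h_sym 0 (Suc j) x = 0" for j and x :: "nat \<Rightarrow> zct"
    by (simp add: h_sym_def complete_sym_def)
  then show ?thesis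
    unfolding p c_shift_nat by (cases n) (simp_all add: h_sym_0 sum.atMost_Suc_shift del: sum.atMost_Suc)
qed (simp add: c_shift_def c_poly_def)

text \<open>
  This is \<open>s\<^sub>0 c(u) (1 + t\<^sub>1 u) = c(u) (1 - t\<^sub>1 u)\<close> for the generating series \<open>c(u) = \<Sum>\<^sub>p c\<^sub>p u\<^sup>p\<close>.
\<close>

lemma refl_act_c_shift_0_rec:
  "refl_act 0 (c_shift 0 p) + t_poly 1 * refl_act 0 (c_shift 0 (p - 1)) =
     c_shift 0 p - t_poly 1 * c_shift 0 (p - 1)"
proof (cases "p \<le> 0")
  case True
  then show ?thesis by (cases "p = 0") (simp_all add: c_shift_neg)
next
  case False
  then obtain n where p: "p = int (Suc n)"
    by (metis gr0_implies_Suc linorder_not_le pos_int_cases)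
  have "(\<Sum>j = 1..Suc n. (- t_poly 1) ^ j * c_poly (int (Suc n) - int j)) =
     - t_poly 1 * (\<Sum>j = 0..n. (- t_poly 1) ^ j * c_poly (int n - int j))"
    unfolding One_nat_def sum.shift_bounds_cl_Suc_ivl
    by (simp add: sum_distrib_left mult.assoc)
  moreover have "(\<Sum>j = 0..n. (- t_poly 1) ^ j * c_poly (int n - int j)) =
     c_poly (int n) + (\<Sum>j = 1..n. (- t_poly 1) ^ j * c_poly (int n - int j))"
    by (simp add: sum.atLeast_Suc_atMost)
  ultimately show ?thesis
    using p refl_act_0_c_poly[of n] refl_act_0_c_poly[of "Suc n"]
    by (simp add: c_shift_0_left algebra_simps del: sum.cl_ivl_Suc)
qed

text \<open>
  Together with its counterpart for negative upper indices, this computes the effect of \<open>s\<^sub>i\<close> on all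
  \<open>c\<^sub>p\<^sup>r\<close> by moving the upper index away from \<open>0\<close> one step at a time.
\<close>

lemma refl_act_c_shift_up:
  assumes "r \<ge> 0" "\<And>p. p < 0 \<Longrightarrow> g p = 0"
    and "\<And>p. refl_act i (c_shift r p) = g p + refl_act i (t_poly (nat (r + 1))) * g (p - 1)"
  shows "refl_act i (c_shift (r + 1) p) = g p"
proof (rule first_order_recurrence_unique[where a = "refl_act i (t_poly (nat (r + 1)))" and p = p
      and f = "\<lambda>p. refl_act i (c_shift (r + 1) p)" and g = g])
  fix p
  show "refl_act i (c_shift (r + 1) p) +
      refl_act i (t_poly (nat (r + 1))) * refl_act i (c_shift (r + 1) (p - 1)) =
      g p + refl_act i (t_poly (nat (r + 1))) * g (p - 1)"
    using assms(3)[of p] c_shift_rec_nonneg[OF assms(1), of p]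
    by (simp add: refl_act_add refl_act_mult)
qed (simp add: c_shift_neg assms(2))

lemma refl_act_c_shift_down:
  assumes "r < 0"
  shows "refl_act i (c_shift r p) = refl_act i (c_shift (r + 1) p) -
      refl_act i (t_poly (nat (- r))) * refl_act i (c_shift (r + 1) (p - 1))"
  using c_shift_rec_neg[OF assms, of p] by (simp add: refl_act_diff refl_act_mult)

lemma refl_act_t_poly_fixed: "j \<ge> 1 \<Longrightarrow> j \<noteq> i \<Longrightarrow> j \<noteq> i + 1 \<Longrightarrow> refl_act i (t_poly j) = t_poly j"
  and refl_act_t_poly_0: "refl_act 0 (t_poly 1) = - t_poly 1"
  and refl_act_t_poly_left: "i \<ge> 1 \<Longrightarrow> refl_act i (t_poly i) = t_poly (i + 1)"
  and refl_act_t_poly_right: "i \<ge> 1 \<Longrightarrow> refl_act i (t_poly (i + 1)) = t_poly i"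
  by (simp_all add: refl_act_t_poly)

lemma refl_act_c_shift_pos_less: "n < i \<Longrightarrow> refl_act i (c_shift (int n) p) = c_shift (int n) p"
proof (induction n arbitrary: p)
  case 0
  then show ?case by (simp add: c_shift_0_left refl_act_c_poly)
next
  case (Suc n)
  have "refl_act i (t_poly (nat (int n + 1))) = t_poly (nat (int n + 1))"
    using Suc.prems by (intro refl_act_t_poly_fixed) auto
  then have "refl_act i (c_shift (int n + 1) p) = c_shift (int n + 1) p"
    using Suc c_shift_rec_nonneg[of "int n"]
    by (intro refl_act_c_shift_up) (auto simp: c_shift_neg)
  then show ?case by (simp add: add.commute)
qed

lemma refl_act_c_shift_pos_eq:
  assumes "i \<ge> 1"
  shows "refl_act i (c_shift (int i) p) =
    c_shift (int i + 1) p + t_poly i * c_shift (int i + 1) (p - 1)"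
proof -
  obtain n where i: "i = Suc n" using assms by (cases i) auto
  have "refl_act i (c_shift (int n + 1) p) =
    c_shift (int i + 1) p + t_poly i * c_shift (int i + 1) (p - 1)"
  proof (rule refl_act_c_shift_up)
    fix p
    have n: "nat (int n + 1) = i" "nat (int i + 1) = i + 1" "int n + 1 = int i" using i by auto
    let ?c = "c_shift (int i + 1)"
    have "refl_act i (c_shift (int n) p) = c_shift (int n) p"
      using i by (intro refl_act_c_shift_pos_less) simp
    also have "\<dots> = c_shift (int i) p + t_poly i * c_shift (int i) (p - 1)"
      using c_shift_rec_nonneg[of "int n" p] unfolding n by simp
    also have "\<dots> = (?c p + t_poly (i + 1) * ?c (p - 1)) +
        t_poly i * (?c (p - 1) + t_poly (i + 1) * ?c (p - 1 - 1))"
      using c_shift_rec_nonneg[of "int i" p] c_shift_rec_nonneg[of "int i" "p - 1"] unfolding n by simp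
    finally have "refl_act i (c_shift (int n) p) = ?c p + t_poly i * ?c (p - 1) +
        t_poly (i + 1) * (?c (p - 1) + t_poly i * ?c (p - 1 - 1))"
      by (simp only: distrib_left ac_simps)
    moreover have "refl_act i (t_poly (nat (int n + 1))) = t_poly (i + 1)"
      using refl_act_t_poly_left[OF assms] i by (simp add: nat_add_distrib)
    ultimately show "refl_act i (c_shift (int n) p) = ?c p + t_poly i * ?c (p - 1) +
      refl_act i (t_poly (nat (int n + 1))) * (?c (p - 1) + t_poly i * ?c (p - 1 - 1))"
      by (simp only:)
  qed (auto simp: c_shift_neg)
  then show ?thesis using i by (simp add: add.commute)
qed

lemma refl_act_c_shift_zero:
  "refl_act 0 (c_shift 0 p) = c_shift 1 p - t_poly 1 * c_shift 1 (p - 1)"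
proof (rule first_order_recurrence_unique[where a = "t_poly 1" and p = p
      and f = "\<lambda>p. refl_act 0 (c_shift 0 p)"
      and g = "\<lambda>p. c_shift 1 p - t_poly 1 * c_shift 1 (p - 1)"])
  fix p
  have rec: "c_shift 0 q = c_shift 1 q + t_poly 1 * c_shift 1 (q - 1)" for q
    using c_shift_rec_nonneg[of 0 q] by simp
  have "refl_act 0 (c_shift 0 p) + t_poly 1 * refl_act 0 (c_shift 0 (p - 1)) =
      c_shift 1 p - t_poly 1 * (t_poly 1 * c_shift 1 (p - 1 - 1))"
    unfolding refl_act_c_shift_0_rec unfolding rec by (simp add: algebra_simps)
  then show "refl_act 0 (c_shift 0 p) + t_poly 1 * refl_act 0 (c_shift 0 (p - 1)) =
    c_shift 1 p - t_poly 1 * c_shift 1 (p - 1) +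
    t_poly 1 * (c_shift 1 (p - 1) - t_poly 1 * c_shift 1 (p - 1 - 1))"
    by (simp add: algebra_simps)
qed (simp add: c_shift_neg)

lemma refl_act_c_shift_pos_greater:
  "i < n \<Longrightarrow> refl_act i (c_shift (int n) p) = c_shift (int n) p"
proof (induction n arbitrary: p)
  case (Suc n)
  have "refl_act i (c_shift (int n + 1) p) = c_shift (int n + 1) p"
  proof (rule refl_act_c_shift_up)
    fix p
    show "refl_act i (c_shift (int n) p) = c_shift (int n + 1) p +
        refl_act i (t_poly (nat (int n + 1))) * c_shift (int n + 1) (p - 1)"
    proof (cases "n = i")
      case True
      have n: "nat (int i + 1) = i + 1" by simp
      show ?thesis
      proof (cases "i = 0")
        case True
        then show ?thesis
          using \<open>n = i\<close> refl_act_c_shift_zero[of p] refl_act_t_poly_0 by simp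
      next
        case False
        then show ?thesis
          using refl_act_c_shift_pos_eq[of i p] refl_act_t_poly_right[of i]
          unfolding True n by simp
      qed
    next
      case False
      then have "refl_act i (t_poly (nat (int n + 1))) = t_poly (nat (int n + 1))"
        using Suc.prems by (intro refl_act_t_poly_fixed) auto
      then show ?thesis
        using False Suc c_shift_rec_nonneg[of "int n" p] by (metis less_antisym of_nat_0_le_iff)
    qed
  qed (auto simp: c_shift_neg)
  then show ?case by (simp add: add.commute)
qed simp

lemma refl_act_c_shift_neg_less: "n < i \<Longrightarrow> refl_act i (c_shift (- int n) p) = c_shift (- int n) p"
proof (induction n arbitrary: p)
  case 0
  then show ?case using refl_act_c_shift_pos_less[of 0 i p] by simp
next
  case (Suc n)
  have "refl_act i (t_poly (Suc n)) = t_poly (Suc n)"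
    using Suc.prems by (intro refl_act_t_poly_fixed) auto
  moreover have "nat (- (- int (Suc n))) = Suc n" "- int (Suc n) + 1 = - int n" by simp_all
  ultimately show ?case
    using refl_act_c_shift_down[of "- int (Suc n)" i p] c_shift_rec_neg[of "- int (Suc n)" p] Suc
    by simp
qed

lemma refl_act_c_shift_neg_eq:
  assumes "i \<ge> 1"
  shows "refl_act i (c_shift (- int i) p) =
    c_shift (1 - int i) p - t_poly (i + 1) * c_shift (1 - int i) (p - 1)"
proof -
  have "refl_act i (c_shift (1 - int i) p) = c_shift (1 - int i) p" for p
    using refl_act_c_shift_neg_less[of "i - 1" i p] assms by (simp add: of_nat_diff)
  then show ?thesis
    using refl_act_c_shift_down[of "- int i" i p] assms refl_act_t_poly_left[OF assms]
    by simp
qed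

lemma refl_act_c_shift_neg_greater:
  "i < n \<Longrightarrow> refl_act i (c_shift (- int n) p) = c_shift (- int n) p"
proof (induction n arbitrary: p)
  case (Suc n)
  have n: "nat (- (- int (Suc n))) = Suc n" "- int (Suc n) + 1 = - int n" by simp_all
  note rec = refl_act_c_shift_down[of "- int (Suc n)" i p, unfolded n]
    c_shift_rec_neg[of "- int (Suc n)" p, unfolded n]
  show ?case
  proof (cases "n = i")
    case False
    then have "refl_act i (t_poly (Suc n)) = t_poly (Suc n)"
      using Suc.prems by (intro refl_act_t_poly_fixed) auto
    then show ?thesis using rec Suc False by simp
  next
    case n_eq: True
    show ?thesis
    proof (cases "i = 0")
      case True
      have zero: "c_shift 0 q = c_shift 1 q + t_poly 1 * c_shift 1 (q - 1)" for q
        using c_shift_rec_nonneg[of 0 q] by simp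
      have "refl_act 0 (c_shift (- 1) p) = c_shift 1 p - t_poly 1 * c_shift 1 (p - 1) +
          t_poly 1 * (c_shift 1 (p - 1) - t_poly 1 * c_shift 1 (p - 1 - 1))"
        using rec(1) n_eq True refl_act_t_poly_0
          refl_act_c_shift_zero[of p] refl_act_c_shift_zero[of "p - 1"] by simp
      moreover have "c_shift (- 1) p = c_shift 0 p - t_poly 1 * c_shift 0 (p - 1)"
        using rec(2) n_eq True by simp
      moreover have "- int (Suc n) = - 1" using n_eq True by simp
      moreover have "A - t * B + t * (B - t * C) = A + t * B - t * (B + t * C)" for A B C t :: zct
        by (simp add: algebra_simps)
      ultimately show ?thesis
        using True unfolding zero by (simp only:)
    next
      case False
      have neg: "c_shift (- int i) q = c_shift (1 - int i) q - t_poly i * c_shift (1 - int i) (q - 1)"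
        for q using c_shift_rec_neg[of "- int i" q] False by simp
      have "refl_act i (c_shift (- int (Suc n)) p) = refl_act i (c_shift (- int i) p) -
          t_poly i * refl_act i (c_shift (- int i) (p - 1))"
        using rec n_eq False refl_act_t_poly_right[of i] by simp
      also have "\<dots> = (c_shift (1 - int i) p - t_poly i * c_shift (1 - int i) (p - 1)) -
          t_poly (i + 1) * (c_shift (1 - int i) (p - 1) - t_poly i * c_shift (1 - int i) (p - 1 - 1))"
        using False by (simp add: refl_act_c_shift_neg_eq algebra_simps)
      also have "\<dots> = c_shift (- int (Suc n)) p"
        unfolding neg[symmetric] using rec n_eq by simp
      finally show ?thesis .
    qed
  qed
qed simp

text \<open>
  In terms of the generating series \<open>\<Sum>\<^sub>p c\<^sub>p\<^sup>r u\<^sup>p = c(u) / \<Prod>\<^sub>m\<^sub>\<le>\<^sub>r (1 + t\<^sub>m u)\<close> for \<open>r \<ge> 0\<close> and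
  \<open>c(u) \<Prod>\<^sub>m\<^sub>\<le>\<^sub>-\<^sub>r (1 - t\<^sub>m u)\<close> for \<open>r \<le> 0\<close>, a reflection \<open>s\<^sub>i\<close> with \<open>i \<ge> 1\<close> only matters if exactly one
  of \<open>t\<^sub>i\<close>, \<open>t\<^sub>i\<^sub>+\<^sub>1\<close> occurs, and \<open>s\<^sub>0\<close> replaces \<open>c(u)\<close> by \<open>c(u) (1 - t\<^sub>1 u) / (1 + t\<^sub>1 u)\<close>, which is
  compensated by the factor containing \<open>t\<^sub>1\<close> if there is one.
\<close>

lemma refl_act_c_shift_invariant:
  assumes "\<bar>r\<bar> \<noteq> int i"
  shows "refl_act i (c_shift r p) = c_shift r p"
proof (cases "r \<ge> 0")
  case True
  then obtain n where "r = int n" by (metis nat_0_le)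
  then show ?thesis
    using assms refl_act_c_shift_pos_less[of n i p] refl_act_c_shift_pos_greater[of i n p] by fastforce
next
  case False
  then obtain n where "r = - int n" by (metis linear minus_minus nat_0_le neg_0_le_iff_le)
  then show ?thesis
    using assms refl_act_c_shift_neg_less[of n i p] refl_act_c_shift_neg_greater[of i n p] by fastforce
qed

lemma c_shift_diff_refl_act:
  assumes "\<bar>r\<bar> = int i"
  shows "c_shift r p - refl_act i (c_shift r p) = dd_denom i * c_shift (r + 1) (p - 1)"
proof -
  consider "i = 0" "r = 0" | "i \<ge> 1" "r = int i" | "i \<ge> 1" "r = - int i"
    using assms by force
  then show ?thesis
  proof cases
    case 1
    then show ?thesis
      using refl_act_c_shift_zero[of p] c_shift_rec_nonneg[of 0 p]
      by (simp add: dd_denom_def algebra_simps)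
  next
    case 2
    have n: "nat (int i + 1) = i + 1" by simp
    show ?thesis
      using 2 refl_act_c_shift_pos_eq[of i p] c_shift_rec_nonneg[of "int i" p, unfolded n]
      by (simp add: dd_denom_def algebra_simps)
  next
    case 3
    have n: "1 - int i = - int i + 1" "nat (- (- int i)) = i" by simp_all
    have "c_shift (- int i) p = c_shift (- int i + 1) p - t_poly i * c_shift (- int i + 1) (p - 1)"
      using c_shift_rec_neg[of "- int i" p, unfolded n] 3 by simp
    then show ?thesis
      using 3 refl_act_c_shift_neg_eq[of i p, unfolded n]
      by (simp add: dd_denom_def left_diff_distrib)
  qed
qed

text \<open>
  Write \<open>A\<close> and \<open>B\<close> for the classes with upper indices \<open>1 - i\<close> and \<open>i + 1\<close>; both are fixed by \<open>s\<^sub>i\<close>.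
  The two factors of the product are \<open>A\<^sub>p - t\<^sub>i A\<^sub>p\<^sub>-\<^sub>1\<close> and \<open>B\<^sub>q + t\<^sub>i\<^sub>+\<^sub>1 B\<^sub>q\<^sub>-\<^sub>1\<close>, and \<open>s\<^sub>i\<close> interchanges
  \<open>t\<^sub>i\<close> and \<open>t\<^sub>i\<^sub>+\<^sub>1\<close>, so that the terms with \<open>t\<^sub>i t\<^sub>i\<^sub>+\<^sub>1\<close> cancel in the difference.
\<close>

lemma c_shift_pair_diff_refl_act:
  assumes "i \<ge> 1"
  shows "c_shift (- int i) p * c_shift (int i) q -
      refl_act i (c_shift (- int i) p) * refl_act i (c_shift (int i) q) =
    dd_denom i * (c_shift (- int i + 1) (p - 1) * c_shift (int i + 1) q +
      c_shift (- int i + 1) p * c_shift (int i + 1) (q - 1))"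
proof -
  have n: "1 - int i = - int i + 1" "nat (- (- int i)) = i" "nat (int i + 1) = i + 1" by simp_all
  have "c_shift (- int i) p = c_shift (- int i + 1) p - t_poly i * c_shift (- int i + 1) (p - 1)"
    using c_shift_rec_neg[of "- int i" p, unfolded n] assms by simp
  moreover have "c_shift (int i) q = c_shift (int i + 1) q + t_poly (i + 1) * c_shift (int i + 1) (q - 1)"
    using c_shift_rec_nonneg[of "int i" q, unfolded n] by simp
  moreover have "(a - t * a') * (b + u * b') - (a - u * a') * (b + t * b') =
      (u - t) * (a' * b + a * b')" for a a' b b' t u :: zct
    by (simp add: algebra_simps)
  moreover have "dd_denom i = t_poly (i + 1) - t_poly i"
    using assms by (simp add: dd_denom_def)
  ultimately show ?thesis
    using refl_act_c_shift_neg_eq[OF assms, of p, unfolded n] refl_act_c_shift_pos_eq[OF assms, of q]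
    by (simp only:)
qed

section \<open>Products of shifted classes\<close>

lemma c_prod_superset:
  assumes "finite S" "\<And>j. j \<in> S \<Longrightarrow> j \<ge> 1" "\<And>j. j \<ge> 1 \<Longrightarrow> \<alpha> j \<noteq> 0 \<Longrightarrow> j \<in> S"
  shows "c_prod \<beta> \<alpha> = (\<Prod>j\<in>S. c_shift (\<beta> j) (\<alpha> j))"
  unfolding c_prod_def by (rule prod.mono_neutral_left) (use assms in auto)

lemma c_prod_diff_refl_act_single:
  assumes fin: "finite {j. j \<ge> 1 \<and> \<alpha> j \<noteq> 0}" and r: "r \<ge> 1" "\<bar>\<beta> r\<bar> = int i"
    and others: "\<And>j. j \<ge> 1 \<Longrightarrow> j \<noteq> r \<Longrightarrow> \<bar>\<beta> j\<bar> \<noteq> int i"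
  shows "c_prod \<beta> \<alpha> - refl_act i (c_prod \<beta> \<alpha>) =
    dd_denom i * c_prod (\<beta>(r := \<beta> r + 1)) (\<alpha>(r := \<alpha> r - 1))"
proof -
  define S where "S = {j. j \<ge> 1 \<and> \<alpha> j \<noteq> 0} - {r}"
  have S: "finite S" "r \<notin> S" "\<And>j. j \<in> S \<Longrightarrow> j \<ge> 1 \<and> j \<noteq> r"
    using fin by (auto simp: S_def)
  define P where "P = (\<Prod>j\<in>S. c_shift (\<beta> j) (\<alpha> j))"
  have "c_prod \<beta> \<alpha> = (\<Prod>j\<in>insert r S. c_shift (\<beta> j) (\<alpha> j))"
    using S r by (intro c_prod_superset) (auto simp: S_def)
  then have 1: "c_prod \<beta> \<alpha> = c_shift (\<beta> r) (\<alpha> r) * P"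
    using S by (simp add: P_def)
  have "c_prod (\<beta>(r := \<beta> r + 1)) (\<alpha>(r := \<alpha> r - 1)) =
      (\<Prod>j\<in>insert r S. c_shift ((\<beta>(r := \<beta> r + 1)) j) ((\<alpha>(r := \<alpha> r - 1)) j))"
    using S r by (intro c_prod_superset) (auto simp: S_def)
  also have "\<dots> = c_shift (\<beta> r + 1) (\<alpha> r - 1) * P"
    using S by (auto simp: P_def intro!: prod.cong)
  finally have 2: "c_prod (\<beta>(r := \<beta> r + 1)) (\<alpha>(r := \<alpha> r - 1)) = \<dots>" .
  have "refl_act i P = P"
    unfolding P_def refl_act_prod
    by (rule prod.cong) (use S others in \<open>auto simp: refl_act_c_shift_invariant\<close>)
  then have "c_prod \<beta> \<alpha> - refl_act i (c_prod \<beta> \<alpha>) =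
      (c_shift (\<beta> r) (\<alpha> r) - refl_act i (c_shift (\<beta> r) (\<alpha> r))) * P"
    by (simp add: 1 refl_act_mult left_diff_distrib)
  then show ?thesis
    by (simp add: 2 c_shift_diff_refl_act[OF r(2)] mult.assoc)
qed

lemma c_prod_diff_refl_act_pair:
  assumes fin: "finite {j. j \<ge> 1 \<and> \<alpha> j \<noteq> 0}" and i: "i \<ge> 1" and rs: "r \<ge> 1" "s \<ge> 1" "r \<noteq> s"
    and \<beta>: "\<beta> r = - int i" "\<beta> s = int i"
    and others: "\<And>j. j \<ge> 1 \<Longrightarrow> j \<noteq> r \<Longrightarrow> j \<noteq> s \<Longrightarrow> \<bar>\<beta> j\<bar> \<noteq> int i"
  defines "\<beta>' \<equiv> \<beta>(r := \<beta> r + 1, s := \<beta> s + 1)"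
  shows "c_prod \<beta> \<alpha> - refl_act i (c_prod \<beta> \<alpha>) =
    dd_denom i * (c_prod \<beta>' (\<alpha>(r := \<alpha> r - 1)) + c_prod \<beta>' (\<alpha>(s := \<alpha> s - 1)))"
proof -
  define S where "S = {j. j \<ge> 1 \<and> \<alpha> j \<noteq> 0} - {r, s}"
  have S: "finite S" "r \<notin> S" "s \<notin> S" "\<And>j. j \<in> S \<Longrightarrow> j \<ge> 1 \<and> j \<noteq> r \<and> j \<noteq> s"
    using fin by (auto simp: S_def)
  define P where "P = (\<Prod>j\<in>S. c_shift (\<beta> j) (\<alpha> j))"
  have split: "c_prod \<gamma> \<alpha>' = c_shift (\<gamma> r) (\<alpha>' r) * c_shift (\<gamma> s) (\<alpha>' s) * P"
    if "\<And>j. j \<noteq> r \<Longrightarrow> j \<noteq> s \<Longrightarrow> \<alpha>' j = \<alpha> j \<and> \<gamma> j = \<beta> j" for \<gamma> \<alpha>'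
  proof -
    have "c_prod \<gamma> \<alpha>' = (\<Prod>j\<in>insert r (insert s S). c_shift (\<gamma> j) (\<alpha>' j))"
      using S rs that by (intro c_prod_superset) (auto simp: S_def)
    also have "\<dots> = c_shift (\<gamma> r) (\<alpha>' r) * (c_shift (\<gamma> s) (\<alpha>' s) * (\<Prod>j\<in>S. c_shift (\<gamma> j) (\<alpha>' j)))"
      using S rs by simp
    also have "(\<Prod>j\<in>S. c_shift (\<gamma> j) (\<alpha>' j)) = P"
      unfolding P_def by (rule prod.cong) (use S that in auto)
    finally show ?thesis by (simp add: mult.assoc)
  qed
  have "refl_act i P = P"
    unfolding P_def refl_act_prod
    by (rule prod.cong) (use S others in \<open>auto simp: refl_act_c_shift_invariant\<close>)
  then have "c_prod \<beta> \<alpha> - refl_act i (c_prod \<beta> \<alpha>) =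
      (c_shift (- int i) (\<alpha> r) * c_shift (int i) (\<alpha> s) -
       refl_act i (c_shift (- int i) (\<alpha> r)) * refl_act i (c_shift (int i) (\<alpha> s))) * P"
    by (simp add: split[of \<alpha> \<beta>] \<beta> refl_act_mult left_diff_distrib)
  also have "\<dots> = dd_denom i * (c_prod \<beta>' (\<alpha>(r := \<alpha> r - 1)) + c_prod \<beta>' (\<alpha>(s := \<alpha> s - 1)))"
    unfolding c_shift_pair_diff_refl_act[OF i] using rs \<beta>
    by (simp add: split \<beta>'_def algebra_simps)
  finally show ?thesis .
qed

section \<open>Applying series of raising operators\<close>

text \<open>
  On a sequence of finite support, such a series has only finitely many nonvanishing terms.
\<close>

definition admissible :: "(raising \<Rightarrow> int) \<Rightarrow> bool" where
  "admissible a \<longleftrightarrow> (\<forall>m. a m \<noteq> 0 \<longrightarrow> Poly_Mapping.keys m \<subseteq> {(i, j). 1 \<le> i \<and> i < j})"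

lemma apply_raising_superset:
  assumes "finite A" "Poly_Mapping.keys m \<subseteq> A"
  shows "apply_raising m \<alpha> l = \<alpha> l +
    (\<Sum>ij\<in>A. int (Poly_Mapping.lookup m ij) * (of_bool (l = fst ij) - of_bool (l = snd ij)))"
proof -
  have "(\<Sum>ij\<in>Poly_Mapping.keys m. int (Poly_Mapping.lookup m ij) * (of_bool (l = fst ij) - of_bool (l = snd ij))) =
    (\<Sum>ij\<in>A. int (Poly_Mapping.lookup m ij) * (of_bool (l = fst ij) - of_bool (l = snd ij)))"
    by (rule sum.mono_neutral_left) (use assms in \<open>auto simp: in_keys_iff\<close>)
  then show ?thesis by (simp add: apply_raising_def case_prod_unfold)
qed

lemma finite_bounded_poly_mappings:
  assumes "finite A"
  shows "finite {m :: 'a \<Rightarrow>\<^sub>0 nat. Poly_Mapping.keys m \<subseteq> A \<and> (\<forall>x. Poly_Mapping.lookup m x \<le> K)}"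
    (is "finite ?M")
proof (rule finite_imageD)
  have "Poly_Mapping.lookup ` ?M \<subseteq> {f. \<forall>x. (x \<in> A \<longrightarrow> f x \<in> {..K}) \<and> (x \<notin> A \<longrightarrow> f x = 0)}"
    by (auto simp: in_keys_iff subset_iff)
  then show "finite (Poly_Mapping.lookup ` ?M)"
    by (rule finite_subset) (intro finite_set_of_finite_funs assms finite_atMost)
  show "inj_on Poly_Mapping.lookup ?M"
    by (rule inj_onI) (simp add: poly_mapping_eqI)
qed

lemma finite_support_apply_raising:
  assumes "finite {j. j \<ge> 1 \<and> \<alpha> j \<noteq> 0}"
  shows "finite {j. j \<ge> 1 \<and> apply_raising m \<alpha> j \<noteq> 0}"
proof (rule finite_subset)
  show "{j. j \<ge> 1 \<and> apply_raising m \<alpha> j \<noteq> 0} \<subseteq>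
    {j. j \<ge> 1 \<and> \<alpha> j \<noteq> 0} \<union> fst ` Poly_Mapping.keys m \<union> snd ` Poly_Mapping.keys m"
  proof
    fix j assume j: "j \<in> {j. j \<ge> 1 \<and> apply_raising m \<alpha> j \<noteq> 0}"
    show "j \<in> {j. j \<ge> 1 \<and> \<alpha> j \<noteq> 0} \<union> fst ` Poly_Mapping.keys m \<union> snd ` Poly_Mapping.keys m"
    proof (rule ccontr)
      assume n: "\<not> ?thesis"
      then have "(\<Sum>ij\<in>Poly_Mapping.keys m. int (Poly_Mapping.lookup m ij) *
          (of_bool (j = fst ij) - of_bool (j = snd ij))) = 0"
        by (intro sum.neutral) force
      then show False
        using j n apply_raising_superset[of "Poly_Mapping.keys m" m \<alpha> j] by simp
    qed
  qed
qed (use assms in simp)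

lemma c_prod_nonzero_imp_nonneg:
  assumes "finite {j. j \<ge> 1 \<and> \<alpha> j \<noteq> 0}" "c_prod \<beta> \<alpha> \<noteq> 0" "j \<ge> 1"
  shows "\<alpha> j \<ge> 0"
proof (rule ccontr)
  assume "\<not> \<alpha> j \<ge> 0"
  then have "c_shift (\<beta> j) (\<alpha> j) = 0" "j \<in> {j. j \<ge> 1 \<and> \<alpha> j \<noteq> 0}"
    using assms(3) by (auto simp: c_shift_neg)
  then have "c_prod \<beta> \<alpha> = 0"
    unfolding c_prod_def using assms(1) by (intro prod_zero) auto
  with assms(2) show False by simp
qed

text \<open>
  Raising decreases \<open>\<Sum>\<^sub>l l \<alpha>\<^sub>l\<close> by at least the degree of the monomial, while this sum is
  nonnegative as long as the product of the classes does not vanish.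
\<close>

lemma finite_nonzero_terms:
  assumes fin: "finite {j. j \<ge> 1 \<and> \<alpha> j \<noteq> 0}" and a: "admissible a"
  shows "finite {m. of_int (a m) * c_prod \<beta> (apply_raising m \<alpha>) \<noteq> 0}"
proof -
  obtain L where L: "\<And>j. j \<ge> 1 \<Longrightarrow> \<alpha> j \<noteq> 0 \<Longrightarrow> j \<le> L"
    using fin by (metis (mono_tags, lifting) finite_nat_set_iff_bounded_le mem_Collect_eq)
  define A where "A = {1..L} \<times> {1..L}"
  define K where "K = nat (\<Sum>l\<in>{1..L}. int l * \<alpha> l)"
  have "Poly_Mapping.keys m \<subseteq> A \<and> (\<forall>x. Poly_Mapping.lookup m x \<le> K)"
    if "of_int (a m) * c_prod \<beta> (apply_raising m \<alpha>) \<noteq> 0" for m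
  proof -
    let ?\<alpha>' = "apply_raising m \<alpha>" and ?k = "Poly_Mapping.keys m" and ?m = "Poly_Mapping.lookup m"
    have keys: "1 \<le> fst ij \<and> fst ij < snd ij" if "ij \<in> ?k" for ij
    proof -
      have "a m \<noteq> 0"
        using \<open>of_int (a m) * c_prod \<beta> ?\<alpha>' \<noteq> 0\<close> by auto
      then have "ij \<in> {(i, j). 1 \<le> i \<and> i < j}"
        using a that unfolding admissible_def by blast
      then show ?thesis by auto
    qed
    have nonneg: "?\<alpha>' j \<ge> 0" if "j \<ge> 1" for j
    proof (rule c_prod_nonzero_imp_nonneg)
      show "c_prod \<beta> ?\<alpha>' \<noteq> 0"
        using \<open>of_int (a m) * c_prod \<beta> ?\<alpha>' \<noteq> 0\<close> by auto
    qed (use that finite_support_apply_raising[OF fin] in auto)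
    \<comment> \<open>The largest column index \<open>J\<close> occurring in \<open>m\<close> is only lowered, so beyond the support of
      \<open>\<alpha>\<close> its entry would become negative.\<close>
    have snd_le: "snd ij \<le> L" if ij: "ij \<in> ?k" for ij
    proof (rule ccontr)
      assume "\<not> snd ij \<le> L"
      define J where "J = Max (snd ` ?k)"
      have J: "J \<in> snd ` ?k" "\<And>x. x \<in> ?k \<Longrightarrow> snd x \<le> J"
        unfolding J_def using ij by (auto intro!: Max_in)
      have "J > L" using J(2)[OF ij] \<open>\<not> snd ij \<le> L\<close> by simp
      have "\<alpha> J = 0" using L[of J] \<open>J > L\<close> by auto
      obtain x where x: "x \<in> ?k" "snd x = J" using J(1) by auto
      have "(\<Sum>y\<in>?k. int (?m y) * (of_bool (J = fst y) - of_bool (J = snd y))) < (\<Sum>y\<in>?k. 0)"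
      proof (rule sum_strict_mono_ex1)
        show "\<forall>y\<in>?k. int (?m y) * (of_bool (J = fst y) - of_bool (J = snd y)) \<le> 0"
          using keys J(2) by fastforce
        show "\<exists>y\<in>?k. int (?m y) * (of_bool (J = fst y) - of_bool (J = snd y)) < 0"
          using keys[OF x(1)] x by (intro bexI[of _ x]) (auto simp: in_keys_iff)
      qed simp
      then have "?\<alpha>' J < 0"
        using apply_raising_superset[of ?k m \<alpha> J] \<open>\<alpha> J = 0\<close> by simp
      then show False using nonneg[of J] \<open>J > L\<close> by simp
    qed
    have kA: "?k \<subseteq> A"
    proof
      fix x assume "x \<in> ?k"
      then show "x \<in> A" using keys[of x] snd_le[of x] by (cases x) (auto simp: A_def)
    qed
    \<comment> \<open>Each \<open>R\<^sub>a\<^sub>b\<close> changes the weighted sum by \<open>a - b \<le> - 1\<close>.\<close>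
    have "0 \<le> (\<Sum>l\<in>{1..L}. int l * ?\<alpha>' l)"
      using nonneg by (intro sum_nonneg) auto
    also have "\<dots> = (\<Sum>l\<in>{1..L}. int l * \<alpha> l) + (\<Sum>l\<in>{1..L}. \<Sum>x\<in>?k.
        int (?m x) * (int l * (of_bool (l = fst x) - of_bool (l = snd x))))"
      by (simp add: apply_raising_superset[of ?k] distrib_left sum.distrib sum_distrib_left
          mult.left_commute)
    also have "(\<Sum>l\<in>{1..L}. \<Sum>x\<in>?k. int (?m x) * (int l * (of_bool (l = fst x) - of_bool (l = snd x)))) =
        (\<Sum>x\<in>?k. int (?m x) * (\<Sum>l\<in>{1..L}. int l * (of_bool (l = fst x) - of_bool (l = snd x))))"
      by (subst sum.swap) (simp add: sum_distrib_left)
    also have "\<dots> = (\<Sum>x\<in>?k. int (?m x) * (int (fst x) - int (snd x)))"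
    proof (rule sum.cong)
      fix x assume x: "x \<in> ?k"
      have *: "(\<Sum>l\<in>{1..L}. int l * of_bool (l = b)) = int b" if "b \<in> {1..L}" for b
        using that by (simp add: of_bool_def if_distrib[of "\<lambda>x. _ * x"] cong: if_cong)
      show "int (?m x) * (\<Sum>l\<in>{1..L}. int l * (of_bool (l = fst x) - of_bool (l = snd x))) =
          int (?m x) * (int (fst x) - int (snd x))"
        using keys[OF x] snd_le[OF x] *[of "fst x"] *[of "snd x"]
        by (simp add: right_diff_distrib sum_subtractf)
    qed simp
    also have "\<dots> \<le> (\<Sum>x\<in>?k. - int (?m x))"
    proof (rule sum_mono)
      fix x assume "x \<in> ?k"
      then have "int (fst x) - int (snd x) \<le> - 1" using keys[of x] by linarith
      then have "int (?m x) * (int (fst x) - int (snd x)) \<le> int (?m x) * (- 1)"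
        by (rule mult_left_mono) simp
      then show "int (?m x) * (int (fst x) - int (snd x)) \<le> - int (?m x)" by simp
    qed
    finally have total: "(\<Sum>x\<in>?k. int (?m x)) \<le> (\<Sum>l\<in>{1..L}. int l * \<alpha> l)"
      by (simp add: sum_negf)
    have "?m x \<le> K" for x
    proof (cases "x \<in> ?k")
      case True
      then have "int (?m x) \<le> (\<Sum>x\<in>?k. int (?m x))"
        by (intro member_le_sum) auto
      then show ?thesis using total by (simp add: K_def)
    qed (simp add: in_keys_iff)
    with kA show ?thesis by blast
  qed
  then have "{m. of_int (a m) * c_prod \<beta> (apply_raising m \<alpha>) \<noteq> 0} \<subseteq>
      {m. Poly_Mapping.keys m \<subseteq> A \<and> (\<forall>x. Poly_Mapping.lookup m x \<le> K)}"
    by blast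
  then show ?thesis
    by (rule finite_subset) (intro finite_bounded_poly_mappings, simp add: A_def)
qed

section \<open>Divided differences of double theta polynomials\<close>

lemma apply_series_superset:
  assumes "finite S" "{m. of_int (a m) * c_prod \<beta> (apply_raising m \<alpha>) \<noteq> 0} \<subseteq> S"
  shows "apply_series a \<beta> \<alpha> = (\<Sum>m\<in>S. of_int (a m) * c_prod \<beta> (apply_raising m \<alpha>))"
  unfolding apply_series_def by (rule Sum_any.expand_superset) (use assms in auto)

lemma R_series_admissible: "admissible (R_series k lam)"
  unfolding admissible_def
proof (intro allI impI subsetI)
  fix m ij assume m: "R_series k lam m \<noteq> 0" and ij: "ij \<in> Poly_Mapping.keys m"
  show "ij \<in> {(i, j). 1 \<le> i \<and> i < j}"
  proof (rule ccontr)
    assume "ij \<notin> {(i, j). 1 \<le> i \<and> i < j}"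
    then have "R_factor k lam ij = 1"
      by (auto simp: R_factor_def split: prod.split)
    then have "fps_nth (R_factor k lam ij) (Poly_Mapping.lookup m ij) = 0"
      using ij by (simp add: in_keys_iff)
    then have "R_series k lam m = 0"
      unfolding R_series_def using ij by (intro prod_zero) auto
    with m show False by simp
  qed
qed

lemma apply_raising_fun_upd:
  "apply_raising m (\<alpha>(r := \<alpha> r + x)) = (apply_raising m \<alpha>)(r := apply_raising m \<alpha> r + x)"
  by (auto simp: apply_raising_def fun_eq_iff)

text \<open>
  Only subscripts are moved by raising operators, so an identity for all products with given upper
  indices can be summed against any series.
\<close>

lemma apply_series_diff_refl_act:
  assumes fin: "finite {j. j \<ge> 1 \<and> \<alpha> j \<noteq> 0}" "finite {j. j \<ge> 1 \<and> \<alpha>' j \<noteq> 0}"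
    and a: "admissible a"
    and step: "\<And>m. c_prod \<beta> (apply_raising m \<alpha>) - refl_act i (c_prod \<beta> (apply_raising m \<alpha>)) =
      dd_denom i * c_prod \<beta>' (apply_raising m \<alpha>')"
  shows "dd_denom i * apply_series a \<beta>' \<alpha>' = apply_series a \<beta> \<alpha> - refl_act i (apply_series a \<beta> \<alpha>)"
proof -
  define S where "S = {m. of_int (a m) * c_prod \<beta> (apply_raising m \<alpha>) \<noteq> 0} \<union>
    {m. of_int (a m) * c_prod \<beta>' (apply_raising m \<alpha>') \<noteq> 0}"
  have S: "finite S"
    unfolding S_def using finite_nonzero_terms[OF _ a] fin by blast
  have "apply_series a \<beta> \<alpha> = (\<Sum>m\<in>S. of_int (a m) * c_prod \<beta> (apply_raising m \<alpha>))"
    by (rule apply_series_superset[OF S]) (auto simp: S_def)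
  moreover have "apply_series a \<beta>' \<alpha>' = (\<Sum>m\<in>S. of_int (a m) * c_prod \<beta>' (apply_raising m \<alpha>'))"
    by (rule apply_series_superset[OF S]) (auto simp: S_def)
  moreover have "dd_denom i * (of_int (a m) * c_prod \<beta>' (apply_raising m \<alpha>')) =
      of_int (a m) * c_prod \<beta> (apply_raising m \<alpha>) -
      of_int (a m) * refl_act i (c_prod \<beta> (apply_raising m \<alpha>))" for m
    by (simp only: mult.left_commute[of "dd_denom i"] step[symmetric] right_diff_distrib)
  ultimately show ?thesis
    by (simp only: refl_act_sum refl_act_mult refl_act_of_int sum_distrib_left sum_subtractf)
qed

text \<open>
  Equality of the sets \<open>C\<close> makes both the raising operators and the upper indices outside row \<open>r\<close>
  agree, so that the divided difference can be taken term by term.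
\<close>

lemma divided_diff_double_theta_one_row:
  assumes fin: "finite {j. j \<ge> 1 \<and> mu j \<noteq> 0}" and r: "r \<ge> 1" and lam: "lam = mu(r := mu r + 1)"
    and C: "C_set k lam = C_set k mu"
    and beta_r: "\<bar>beta k lam r\<bar> = int i"
    and others: "\<And>j. j \<ge> 1 \<Longrightarrow> j \<noteq> r \<Longrightarrow> \<bar>beta k lam j\<bar> \<noteq> int i"
  shows "divided_diff i (double_theta k lam) = double_theta k mu"
proof (rule divided_diff_eqI)
  have R: "R_series k mu = R_series k lam"
    unfolding R_series_def R_factor_def C ..
  have beta: "beta k mu = (beta k lam)(r := beta k lam r + 1)"
    unfolding beta_def C by (auto simp: lam fun_eq_iff)
  have mu: "(\<lambda>j. int (mu j)) = (\<lambda>j. int (lam j))(r := int (lam r) + (- 1))"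
    by (auto simp: lam fun_eq_iff)
  have fin': "finite {j. j \<ge> 1 \<and> int (lam j) \<noteq> 0}"
    by (rule finite_subset[of _ "insert r {j. j \<ge> 1 \<and> mu j \<noteq> 0}"]) (use fin lam in auto)
  show "dd_denom i * double_theta k mu = double_theta k lam - refl_act i (double_theta k lam)"
    unfolding double_theta_def R
  proof (rule apply_series_diff_refl_act)
    fix m
    show "c_prod (beta k lam) (apply_raising m (\<lambda>j. int (lam j))) -
        refl_act i (c_prod (beta k lam) (apply_raising m (\<lambda>j. int (lam j)))) =
        dd_denom i * c_prod (beta k mu) (apply_raising m (\<lambda>j. int (mu j)))"
      unfolding mu beta apply_raising_fun_upd[of m "\<lambda>j. int (lam j)"] unfolding add_uminus_conv_diff
      by (rule c_prod_diff_refl_act_single[where \<beta> = "beta k lam" and r = r])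
         (use finite_support_apply_raising[OF fin'] r beta_r others in auto)
  qed (use fin fin' in \<open>auto simp: R_series_admissible\<close>)
qed

text \<open>
  The product of a series with the variable \<open>R\<^sub>i\<^sub>j\<close>.
\<close>

definition shift_series :: "nat \<times> nat \<Rightarrow> (raising \<Rightarrow> int) \<Rightarrow> raising \<Rightarrow> int" where
  "shift_series ij a m =
     (if Poly_Mapping.lookup m ij = 0 then 0 else a (m - Poly_Mapping.single ij 1))"

lemma shift_series_add_single: "shift_series ij a (m + Poly_Mapping.single ij 1) = a m"
  by (simp add: shift_series_def lookup_add)

lemma minus_single_plus_single:
  assumes "Poly_Mapping.lookup m ij \<noteq> 0"
  shows "m = (m - Poly_Mapping.single ij 1) + Poly_Mapping.single ij (1::nat)"
  by (rule poly_mapping_eqI) (use assms in \<open>auto simp: lookup_add lookup_minus lookup_single when_def\<close>)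

lemma admissible_shift_series:
  assumes "admissible a" "1 \<le> r" "r < s"
  shows "admissible (shift_series (r, s) a)"
  unfolding admissible_def
proof (intro allI impI)
  fix m assume m: "shift_series (r, s) a m \<noteq> 0"
  then have l: "Poly_Mapping.lookup m (r, s) \<noteq> 0" "a (m - Poly_Mapping.single (r, s) 1) \<noteq> 0"
    by (auto simp: shift_series_def split: if_splits)
  have "Poly_Mapping.keys m \<subseteq>
      Poly_Mapping.keys (m - Poly_Mapping.single (r, s) 1) \<union> {(r, s)}"
    by (subst minus_single_plus_single[OF l(1)]) (use Poly_Mapping.keys_add in fastforce)
  then show "Poly_Mapping.keys m \<subseteq> {(i, j). 1 \<le> i \<and> i < j}"
    using assms l(2) unfolding admissible_def by blast
qed

text \<open>Multiplying a series by \<open>R\<^sub>r\<^sub>s\<close> amounts to applying it after the operator \<open>R\<^sub>r\<^sub>s\<close>.\<close>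

lemma apply_series_shift:
  assumes "r \<noteq> s"
  shows "apply_series (shift_series (r, s) a) \<beta> \<alpha> = apply_series a \<beta> (\<alpha>(r := \<alpha> r + 1, s := \<alpha> s - 1))"
proof -
  let ?E = "Poly_Mapping.single (r, s) (1::nat)"
  let ?f = "\<lambda>m. of_int (shift_series (r, s) a m) * c_prod \<beta> (apply_raising m \<alpha>)"
  let ?g = "\<lambda>m. of_int (a m) * c_prod \<beta> (apply_raising m (\<alpha>(r := \<alpha> r + 1, s := \<alpha> s - 1)))"
  have fg: "?f (m + ?E) = ?g m" for m
    unfolding shift_series_add_single apply_raising_add apply_raising_single[OF assms] ..
  have "(\<Sum>m | ?f m \<noteq> 0. ?f m) = (\<Sum>m | ?g m \<noteq> 0. ?g m)"
  proof (rule sum.reindex_bij_witness[of _ "\<lambda>m. m + ?E" "\<lambda>m. m - ?E"])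
    fix m assume m: "m \<in> {m. ?f m \<noteq> 0}"
    then have "Poly_Mapping.lookup m (r, s) \<noteq> 0"
      by (auto simp: shift_series_def split: if_splits)
    from minus_single_plus_single[OF this] have eq: "m - ?E + ?E = m" by simp
    then show "m - ?E + ?E = m" .
    show "m - ?E \<in> {m. ?g m \<noteq> 0}" "?g (m - ?E) = ?f m"
      using fg[of "m - ?E"] m unfolding eq by auto
  next
    fix m assume m: "m \<in> {m. ?g m \<noteq> 0}"
    show "m + ?E - ?E = m" by simp
    show "m + ?E \<in> {m. ?f m \<noteq> 0}" using fg[of m] m by auto
  qed
  then show ?thesis
    by (simp add: apply_series_def Sum_any.expand_set)
qed

lemma apply_series_add:
  assumes fin: "finite {j. j \<ge> 1 \<and> \<alpha> j \<noteq> 0}" and "admissible a" "admissible b"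
  shows "apply_series (\<lambda>m. a m + b m) \<beta> \<alpha> = apply_series a \<beta> \<alpha> + apply_series b \<beta> \<alpha>"
proof -
  define S where "S = {m. of_int (a m) * c_prod \<beta> (apply_raising m \<alpha>) \<noteq> 0} \<union>
    {m. of_int (b m) * c_prod \<beta> (apply_raising m \<alpha>) \<noteq> 0}"
  have S: "finite S"
    unfolding S_def using finite_nonzero_terms[OF fin] assms by blast
  have "apply_series a \<beta> \<alpha> = (\<Sum>m\<in>S. of_int (a m) * c_prod \<beta> (apply_raising m \<alpha>))"
    and "apply_series b \<beta> \<alpha> = (\<Sum>m\<in>S. of_int (b m) * c_prod \<beta> (apply_raising m \<alpha>))"
    by (rule apply_series_superset[OF S]; auto simp: S_def)+
  moreover have "apply_series (\<lambda>m. a m + b m) \<beta> \<alpha> =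
      (\<Sum>m\<in>S. of_int (a m + b m) * c_prod \<beta> (apply_raising m \<alpha>))"
    by (rule apply_series_superset[OF S]) (auto simp: S_def distrib_right)
  ultimately show ?thesis
    by (simp add: distrib_right sum.distrib)
qed

text \<open>
  Removing the pair \<open>(r, s)\<close> from the denominator of \<open>R\<^sup>\<lambda>\<close> multiplies the raising operator by
  \<open>1 + R\<^sub>r\<^sub>s\<close>.
\<close>

lemma R_series_remove_pair:
  assumes C: "C_set k lam = insert (r, s) (C_set k mu)" "(r, s) \<notin> C_set k mu"
  shows "R_series k mu m = R_series k lam m + shift_series (r, s) (R_series k lam) m"
proof -
  let ?E = "Poly_Mapping.single (r, s) (1::nat)" and ?l = Poly_Mapping.lookup
  define F where "F = R_factor k lam (r, s)"
  have "(r, s) \<in> C_set k lam" using C by simp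
  then have rs: "1 \<le> r" "r < s" by (auto simp: C_set_def)
  have "R_factor k mu (r, s) = 1 - fps_X"
    using rs C by (simp add: R_factor_def)
  also have "\<dots> = (1 - fps_X) * ((1 + fps_X) * Abs_fps (\<lambda>s. (-1) ^ s))"
    unfolding one_plus_X_inverse by simp
  also have "\<dots> = F + fps_X * F"
    using rs C by (simp add: F_def R_factor_def algebra_simps)
  finally have mu: "R_factor k mu (r, s) = F + fps_X * F" .
  have other: "R_factor k mu ij = R_factor k lam ij" if "ij \<noteq> (r, s)" for ij
    using that C by (auto simp: R_factor_def split: prod.split)
  define Q where "Q m = (\<Prod>ij\<in>Poly_Mapping.keys m - {(r, s)}. fps_nth (R_factor k lam ij) (?l m ij))" for m
  have split: "R_series k nu m = fps_nth (R_factor k nu (r, s)) (?l m (r, s)) * Q m"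
    if "\<And>ij. ij \<noteq> (r, s) \<Longrightarrow> R_factor k nu ij = R_factor k lam ij" for nu m
  proof -
    have "R_series k nu m =
        (\<Prod>ij\<in>insert (r, s) (Poly_Mapping.keys m - {(r, s)}). fps_nth (R_factor k nu ij) (?l m ij))"
      unfolding R_series_def
      by (rule prod.mono_neutral_left) (auto simp: in_keys_iff R_factor_nth_0)
    also have "\<dots> = fps_nth (R_factor k nu (r, s)) (?l m (r, s)) *
        (\<Prod>ij\<in>Poly_Mapping.keys m - {(r, s)}. fps_nth (R_factor k nu ij) (?l m ij))"
      by (rule prod.insert) auto
    also have "(\<Prod>ij\<in>Poly_Mapping.keys m - {(r, s)}. fps_nth (R_factor k nu ij) (?l m ij)) = Q m"
      unfolding Q_def by (rule prod.cong) (use that in auto)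
    finally show ?thesis .
  qed
  show ?thesis
  proof (cases "?l m (r, s)")
    case 0
    then show ?thesis
      by (simp add: split[OF other] split mu shift_series_def F_def[symmetric])
  next
    case (Suc n)
    have "?l (m - ?E) ij = ?l m ij" if "ij \<noteq> (r, s)" for ij
      using that by (simp add: lookup_minus lookup_single when_def)
    then have "Poly_Mapping.keys (m - ?E) - {(r, s)} = Poly_Mapping.keys m - {(r, s)}"
      unfolding set_eq_iff Diff_iff in_keys_iff by (metis singletonI)
    then have "Q (m - ?E) = Q m"
      unfolding Q_def by (intro prod.cong) (auto simp: lookup_minus lookup_single when_def)
    moreover have "?l (m - ?E) (r, s) = n"
      using Suc by (simp add: lookup_minus)
    ultimately show ?thesis
      using Suc by (simp add: split[OF other] split mu shift_series_def F_def[symmetric] distrib_right)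
  qed
qed

text \<open>
  The divided difference of each term of \<open>\<Theta>\<^sub>\<lambda>\<close> has one summand for \<open>\<mu>\<close> and one for \<open>\<mu>\<close> raised by
  \<open>R\<^sub>r\<^sub>s\<close>. Summing up gives the series of \<open>\<lambda>\<close> times \<open>1 + R\<^sub>r\<^sub>s\<close>, applied to \<open>\<mu>\<close>, and this product of
  series is the series of \<open>\<mu>\<close>.
\<close>

lemma divided_diff_double_theta_two_rows:
  assumes fin: "finite {j. j \<ge> 1 \<and> mu j \<noteq> 0}" and i: "i \<ge> 1" and lam: "lam = mu(r := mu r + 1)"
    and C: "C_set k lam = insert (r, s) (C_set k mu)" "(r, s) \<notin> C_set k mu"
    and beta_rs: "beta k lam r = - int i" "beta k lam s = int i"
    and others: "\<And>j. j \<ge> 1 \<Longrightarrow> j \<noteq> r \<Longrightarrow> j \<noteq> s \<Longrightarrow> \<bar>beta k lam j\<bar> \<noteq> int i"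
  shows "divided_diff i (double_theta k lam) = double_theta k mu"
proof (rule divided_diff_eqI)
  let ?a = "R_series k lam" and ?\<beta> = "beta k mu"
  let ?m = "\<lambda>j. int (mu j)" and ?l = "\<lambda>j. int (lam j)"
  let ?m' = "?m(r := ?m r + 1, s := ?m s - 1)"
  have "(r, s) \<in> C_set k lam" using C by simp
  then have rs: "1 \<le> r" "r < s" "1 \<le> s" "r \<noteq> s" by (auto simp: C_set_def)
  have beta: "?\<beta> = (beta k lam)(r := beta k lam r + 1, s := beta k lam s + 1)"
  proof
    fix j
    have "{i. 1 \<le> i \<and> i < j \<and> (i, j) \<notin> C_set k mu} =
        (if j = s then insert r {i. 1 \<le> i \<and> i < j \<and> (i, j) \<notin> C_set k lam}
         else {i. 1 \<le> i \<and> i < j \<and> (i, j) \<notin> C_set k lam})"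
      using C rs by auto
    moreover have "r \<notin> {i. 1 \<le> i \<and> i < s \<and> (i, s) \<notin> C_set k lam}"
      using C by auto
    ultimately show "?\<beta> j = ((beta k lam)(r := beta k lam r + 1, s := beta k lam s + 1)) j"
      using rs by (auto simp: beta_def lam)
  qed
  have mu: "?m = ?l(r := ?l r + (- 1))" and mu': "?m' = ?l(s := ?l s + (- 1))"
    using rs by (auto simp: lam fun_eq_iff)
  have fin_lam: "finite {j. j \<ge> 1 \<and> ?l j \<noteq> 0}"
    by (rule finite_subset[of _ "insert r {j. j \<ge> 1 \<and> mu j \<noteq> 0}"]) (use fin lam in auto)
  have fin_mu: "finite {j. j \<ge> 1 \<and> ?m j \<noteq> 0}"
    using fin by simp
  have fin_mu': "finite {j. j \<ge> 1 \<and> ?m' j \<noteq> 0}"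
    by (rule finite_subset[of _ "insert r (insert s {j. j \<ge> 1 \<and> mu j \<noteq> 0})"]) (use fin in auto)
  define S where "S = {m. of_int (?a m) * c_prod (beta k lam) (apply_raising m ?l) \<noteq> 0} \<union>
    {m. of_int (?a m) * c_prod ?\<beta> (apply_raising m ?m) \<noteq> 0} \<union>
    {m. of_int (?a m) * c_prod ?\<beta> (apply_raising m ?m') \<noteq> 0}"
  have S: "finite S"
    unfolding S_def finite_Un
    by (intro conjI finite_nonzero_terms R_series_admissible fin_lam fin_mu fin_mu')
  have step: "c_prod (beta k lam) (apply_raising m ?l) - refl_act i (c_prod (beta k lam) (apply_raising m ?l)) =
      dd_denom i * (c_prod ?\<beta> (apply_raising m ?m) + c_prod ?\<beta> (apply_raising m ?m'))" for m
    unfolding mu' unfolding mu beta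
    unfolding apply_raising_fun_upd[of m ?l] unfolding add_uminus_conv_diff
    by (rule c_prod_diff_refl_act_pair[where \<alpha> = "apply_raising m ?l" and r = r and s = s,
          OF finite_support_apply_raising[OF fin_lam] i rs(1,3,4) beta_rs]) (fact others)
  have "double_theta k mu = apply_series ?a ?\<beta> ?m + apply_series ?a ?\<beta> ?m'"
    unfolding double_theta_def R_series_remove_pair[OF C]
    using apply_series_add[OF fin_mu R_series_admissible admissible_shift_series[OF R_series_admissible rs(1,2)]]
      apply_series_shift[of r s ?a ?\<beta> ?m] rs(2) by simp
  also have "\<dots> = (\<Sum>m\<in>S. of_int (?a m) * c_prod ?\<beta> (apply_raising m ?m)) +
      (\<Sum>m\<in>S. of_int (?a m) * c_prod ?\<beta> (apply_raising m ?m'))"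
    by (intro arg_cong2[where f = "(+)"] apply_series_superset[OF S]) (auto simp: S_def)
  finally have "dd_denom i * double_theta k mu = (\<Sum>m\<in>S. of_int (?a m) *
      (dd_denom i * (c_prod ?\<beta> (apply_raising m ?m) + c_prod ?\<beta> (apply_raising m ?m'))))"
    by (simp only: sum.distrib[symmetric] sum_distrib_left distrib_left mult.left_commute)
  also have "\<dots> = (\<Sum>m\<in>S. of_int (?a m) * c_prod (beta k lam) (apply_raising m ?l)) -
      refl_act i (\<Sum>m\<in>S. of_int (?a m) * c_prod (beta k lam) (apply_raising m ?l))"
    unfolding step[symmetric]
    by (simp only: refl_act_sum refl_act_mult refl_act_of_int sum_subtractf right_diff_distrib)
  also have "(\<Sum>m\<in>S. of_int (?a m) * c_prod (beta k lam) (apply_raising m ?l)) = double_theta k lam"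
    unfolding double_theta_def by (rule apply_series_superset[OF S, symmetric]) (auto simp: S_def)
  finally show "dd_denom i * double_theta k mu = double_theta k lam - refl_act i (double_theta k lam)" .
qed

section \<open>Length and inversions in the hyperoctahedral group\<close>

lemma W_D:
  assumes "w \<in> W n"
  shows "bij w" "w (- x) = - w x" "\<bar>x\<bar> > int n \<Longrightarrow> w x = x"
  using assms by (auto simp: W_def)

lemma W_0: "w \<in> W n \<Longrightarrow> w 0 = 0"
  using W_D(2)[of w n 0] by simp

lemma W_eq_0_iff: "w \<in> W n \<Longrightarrow> w x = 0 \<longleftrightarrow> x = 0"
  by (metis W_0 W_D(1) bij_def injD)

lemma W_mono: "w \<in> W n \<Longrightarrow> n \<le> m \<Longrightarrow> w \<in> W m"
  by (auto simp: W_def)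

lemma W_comp: "v \<in> W n \<Longrightarrow> w \<in> W n \<Longrightarrow> v \<circ> w \<in> W n"
  by (auto simp: W_def intro: bij_comp)

lemma W_abs_le:
  assumes "w \<in> W n" "\<bar>x\<bar> \<le> int n"
  shows "\<bar>w x\<bar> \<le> int n"
proof (rule ccontr)
  assume "\<not> \<bar>w x\<bar> \<le> int n"
  then have "w (w x) = w x"
    using W_D(3)[OF assms(1)] by simp
  then have "w x = x"
    using W_D(1)[OF assms(1)] by (meson bij_def injD)
  with assms \<open>\<not> \<bar>w x\<bar> \<le> int n\<close> show False by simp
qed

lemma simple_refl_apply:
  "simple_refl i x =
     (if i = 0 then (if \<bar>x\<bar> = 1 then - x else x)
      else if x = int i then int i + 1 else if x = int i + 1 then int i
      else if x = - int i then - int i - 1 else if x = - int i - 1 then - int i else x)"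
  by (auto simp: simple_refl_def transpose_def)

lemma simple_refl_twice [simp]: "simple_refl i (simple_refl i x) = x"
  by (auto simp: simple_refl_apply)

lemma simple_refl_comp_self [simp]: "simple_refl i \<circ> simple_refl i = id"
  by (auto simp: fun_eq_iff)

lemma simple_refl_uminus: "simple_refl i (- x) = - simple_refl i x"
  by (auto simp: simple_refl_apply)

text \<open>
  A simple reflection moves every nonzero integer at most to its neighbour among the nonzero
  integers, so it can only reverse the order of two numbers that it interchanges.
\<close>

lemma simple_refl_strict_mono:
  assumes "a < b" "a \<noteq> 0" "b \<noteq> 0" "simple_refl i a \<noteq> b"
  shows "simple_refl i a < simple_refl i b"
proof (cases "i = 0")
  case True
  then show ?thesis using assms by (auto simp: simple_refl_apply split: if_splits)
next
  case False
  let ?s = "simple_refl i"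
  have close: "?s x = x \<or> ?s x = x + 1 \<or> ?s x = x - 1" for x
    using False by (auto simp: simple_refl_apply)
  have "?s b \<noteq> a" using assms(4) simple_refl_twice by metis
  moreover have "?s a \<noteq> ?s b" using assms(1) by (metis order_less_irrefl simple_refl_twice)
  ultimately show ?thesis using assms close[of a] close[of b] by (smt (verit))
qed

lemma simple_refl_less_iff:
  assumes "a \<noteq> 0" "b \<noteq> 0" "simple_refl i a \<noteq> b"
  shows "simple_refl i a < simple_refl i b \<longleftrightarrow> a < b"
proof (cases a b rule: linorder_cases)
  case greater
  have "simple_refl i b \<noteq> a" using assms(3) simple_refl_twice by metis
  then show ?thesis using simple_refl_strict_mono[of b a i] greater assms by auto
qed (use simple_refl_strict_mono[of a b i] assms in auto)

lemma simple_refl_in_W: "simple_refl i \<in> W (Suc i)"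
  unfolding W_def
proof (intro CollectI conjI allI impI)
  show "bij (simple_refl i)"
    by (rule o_bij[of "simple_refl i"]) simp_all
qed (auto simp: simple_refl_apply)

lemma comp_simple_refl_in_W_inf:
  assumes "w \<in> W_inf"
  shows "w \<circ> simple_refl i \<in> W_inf"
proof -
  from assms obtain n where "w \<in> W n" by (auto simp: W_inf_def)
  then have "w \<in> W (max n (Suc i))" "simple_refl i \<in> W (max n (Suc i))"
    using W_mono simple_refl_in_W by (metis max.cobounded1 max.cobounded2)+
  then show ?thesis
    using W_comp unfolding W_inf_def by blast
qed

text \<open>
  All pairs of nonzero positions are counted, rather than one of \<open>(a, b)\<close> and \<open>(-b, -a)\<close>, because a
  simple reflection acts on all of them without a choice of representatives.
\<close>

definition inversions :: "(int \<Rightarrow> int) \<Rightarrow> (int \<times> int) set" where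
  "inversions w = {(a, b). a < b \<and> a \<noteq> 0 \<and> b \<noteq> 0 \<and> w b < w a}"

definition sign_changes :: "(int \<Rightarrow> int) \<Rightarrow> int set" where
  "sign_changes w = {b. 0 < b \<and> w b < 0}"

definition inversion_number :: "(int \<Rightarrow> int) \<Rightarrow> nat" where
  "inversion_number w = card (inversions w) + card (sign_changes w)"

definition ascent :: "(int \<Rightarrow> int) \<Rightarrow> nat \<Rightarrow> bool" where
  "ascent w i \<longleftrightarrow> (if i = 0 then 0 < w 1 else w (int i) < w (int i + 1))"

lemma finite_inversions:
  assumes "w \<in> W_inf"
  shows "finite (inversions w)" "finite (sign_changes w)"
proof -
  obtain n where n: "w \<in> W n" using assms by (auto simp: W_inf_def)
  have bound: "\<bar>a\<bar> \<le> int n \<and> \<bar>b\<bar> \<le> int n" if "a < b" "w b < w a" for a b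
  proof -
    have "w a \<le> a \<or> \<bar>a\<bar> \<le> int n" "b \<le> w b \<or> \<bar>b\<bar> \<le> int n"
      using W_D(3)[OF n] by (metis linorder_not_le order.refl)+
    moreover have "\<bar>w a\<bar> \<le> int n" if "\<bar>a\<bar> \<le> int n"
      using W_abs_le[OF n that] .
    moreover have "\<bar>w b\<bar> \<le> int n" if "\<bar>b\<bar> \<le> int n"
      using W_abs_le[OF n that] .
    moreover have "w a = a" if "\<not> \<bar>a\<bar> \<le> int n" using W_D(3)[OF n] that by simp
    moreover have "w b = b" if "\<not> \<bar>b\<bar> \<le> int n" using W_D(3)[OF n] that by simp
    ultimately show ?thesis using that by linarith
  qed
  have "inversions w \<subseteq> {- int n..int n} \<times> {- int n..int n}"
    using bound by (fastforce simp: inversions_def abs_le_iff)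
  then show "finite (inversions w)"
    by (rule finite_subset) simp
  have "b \<le> int n" if "0 < b" "w b < 0" for b
  proof (rule ccontr)
    assume "\<not> b \<le> int n"
    then have "w b = b" using W_D(3)[OF n, of b] by linarith
    with that show False by simp
  qed
  then have "sign_changes w \<subseteq> {0..int n}"
    by (auto simp: sign_changes_def)
  then show "finite (sign_changes w)"
    by (rule finite_subset) simp
qed

text \<open>
  Multiplying by a simple reflection on the right permutes the inversions, except for the pairs of
  adjacent positions that the reflection interchanges. Inversions come in pairs
  \<open>(a, b)\<close>, \<open>(-b, -a)\<close>, except for those with \<open>a = - b\<close>; counting the sign changes separately
  compensates for this, so that every simple reflection changes the number by two.
\<close>

lemma inversion_number_ascent:
  assumes w: "w \<in> W_inf" and asc: "ascent w i"
  shows "inversion_number (w \<circ> simple_refl i) = inversion_number w + 2"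
proof -
  let ?s = "simple_refl i"
  obtain n where n: "w \<in> W n" using w by (auto simp: W_inf_def)
  note odd = W_D(2)[OF n]
  let ?f = "\<lambda>(a, b). (?s a, ?s b)"
  define E where "E = (if i = 0 then {(-1, 1)} else {(int i, int i + 1), (- int i - 1, - int i)})"
  have inj: "inj_on ?f A" for A
    by (rule inj_on_inverseI[where g = ?f]) auto
  have s0: "?s a = 0 \<longleftrightarrow> a = 0" for a
    by (auto simp: simple_refl_apply)
  have mono: "?s a < ?s b" if "a < b" "(a, b) \<notin> E" "a \<noteq> 0" "b \<noteq> 0" for a b
    using that by (intro simple_refl_strict_mono) (auto simp: E_def simple_refl_apply split: if_splits)
  have Edesc: "?s b < ?s a \<and> a < b \<and> a \<noteq> 0 \<and> b \<noteq> 0 \<and> w a < w b" if "(a, b) \<in> E" for a b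
  proof (cases "i = 0")
    case True
    then show ?thesis using that asc odd[of 1] by (simp add: E_def simple_refl_apply ascent_def)
  next
    case False
    have "- int i - 1 = - (int i + 1)" by simp
    then have "w (- int i - 1) = - w (int i + 1)" using odd by metis
    moreover have "(a, b) = (int i, int i + 1) \<or> (a, b) = (- int i - 1, - int i)"
      using that False by (simp add: E_def)
    moreover have "w (- int i) = - w (int i)" using odd by metis
    moreover have "w (int i) < w (int i + 1)" using False asc by (simp add: ascent_def)
    moreover have "?s (int i) = int i + 1" "?s (int i + 1) = int i"
      "?s (- int i - 1) = - int i" "?s (- int i) = - int i - 1"
      using False by (auto simp: simple_refl_apply)
    ultimately show ?thesis using False
      by (elim disjE) simp_all
  qed
  have Eswap: "(?s a, ?s b) \<in> (\<lambda>(a, b). (b, a)) ` E" if "(a, b) \<in> E" for a b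
  proof (cases "i = 0")
    case True
    then show ?thesis using that by (simp add: E_def simple_refl_apply)
  next
    case False
    have "(a, b) = (int i, int i + 1) \<or> (a, b) = (- int i - 1, - int i)"
      using that False by (simp add: E_def)
    then show ?thesis using False
      by (elim disjE) (simp_all add: simple_refl_apply E_def)
  qed
  have "inversions (w \<circ> ?s) = ?f ` inversions w \<union> E"
  proof (intro equalityI subsetI)
    fix p assume "p \<in> inversions (w \<circ> ?s)"
    then obtain a b where p: "p = (a, b)" "a < b" "a \<noteq> 0" "b \<noteq> 0" "w (?s b) < w (?s a)"
      by (auto simp: inversions_def)
    show "p \<in> ?f ` inversions w \<union> E"
    proof (cases "p \<in> E")
      case False
      then have "(?s a, ?s b) \<in> inversions w"
        using p mono[of a b] s0 by (auto simp: inversions_def)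
      then have "?f (?s a, ?s b) \<in> ?f ` inversions w" by blast
      then show ?thesis using p by simp
    qed simp
  next
    fix p assume "p \<in> ?f ` inversions w \<union> E"
    then show "p \<in> inversions (w \<circ> ?s)"
    proof
      assume "p \<in> E"
      then obtain a b where p: "p = (a, b)" "(a, b) \<in> E" by (cases p) auto
      then show ?thesis
        using Edesc[OF p(2)] Edesc[of "?s b" "?s a"] Eswap[OF p(2)] by (auto simp: inversions_def)
    next
      assume "p \<in> ?f ` inversions w"
      then obtain a b where p: "p = (?s a, ?s b)" "(a, b) \<in> inversions w" by auto
      then have "(a, b) \<notin> E" using Edesc[of a b] by (auto simp: inversions_def)
      then show ?thesis
        using p mono[of a b] s0 by (auto simp: inversions_def)
    qed
  qed
  moreover have "?f ` inversions w \<inter> E = {}"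
  proof (rule ccontr)
    assume "?f ` inversions w \<inter> E \<noteq> {}"
    then obtain a b where ab: "(a, b) \<in> inversions w" "(?s a, ?s b) \<in> E" by auto
    then show False
      using Edesc[OF ab(2)] by (auto simp: inversions_def)
  qed
  moreover have "finite E" by (simp add: E_def)
  ultimately have "card (inversions (w \<circ> ?s)) = card (inversions w) + card E"
    by (simp add: card_Un_disjoint finite_inversions[OF w] card_image[OF inj])
  moreover have "card (sign_changes (w \<circ> ?s)) = card (sign_changes w) + (2 - card E) \<and> card E \<le> 2"
  proof (cases "i = 0")
    case True
    have "sign_changes (w \<circ> ?s) = insert 1 (sign_changes w)"
      using asc True odd[of 1] by (auto simp: sign_changes_def simple_refl_apply ascent_def)
    moreover have "1 \<notin> sign_changes w"
      using asc True by (auto simp: sign_changes_def ascent_def)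
    ultimately show ?thesis
      using True finite_inversions[OF w] by (simp add: E_def)
  next
    case False
    have pos: "0 < ?s b \<longleftrightarrow> 0 < b" for b
      using False by (auto simp: simple_refl_apply)
    have "sign_changes (w \<circ> ?s) = ?s ` sign_changes w"
    proof (intro equalityI subsetI)
      fix b assume "b \<in> sign_changes (w \<circ> ?s)"
      then have "?s b \<in> sign_changes w" using pos[of b] by (simp add: sign_changes_def)
      then have "?s (?s b) \<in> ?s ` sign_changes w" by blast
      then show "b \<in> ?s ` sign_changes w" by simp
    next
      fix b assume "b \<in> ?s ` sign_changes w"
      then obtain c where "b = ?s c" "0 < c" "w c < 0" by (auto simp: sign_changes_def)
      then show "b \<in> sign_changes (w \<circ> ?s)" using pos[of c] by (simp add: sign_changes_def)
    qed
    moreover have "inj_on ?s (sign_changes w)"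
      by (rule inj_on_inverseI[where g = ?s]) simp
    moreover have "card E = 2"
      using False by (simp add: E_def)
    ultimately show ?thesis by (simp add: card_image)
  qed
  ultimately show ?thesis
    by (simp add: inversion_number_def)
qed

lemma inversion_number_descent:
  assumes w: "w \<in> W_inf" and desc: "\<not> ascent w i"
  shows "inversion_number w = inversion_number (w \<circ> simple_refl i) + 2"
proof -
  obtain n where n: "w \<in> W n" using w by (auto simp: W_inf_def)
  have "w 1 \<noteq> 0" "w (int i) \<noteq> w (int i + 1)"
    using W_eq_0_iff[OF n, of 1] bij_is_inj[OF W_D(1)[OF n]] by (auto simp: inj_eq)
  then have "ascent (w \<circ> simple_refl i) i"
    using desc W_D(2)[OF n, of 1] by (auto simp: ascent_def simple_refl_apply)
  from inversion_number_ascent[OF comp_simple_refl_in_W_inf[OF w] this] show ?thesis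
    by (simp add: comp_assoc)
qed

lemma inversion_number_id: "inversion_number id = 0"
proof -
  have "inversions (\<lambda>a. a) = {}" "sign_changes (\<lambda>a. a) = {}"
    by (auto simp: inversions_def sign_changes_def)
  then show ?thesis unfolding id_def inversion_number_def by simp
qed

lemma all_ascents_imp_id:
  assumes w: "w \<in> W_inf" and asc: "\<And>i. ascent w i"
  shows "w = id"
proof -
  obtain n where n: "w \<in> W n" using w by (auto simp: W_inf_def)
  have lower: "w (int m) \<ge> int m" for m
  proof (induction m)
    case (Suc m)
    then show ?case
      using asc[of m] by (cases "m = 0") (auto simp: ascent_def add.commute)
  qed (use W_0[OF n] in simp)
  have upper: "w (int m) \<le> int m" if "m \<le> Suc n" for m
    using that
  proof (induction m rule: inc_induct)
    case base
    then show ?case using W_D(3)[OF n, of "int (Suc n)"] by simp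
  next
    case (step m)
    then show ?case
      using asc[of m] W_0[OF n] by (cases "m = 0") (auto simp: ascent_def add.commute)
  qed
  have nat: "w (int m) = int m" for m
    using lower[of m] upper[of m] W_D(3)[OF n, of "int m"] by (cases "m \<le> n") auto
  have "w x = x" for x
    using nat[of "nat x"] nat[of "nat (- x)"] W_D(2)[OF n, of x] by (cases "x \<ge> 0") auto
  then show ?thesis by auto
qed

definition word_product :: "nat list \<Rightarrow> int \<Rightarrow> int" where
  "word_product is = foldr (\<lambda>i v. simple_refl i \<circ> v) is id"

lemma word_product_snoc: "word_product (is @ [i]) = word_product is \<circ> simple_refl i"
  unfolding word_product_def by (induction "is") (simp_all add: comp_assoc)

lemma word_product_in_W_inf: "word_product is \<in> W_inf"
proof (induction "is" rule: rev_induct)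
  case Nil
  have "id \<in> W 0" by (auto simp: W_def)
  then show ?case unfolding word_product_def W_inf_def foldr.simps id_apply by blast
next
  case (snoc i "is")
  then show ?case unfolding word_product_snoc by (rule comp_simple_refl_in_W_inf)
qed

text \<open>
  Every letter of a word changes the number of inversions by two, upwards or downwards.
\<close>

lemma inversion_number_word_le: "inversion_number (word_product is) \<le> 2 * length is"
proof (induction "is" rule: rev_induct)
  case Nil
  have "word_product [] = id" by (simp add: word_product_def)
  then show ?case by (metis inversion_number_id zero_le)
next
  case (snoc i "is")
  show ?case unfolding word_product_snoc
    using snoc inversion_number_ascent[OF word_product_in_W_inf[of "is"], of i]
      inversion_number_descent[OF word_product_in_W_inf[of "is"], of i]
    by (cases "ascent (word_product is) i") (auto simp: comp_def)
qed

text \<open>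
  As long as there is a descent, multiplying by the corresponding reflection on the right removes
  two inversions; an element without descents is the identity.
\<close>

lemma exists_word_of_inversion_number:
  "w \<in> W_inf \<Longrightarrow> \<exists>is. w = word_product is \<and> 2 * length is = inversion_number w"
proof (induction "inversion_number w" arbitrary: w rule: less_induct)
  case less
  show ?case
  proof (cases "\<forall>i. ascent w i")
    case True
    then have "w = id" using all_ascents_imp_id less.prems by blast
    moreover have "word_product [] = id" by (simp add: word_product_def)
    ultimately show ?thesis
      using inversion_number_id by (metis list.size(3) mult_0_right)
  next
    case False
    then obtain i where "\<not> ascent w i" by blast
    note N = inversion_number_descent[OF less.prems this]
    then obtain "is" where "is": "w \<circ> simple_refl i = word_product is"
      "2 * length is = inversion_number (w \<circ> simple_refl i)"
      using less.hyps[of "w \<circ> simple_refl i"] comp_simple_refl_in_W_inf[OF less.prems] by auto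
    have "w = word_product (is @ [i])"
      unfolding word_product_snoc "is"(1)[symmetric] by (simp add: comp_assoc)
    then show ?thesis
      using "is"(2) N by (intro exI[of _ "is @ [i]"]) simp
  qed
qed

lemma W_length_eq:
  assumes "w \<in> W_inf"
  shows "2 * W_length w = inversion_number w"
proof -
  obtain "is" where "is": "w = word_product is" "2 * length is = inversion_number w"
    using exists_word_of_inversion_number[OF assms] by blast
  have "W_length w = length is"
    unfolding W_length_def word_product_def[symmetric]
  proof (rule Least_equality)
    fix l assume "\<exists>js. length js = l \<and> w = word_product js"
    then obtain js where "length js = l" "w = word_product js" by blast
    then show "length is \<le> l"
      using inversion_number_word_le[of js] "is"(2) by simp
  qed (use "is"(1) in blast)
  then show ?thesis using "is"(2) by simp
qed

lemma W_length_comp_simple_refl_iff: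
  assumes "w \<in> W_inf"
  shows "W_length (w \<circ> simple_refl i) = W_length w + 1 \<longleftrightarrow> ascent w i"
  using W_length_eq[OF assms] W_length_eq[OF comp_simple_refl_in_W_inf[OF assms, of i]]
    inversion_number_ascent[OF assms, of i] inversion_number_descent[OF assms, of i]
  by (cases "ascent w i") auto

lemma k_grassmannian_iff: "k_grassmannian k w \<longleftrightarrow> w \<in> W_inf \<and> (\<forall>i. i \<noteq> k \<longrightarrow> ascent w i)"
  using W_length_comp_simple_refl_iff by (auto simp: k_grassmannian_def)

section \<open>Shapes of k-Grassmannian elements\<close>

lemma W_inj: "w \<in> W n \<Longrightarrow> w x = w y \<longleftrightarrow> x = y"
  using W_D(1)[of w n] by (auto simp: bij_def dest: injD)

lemma W_abs_eq_iff:
  assumes "w \<in> W n" "x > 0" "y > 0"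
  shows "\<bar>w x\<bar> = \<bar>w y\<bar> \<longleftrightarrow> x = y"
proof
  assume "\<bar>w x\<bar> = \<bar>w y\<bar>"
  then have "w x = w y \<or> w x = w (- y)"
    using W_D(2)[OF assms(1), of y] by (simp add: abs_eq_iff)
  then show "x = y"
    using assms W_inj[OF assms(1)] by auto
qed simp

lemma W_obtain_abs:
  assumes "w \<in> W n" "y > 0"
  obtains x where "x > 0" "\<bar>w x\<bar> = y"
proof -
  obtain z where z: "w z = y"
    using W_D(1)[OF assms(1)] by (metis bij_pointE)
  then have "z \<noteq> 0"
    using W_0[OF assms(1)] assms(2) by auto
  moreover have "\<bar>w \<bar>z\<bar>\<bar> = y"
    using z W_D(2)[OF assms(1), of z] assms(2) by (auto simp: abs_if)
  ultimately show thesis using that[of "\<bar>z\<bar>"] by simp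
qed

lemma gap_of_increasing:
  fixes w :: "int \<Rightarrow> int"
  assumes "\<And>m. a \<le> m \<Longrightarrow> m < b \<Longrightarrow> w (int m) < w (int m + 1)" "a \<le> b"
  shows "w (int a) + (int b - int a) \<le> w (int b)"
  using assms(2,1)
proof (induction b rule: dec_induct)
  case (step b)
  have "w (int a) + (int b - int a) \<le> w (int b)"
    by (rule step.IH) (use step.prems in auto)
  moreover have "w (int b) < w (int b + 1)"
    using step.hyps step.prems by auto
  ultimately show ?case by (simp add: add.commute)
qed simp

text \<open>
  The last property combines strict monotonicity beyond \<open>k\<close> with integrality of the entries.
\<close>

lemma k_grassmannian_D:
  assumes "k_grassmannian k w"
  obtains n where "w \<in> W n"
    and "\<And>p q. 1 \<le> p \<Longrightarrow> p < q \<Longrightarrow> q \<le> k \<Longrightarrow> w (int p) < w (int q)"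
    and "\<And>p. 1 \<le> p \<Longrightarrow> p \<le> k \<Longrightarrow> 0 < w (int p)"
    and "\<And>i j. 1 \<le> i \<Longrightarrow> i \<le> j \<Longrightarrow> w (int (k + i)) + (int j - int i) \<le> w (int (k + j))"
proof -
  obtain n where n: "w \<in> W n" and asc: "\<And>i. i \<noteq> k \<Longrightarrow> ascent w i"
    using assms by (auto simp: k_grassmannian_iff W_inf_def)
  have gap: "w (int a) + (int b - int a) \<le> w (int b)" if "1 \<le> a" "a \<le> b" "b \<le> k \<or> k < a" for a b
  proof (rule gap_of_increasing)
    fix m assume "a \<le> m" "m < b"
    then have "m \<noteq> k" "m \<noteq> 0" using that by auto
    then show "w (int m) < w (int m + 1)" using asc[of m] by (simp add: ascent_def)
  qed (use that in simp)
  show thesis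
  proof (rule that[OF n])
    show less: "w (int p) < w (int q)" if "1 \<le> p" "p < q" "q \<le> k" for p q
      using gap[of p q] that by simp
    show "0 < w (int p)" if "1 \<le> p" "p \<le> k" for p
    proof -
      have "0 < w 1" using asc[of 0] that by (simp add: ascent_def)
      then show ?thesis using gap[of 1 p] that by simp
    qed
    show "w (int (k + i)) + (int j - int i) \<le> w (int (k + j))" if "1 \<le> i" "i \<le> j" for i j
      using gap[of "k + i" "k + j"] that by simp
  qed
qed

text \<open>
  The absolute values of the entries at positive positions are the positive integers, each once.
\<close>

lemma card_abs_less:
  assumes "w \<in> W n" "x > 0"
  shows "int (card {q. 1 \<le> q \<and> \<bar>w (int q)\<bar> < x}) = x - 1"
proof -
  have "bij_betw (\<lambda>q. nat \<bar>w (int q)\<bar>) {q. 1 \<le> q \<and> \<bar>w (int q)\<bar> < x} {1..<nat x}"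
    unfolding bij_betw_def
  proof
    show "inj_on (\<lambda>q. nat \<bar>w (int q)\<bar>) {q. 1 \<le> q \<and> \<bar>w (int q)\<bar> < x}"
      by (rule inj_onI) (use W_abs_eq_iff[OF assms(1)] in \<open>force simp: eq_nat_nat_iff\<close>)
    show "(\<lambda>q. nat \<bar>w (int q)\<bar>) ` {q. 1 \<le> q \<and> \<bar>w (int q)\<bar> < x} = {1..<nat x}"
    proof (intro equalityI subsetI)
      fix y assume "y \<in> (\<lambda>q. nat \<bar>w (int q)\<bar>) ` {q. 1 \<le> q \<and> \<bar>w (int q)\<bar> < x}"
      then obtain q where q: "y = nat \<bar>w (int q)\<bar>" "1 \<le> q" "\<bar>w (int q)\<bar> < x" by auto
      have "w (int q) \<noteq> 0" using W_eq_0_iff[OF assms(1)] q by simp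
      then show "y \<in> {1..<nat x}" using q assms(2) by auto
    next
      fix y assume y: "y \<in> {1..<nat x}"
      obtain z where "z > 0" "\<bar>w z\<bar> = int y"
        by (rule W_obtain_abs[OF assms(1), of "int y"]) (use y in auto)
      then show "y \<in> (\<lambda>q. nat \<bar>w (int q)\<bar>) ` {q. 1 \<le> q \<and> \<bar>w (int q)\<bar> < x}"
        using y by (intro image_eqI[of _ _ "nat z"]) auto
    qed
  qed
  from bij_betw_same_card[OF this] show ?thesis using assms(2) by simp
qed

text \<open>
  Let \<open>x\<close> be the entry at position \<open>k + j\<close>. The \<open>x - 1\<close> positions with entries of absolute value
  less than \<open>x\<close> are all to the left of \<open>k + j\<close>: those up to \<open>k\<close> number \<open>k - \<lambda>\<^sub>j\<close>, and among the
  others the condition is that the entry exceeds \<open>-x\<close>.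
\<close>

lemma positive_row_eq:
  assumes w: "k_grassmannian k w" and j: "1 \<le> j" and x: "w (int (k + j)) > 0"
  shows "w (int (k + j)) = int k + 1 - int (grassmannian_shape k w j) +
    int (card {i. 1 \<le> i \<and> i < j \<and> w (int (k + i)) + w (int (k + j)) > 0})"
proof -
  obtain n where n: "w \<in> W n"
    and pos: "\<And>p. 1 \<le> p \<Longrightarrow> p \<le> k \<Longrightarrow> 0 < w (int p)"
    and gap: "\<And>i j. 1 \<le> i \<Longrightarrow> i \<le> j \<Longrightarrow> w (int (k + i)) + (int j - int i) \<le> w (int (k + j))"
    using k_grassmannian_D[OF w] by metis
  let ?x = "w (int (k + j))"
  let ?L = "{p. 1 \<le> p \<and> p \<le> k \<and> w (int p) < ?x}" and ?U = "{p. 1 \<le> p \<and> p \<le> k \<and> w (int p) > ?x}"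
  let ?I = "{i. 1 \<le> i \<and> i < j \<and> w (int (k + i)) + ?x > 0}"
  have fin: "finite ?L" "finite ?U" "finite ?I"
    by (rule finite_subset[of _ "{..k + j}"]; auto)+
  have "w (int p) \<noteq> ?x" if "p \<le> k" for p
    using W_inj[OF n] that j by simp
  then have "w (int p) < ?x \<or> w (int p) > ?x" if "p \<le> k" for p
    using that by (meson linorder_neqE)
  then have "?L \<union> ?U = {1..k}" by fastforce
  then have "card (?L \<union> ?U) = k" by simp
  moreover have "?L \<inter> ?U = {}" by auto
  ultimately have LU: "card ?L + card ?U = k"
    using card_Un_disjoint[OF fin(1,2)] by simp
  have "{q. 1 \<le> q \<and> \<bar>w (int q)\<bar> < ?x} = ?L \<union> (+) k ` ?I"
  proof (intro equalityI subsetI)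
    fix q assume q: "q \<in> {q. 1 \<le> q \<and> \<bar>w (int q)\<bar> < ?x}"
    show "q \<in> ?L \<union> (+) k ` ?I"
    proof (cases "q \<le> k")
      case False
      define i where "i = q - k"
      have i: "q = k + i" "1 \<le> i" using False by (auto simp: i_def)
      have "i < j"
      proof (rule ccontr)
        assume "\<not> i < j"
        then have "?x \<le> w (int q)" using gap[of j i] j i by simp
        moreover have "\<bar>w (int q)\<bar> < ?x" using q by simp
        ultimately show False by linarith
      qed
      then show ?thesis using q i by auto
    qed (use q in auto)
  next
    fix q assume "q \<in> ?L \<union> (+) k ` ?I"
    then show "q \<in> {q. 1 \<le> q \<and> \<bar>w (int q)\<bar> < ?x}"
    proof
      assume "q \<in> ?L"
      then show ?thesis using pos[of q] by auto
    next
      assume "q \<in> (+) k ` ?I"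
      then obtain i where i: "q = k + i" "1 \<le> i" "i < j" "w (int (k + i)) + ?x > 0" by auto
      then show ?thesis using gap[of i j] by auto
    qed
  qed
  moreover have "?L \<inter> (+) k ` ?I = {}" by auto
  ultimately have "card {q. 1 \<le> q \<and> \<bar>w (int q)\<bar> < ?x} = card ?L + card ?I"
    using fin by (simp add: card_Un_disjoint card_image)
  then have "?x - 1 = int (card ?L) + int (card ?I)"
    using card_abs_less[OF n x] by simp
  moreover have "grassmannian_shape k w j = card ?U"
    using x j by (simp add: grassmannian_shape_def)
  ultimately show ?thesis using LU by linarith
qed

text \<open>
  The interesting case is a negative entry \<open>-d\<close> in row \<open>i\<close> and a positive entry \<open>x\<close> in row \<open>j\<close>.
  Expressing \<open>\<lambda>\<^sub>j\<close> by the preceding lemma, the inequality defining \<open>C(\<lambda>)\<close> becomes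
  \<open>d - x > n - i\<close>, where \<open>n\<close> is the number of rows with entry less than \<open>-x\<close>. The entries
  increase by at least one per row. So if \<open>d > x\<close>, fewer than \<open>d - x\<close> rows after row \<open>i\<close> have
  such an entry, and if \<open>d < x\<close>, all rows up to \<open>i - (x - d)\<close> have one.
\<close>

lemma C_set_grassmannian_shape:
  assumes w: "k_grassmannian k w"
  shows "C_set k (grassmannian_shape k w) =
    {(i, j). 1 \<le> i \<and> i < j \<and> w (int (k + i)) + w (int (k + j)) < 0}"
proof -
  obtain n where n: "w \<in> W n"
    and gap: "\<And>i j. 1 \<le> i \<Longrightarrow> i \<le> j \<Longrightarrow> w (int (k + i)) + (int j - int i) \<le> w (int (k + j))"
    using k_grassmannian_D[OF w] by metis
  let ?lam = "grassmannian_shape k w" and ?r = "\<lambda>j. w (int (k + j))"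
  have neg: "int (?lam i) = int k - ?r i" if "1 \<le> i" "?r i < 0" for i
    using that by (simp add: grassmannian_shape_def)
  have nonzero: "?r i \<noteq> 0" if "1 \<le> i" for i
    using W_eq_0_iff[OF n] that by simp
  have sum_nonzero: "?r i + ?r j \<noteq> 0" if "1 \<le> i" "1 \<le> j" for i j
  proof
    assume "?r i + ?r j = 0"
    then have "?r i = w (- int (k + j))" using W_D(2)[OF n, of "int (k + j)"] by simp
    then have "int (k + i) = - int (k + j)" using W_inj[OF n] by blast
    then show False using that by simp
  qed
  have small: "?lam i \<le> k" if "?r i > 0" for i
  proof -
    have "card {p. 1 \<le> p \<and> p \<le> k \<and> w (int p) > ?r i} \<le> card {1..k}"
      by (rule card_mono) auto
    then show ?thesis using that by (simp add: grassmannian_shape_def)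
  qed
  have *: "2 * int k + (int j - int i) < int (?lam i) + int (?lam j) \<longleftrightarrow> ?r i + ?r j < 0"
    if ij: "1 \<le> i" "i < j" for i j
  proof -
    have j: "1 \<le> j" using ij by simp
    consider "?r j < 0" | "?r j > 0" "?r i > 0" | "?r j > 0" "?r i < 0"
      using nonzero[OF ij(1)] nonzero[OF j] by linarith
    then show ?thesis
    proof cases
      case 1
      then show ?thesis
        using gap[of i j] neg[OF j] neg[OF ij(1)] ij by simp
    next
      case 2
      then show ?thesis
        using small[of i] small[of j] ij by simp
    next
      case 3
      define x d where "x = ?r j" and "d = - ?r i"
      define N where "N = {a. 1 \<le> a \<and> a < j \<and> ?r a + x < 0}"
      have finN: "finite N" by (rule finite_subset[of _ "{..j}"]) (auto simp: N_def)
      have "{1..<j} = N \<union> {a. 1 \<le> a \<and> a < j \<and> ?r a + x > 0}"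
        using sum_nonzero[OF _ j] by (fastforce simp: N_def x_def neq_iff)
      moreover have "N \<inter> {a. 1 \<le> a \<and> a < j \<and> ?r a + x > 0} = {}"
        by (auto simp: N_def)
      ultimately have "card {1..<j} = card N + card {a. 1 \<le> a \<and> a < j \<and> ?r a + x > 0}"
        using finN by (simp add: card_Un_disjoint)
      then have card_N: "int (card N) + int (card {a. 1 \<le> a \<and> a < j \<and> ?r a + x > 0}) = int j - 1"
        using ij by simp
      have "x = int k + 1 - int (?lam j) + (int j - 1 - int (card N))"
        using positive_row_eq[OF w j 3(1)] card_N by (simp add: x_def)
      moreover have "int (?lam i) = int k + d"
        using neg[OF ij(1) 3(2)] by (simp add: d_def)
      moreover have "int (card N) < int i + d - x \<longleftrightarrow> d > x"
      proof (cases "d > x")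
        case True
        have "N \<subseteq> {1..<nat (int i + d - x)}"
        proof
          fix a assume a: "a \<in> N"
          have "int a < int i + d - x"
          proof (cases "i \<le> a")
            case True
            then show ?thesis using gap[of i a] ij a by (simp add: N_def d_def)
          next
            case False
            then show ?thesis using \<open>d > x\<close> by simp
          qed
          then show "a \<in> {1..<nat (int i + d - x)}" using a by (auto simp: N_def)
        qed
        from card_mono[OF _ this] have "card N \<le> nat (int i + d - x) - 1" by simp
        then show ?thesis using True ij by linarith
      next
        case False
        have "{1..nat (int i + d - x)} \<subseteq> N"
        proof
          fix a assume a: "a \<in> {1..nat (int i + d - x)}"
          then have "a \<le> i" "int a \<le> int i + d - x" "1 \<le> a" using False by auto
          then have "?r a + x \<le> 0" using gap[of a i] by (simp add: d_def)
          then show "a \<in> N"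
            using \<open>a \<le> i\<close> \<open>1 \<le> a\<close> sum_nonzero[of a j] ij by (auto simp: N_def x_def)
        qed
        from card_mono[OF finN this] show ?thesis using False by simp
      qed
      moreover have "?r i + ?r j < 0 \<longleftrightarrow> d > x"
        by (auto simp: d_def x_def)
      ultimately show ?thesis by auto
    qed
  qed
  then have "2 * k + (j - i) < ?lam i + ?lam j \<longleftrightarrow> ?r i + ?r j < 0" if "1 \<le> i" "i < j" for i j
  proof -
    have "int (j - i) = int j - int i" using that by simp
    then show ?thesis using * [OF that] by linarith
  qed
  then show ?thesis
    unfolding C_set_def by auto
qed

text \<open>
  For a positive entry this restates the formula for \<open>\<lambda>\<^sub>j\<close>. For a negative entry all earlier rows
  have negative entries as well, so that no pair \<open>(i, j)\<close> is missing from \<open>C(\<lambda>)\<close> and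
  \<open>\<beta>\<^sub>j = k + 1 - \<lambda>\<^sub>j\<close>.
\<close>

lemma beta_grassmannian_shape:
  assumes w: "k_grassmannian k w" and j: "1 \<le> j"
  shows "beta k (grassmannian_shape k w) j =
    (if w (int (k + j)) < 0 then w (int (k + j)) + 1 else w (int (k + j)))"
proof -
  obtain n where n: "w \<in> W n"
    and gap: "\<And>i j. 1 \<le> i \<Longrightarrow> i \<le> j \<Longrightarrow> w (int (k + i)) + (int j - int i) \<le> w (int (k + j))"
    using k_grassmannian_D[OF w] by metis
  let ?r = "\<lambda>j. w (int (k + j))"
  have notC: "{i. 1 \<le> i \<and> i < j \<and> (i, j) \<notin> C_set k (grassmannian_shape k w)} =
      {i. 1 \<le> i \<and> i < j \<and> \<not> ?r i + ?r j < 0}"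
    by (auto simp: C_set_grassmannian_shape[OF w])
  show ?thesis
  proof (cases "?r j < 0")
    case True
    have "{i. 1 \<le> i \<and> i < j \<and> \<not> ?r i + ?r j < 0} = {}"
      using gap[of _ j] True by fastforce
    then have "card {i. 1 \<le> i \<and> i < j \<and> \<not> ?r i + ?r j < 0} = 0" by (simp only: card.empty)
    then show ?thesis
      using True j unfolding beta_def notC by (simp add: grassmannian_shape_def)
  next
    case False
    have "?r j \<noteq> 0" using W_eq_0_iff[OF n] j by simp
    then have pos: "?r j > 0" using False by simp
    have "?r i + ?r j \<noteq> 0" if "1 \<le> i" for i
    proof
      assume "?r i + ?r j = 0"
      then have "\<bar>?r i\<bar> = \<bar>?r j\<bar>" by simp
      then have "i = j" using W_abs_eq_iff[OF n, of "int (k + i)" "int (k + j)"] that j by simp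
      with \<open>?r i + ?r j = 0\<close> pos show False by simp
    qed
    then have "{i. 1 \<le> i \<and> i < j \<and> \<not> ?r i + ?r j < 0} = {i. 1 \<le> i \<and> i < j \<and> ?r i + ?r j > 0}"
      by (fastforce simp: not_less le_less)
    then show ?thesis
      using False positive_row_eq[OF w j pos] unfolding beta_def notC by simp
  qed
qed

text \<open>
  The indices \<open>\<beta>\<^sub>j\<close> depend on the shape only and determine the entries beyond \<open>k\<close>; the first \<open>k\<close>
  entries are the remaining positive integers in increasing order.
\<close>

lemma grassmannian_shape_inj: "inj_on (grassmannian_shape k) {w. k_grassmannian k w}"
proof (rule inj_onI)
  fix v w assume "v \<in> {w. k_grassmannian k w}" "w \<in> {w. k_grassmannian k w}"
    and shape: "grassmannian_shape k v = grassmannian_shape k w"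
  then have vw: "k_grassmannian k v" "k_grassmannian k w" by auto
  obtain n where n: "v \<in> W n"
    and v_mono: "\<And>p q. 1 \<le> p \<Longrightarrow> p < q \<Longrightarrow> q \<le> k \<Longrightarrow> v (int p) < v (int q)"
    and v_pos: "\<And>p. 1 \<le> p \<Longrightarrow> p \<le> k \<Longrightarrow> 0 < v (int p)"
    using k_grassmannian_D[OF vw(1)] by metis
  obtain m where m: "w \<in> W m"
    and w_mono: "\<And>p q. 1 \<le> p \<Longrightarrow> p < q \<Longrightarrow> q \<le> k \<Longrightarrow> w (int p) < w (int q)"
    and w_pos: "\<And>p. 1 \<le> p \<Longrightarrow> p \<le> k \<Longrightarrow> 0 < w (int p)"
    using k_grassmannian_D[OF vw(2)] by metis
  have rows: "v (int (k + j)) = w (int (k + j))" if "1 \<le> j" for j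
  proof -
    have "v (int (k + j)) \<noteq> 0" "w (int (k + j)) \<noteq> 0"
      using W_eq_0_iff[OF n] W_eq_0_iff[OF m] that by auto
    then show ?thesis
      using beta_grassmannian_shape[OF vw(1) that] beta_grassmannian_shape[OF vw(2) that] shape
      by (auto split: if_splits)
  qed
  have image: "(\<lambda>p. u (int p)) ` {1..k} = {y. y > 0 \<and> (\<forall>j\<ge>1. \<bar>u (int (k + j))\<bar> \<noteq> y)}"
    if u: "u \<in> W l" and pos: "\<And>p. 1 \<le> p \<Longrightarrow> p \<le> k \<Longrightarrow> 0 < u (int p)" for u l
  proof (intro equalityI subsetI)
    fix y assume "y \<in> (\<lambda>p. u (int p)) ` {1..k}"
    then obtain p where p: "1 \<le> p" "p \<le> k" "y = u (int p)" by auto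
    have "\<bar>u (int (k + j))\<bar> \<noteq> \<bar>u (int p)\<bar>" if "j \<ge> 1" for j
      using W_abs_eq_iff[OF u, of "int (k + j)" "int p"] p that by simp
    then show "y \<in> {y. y > 0 \<and> (\<forall>j\<ge>1. \<bar>u (int (k + j))\<bar> \<noteq> y)}"
      using pos[OF p(1,2)] p(3) by auto
  next
    fix y assume y: "y \<in> {y. y > 0 \<and> (\<forall>j\<ge>1. \<bar>u (int (k + j))\<bar> \<noteq> y)}"
    obtain x where x: "x > 0" "\<bar>u x\<bar> = y"
      by (rule W_obtain_abs[OF u, of y]) (use y in auto)
    have "x \<le> int k"
    proof (rule ccontr)
      assume "\<not> x \<le> int k"
      then have "x = int (k + nat (x - int k))" "nat (x - int k) \<ge> 1" by auto
      then show False using y x(2) by (metis (mono_tags, lifting) mem_Collect_eq)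
    qed
    then have "u x > 0" using pos[of "nat x"] x(1) by simp
    then show "y \<in> (\<lambda>p. u (int p)) ` {1..k}"
      using x \<open>x \<le> int k\<close> by (intro image_eqI[of _ _ "nat x"]) auto
  qed
  have "map (\<lambda>p. v (int p)) [1..<Suc k] = map (\<lambda>p. w (int p)) [1..<Suc k]"
  proof (rule strict_sorted_equal)
    have "v (1 + int i) < v (1 + int j)" if "i < j" "j < k" for i j
      using v_mono[of "Suc i" "Suc j"] that by simp
    then show "sorted_wrt (<) (map (\<lambda>p. v (int p)) [1..<Suc k])"
      by (auto simp: sorted_wrt_iff_nth_less simp del: upt_Suc)
    have "w (1 + int i) < w (1 + int j)" if "i < j" "j < k" for i j
      using w_mono[of "Suc i" "Suc j"] that by simp
    then show "sorted_wrt (<) (map (\<lambda>p. w (int p)) [1..<Suc k])"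
      by (auto simp: sorted_wrt_iff_nth_less simp del: upt_Suc)
    have "{y. y > 0 \<and> (\<forall>j\<ge>1. \<bar>v (int (k + j))\<bar> \<noteq> y)} = {y. y > 0 \<and> (\<forall>j\<ge>1. \<bar>w (int (k + j))\<bar> \<noteq> y)}"
      using rows by auto
    moreover have "(\<lambda>p. v (int p)) ` {1..k} = {y. y > 0 \<and> (\<forall>j\<ge>1. \<bar>v (int (k + j))\<bar> \<noteq> y)}"
      by (rule image[OF n]) (fact v_pos)
    moreover have "(\<lambda>p. w (int p)) ` {1..k} = {y. y > 0 \<and> (\<forall>j\<ge>1. \<bar>w (int (k + j))\<bar> \<noteq> y)}"
      by (rule image[OF m]) (fact w_pos)
    ultimately have "(\<lambda>p. v (int p)) ` {1..k} = (\<lambda>p. w (int p)) ` {1..k}"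
      by (simp only:)
    then show "set (map (\<lambda>p. v (int p)) [1..<Suc k]) = set (map (\<lambda>p. w (int p)) [1..<Suc k])"
      by (simp add: atLeastLessThanSuc_atLeastAtMost del: upt_Suc)
  qed
  then have low: "v (int p) = w (int p)" if "1 \<le> p" "p \<le> k" for p
    using that by (auto simp: map_eq_conv simp del: upt_Suc)
  have nat: "v (int q) = w (int q)" for q
  proof (cases "q = 0 \<or> q \<le> k")
    case True
    then show ?thesis using low[of q] W_0[OF n] W_0[OF m] by (cases "q = 0") auto
  next
    case False
    then have "1 \<le> q - k" "k + (q - k) = q" by auto
    then show ?thesis using rows[of "q - k"] by simp
  qed
  show "v = w"
  proof
    fix x
    show "v x = w x"
    proof (cases "x \<ge> 0")
      case True
      then show ?thesis using nat[of "nat x"] by simp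
    next
      case False
      then show ?thesis
        using nat[of "nat (- x)"] W_D(2)[OF n, of x] W_D(2)[OF m, of x] by simp
    qed
  qed
qed

section \<open>Every k-strict partition is a shape\<close>

text \<open>
  A permutation of \<open>{1..n}\<close> and a choice of signs, continued to an odd function.
\<close>

lemma signed_permutation_in_W:
  fixes f :: "nat \<Rightarrow> nat" and neg :: "nat \<Rightarrow> bool"
  assumes f: "bij_betw f {1..n} {1..n}"
    and big: "\<And>q. q > n \<Longrightarrow> f q = q" "\<And>q. q > n \<Longrightarrow> \<not> neg q"
  shows "(\<lambda>x. sgn x * (if neg (nat \<bar>x\<bar>) then - int (f (nat \<bar>x\<bar>)) else int (f (nat \<bar>x\<bar>)))) \<in> W n"
    (is "?w \<in> W n")
proof -
  let ?e = "\<lambda>q. if neg q then - 1 else (1::int)"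
  have w: "?w x = sgn x * ?e (nat \<bar>x\<bar>) * int (f (nat \<bar>x\<bar>))" for x by simp
  have pos: "f q \<ge> 1" if "q \<ge> 1" for q
  proof (cases "q \<le> n")
    case True
    then have "f q \<in> {1..n}" using bij_betwE[OF f] that by simp
    then show ?thesis by simp
  qed (use big that in simp)
  have f_le: "f q \<le> n \<longleftrightarrow> q \<le> n" if "q \<ge> 1" for q
  proof (cases "q \<le> n")
    case True
    then have "f q \<in> {1..n}" using bij_betwE[OF f] that by simp
    then show ?thesis using True by simp
  qed (use big in simp)
  have inj: "p = q" if "f p = f q" "p \<ge> 1" "q \<ge> 1" for p q
  proof (cases "p \<le> n")
    case True
    then have "q \<le> n" using f_le that by metis
    then show ?thesis
      using True that bij_betw_imp_inj_on[OF f] by (auto dest: inj_onD)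
  next
    case False
    then show ?thesis using f_le that big by (metis not_le)
  qed
  have surj: "\<exists>q\<ge>1. f q = y" if "y \<ge> 1" for y
  proof (cases "y \<le> n")
    case True
    then have "y \<in> f ` {1..n}" using f that by (simp add: bij_betw_def)
    then show ?thesis by auto
  next
    case False
    then have "f y = y" using big by simp
    then show ?thesis using that by blast
  qed
  have sgn_w: "sgn (?w x) = sgn x * ?e (nat \<bar>x\<bar>)" and abs_w: "\<bar>?w x\<bar> = int (f (nat \<bar>x\<bar>))"
    if "x \<noteq> 0" for x
  proof -
    have "f (nat \<bar>x\<bar>) \<ge> 1" using pos that by simp
    then show "sgn (?w x) = sgn x * ?e (nat \<bar>x\<bar>)" "\<bar>?w x\<bar> = int (f (nat \<bar>x\<bar>))"
      using that unfolding w by (simp_all add: sgn_mult abs_mult abs_sgn_eq)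
  qed
  have w_0: "?w x = 0 \<longleftrightarrow> x = 0" for x
  proof (cases "x = 0")
    case False
    then have "f (nat \<bar>x\<bar>) \<ge> 1" using pos by simp
    then have "\<bar>?w x\<bar> > 0" unfolding abs_w[OF False] by simp
    then show ?thesis using False by linarith
  qed simp
  have "inj ?w"
  proof (rule injI)
    fix x y assume eq: "?w x = ?w y"
    show "x = y"
    proof (cases "x = 0 \<or> y = 0")
      case True
      then show ?thesis using w_0[of x] w_0[of y] eq by metis
    next
      case False
      then have "f (nat \<bar>x\<bar>) = f (nat \<bar>y\<bar>)"
        using abs_w[of x] abs_w[of y] eq by simp
      then have n: "nat \<bar>x\<bar> = nat \<bar>y\<bar>" by (rule inj) (use False in auto)
      have "sgn x * ?e (nat \<bar>x\<bar>) = sgn y * ?e (nat \<bar>y\<bar>)"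
        using sgn_w[of x] sgn_w[of y] eq False by (simp only:) metis
      then have "sgn x = sgn y" unfolding n by (cases "neg (nat \<bar>y\<bar>)") simp_all
      then show ?thesis using n by (metis abs_ge_zero eq_nat_nat_iff mult_sgn_abs)
    qed
  qed
  moreover have "surj ?w"
  proof
    show "UNIV \<subseteq> range ?w"
    proof
      fix y :: int
      show "y \<in> range ?w"
      proof (cases "y = 0")
        case True
        then show ?thesis by (intro range_eqI[of _ _ 0]) simp
      next
        case False
        then have "nat \<bar>y\<bar> \<ge> 1" by simp
        from surj[OF this] obtain q where q: "q \<ge> 1" "f q = nat \<bar>y\<bar>" by blast
        define x where "x = sgn y * ?e q * int q"
        have "\<bar>x\<bar> = int q" "sgn x = sgn y * ?e q"
          using q False by (auto simp: x_def abs_mult abs_sgn_eq sgn_mult)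
        then have nx: "nat \<bar>x\<bar> = q" and sx: "sgn x = sgn y * ?e q" by simp_all
        have "?w x = sgn x * ?e (nat \<bar>x\<bar>) * int (f (nat \<bar>x\<bar>))" by (rule w)
        also have "\<dots> = sgn y * ?e q * ?e q * int (nat \<bar>y\<bar>)" by (simp only: nx sx q(2))
        also have "\<dots> = y" by (cases "neg q") (simp_all add: sgn_mult_abs)
        finally show ?thesis by (intro range_eqI[of _ ?w x]) (rule sym)
      qed
    qed
  qed simp
  ultimately have "bij ?w" by (simp add: bij_def)
  moreover have "?w (- x) = - ?w x" for x by simp
  moreover have "?w x = x" if "\<bar>x\<bar> > int n" for x
  proof -
    have "nat \<bar>x\<bar> > n" using that by simp
    then show ?thesis unfolding w using big[of "nat \<bar>x\<bar>"] by (simp add: sgn_mult_abs)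
  qed
  ultimately show ?thesis by (simp add: W_def)
qed

lemma card_less_sorted_nth:
  fixes A :: "nat set"
  assumes "finite A" "i < card A"
  shows "card {x \<in> A. x < sorted_list_of_set A ! i} = i"
proof -
  let ?l = "sorted_list_of_set A"
  have l: "sorted_wrt (<) ?l" "length ?l = card A" "set ?l = A"
    using assms(1) by auto
  have less: "?l ! j < ?l ! i \<longleftrightarrow> j < i" if "j < card A" for j
    using sorted_wrt_nth_less[OF l(1), of j i] sorted_wrt_nth_less[OF l(1), of i j] assms(2) that l(2)
    by (cases i j rule: linorder_cases) auto
  have "bij_betw ((!) ?l) {..<i} {x \<in> A. x < ?l ! i}"
    unfolding bij_betw_def
  proof
    show "inj_on ((!) ?l) {..<i}"
      using assms l by (auto intro!: inj_onI simp: nth_eq_iff_index_eq)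
    show "(!) ?l ` {..<i} = {x \<in> A. x < ?l ! i}"
    proof (intro equalityI subsetI)
      fix x assume "x \<in> {x \<in> A. x < ?l ! i}"
      then obtain j where "j < card A" "x = ?l ! j" "?l ! j < ?l ! i"
        using l by (metis (no_types, lifting) in_set_conv_nth mem_Collect_eq)
      then show "x \<in> (!) ?l ` {..<i}" using less by auto
    next
      fix x assume "x \<in> (!) ?l ` {..<i}"
      then obtain j where "j < i" "x = ?l ! j" by auto
      then show "x \<in> {x \<in> A. x < ?l ! i}"
        using less[of j] assms(2) l nth_mem[of j ?l] by auto
    qed
  qed
  from bij_betw_same_card[OF this] show ?thesis by simp
qed

text \<open>
  The negative entries of \<open>w\<^sub>\<lambda>\<close> are prescribed by the parts exceeding \<open>k\<close>. In the increasing list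
  of the remaining absolute values, the entry of a row \<open>j\<close> with \<open>\<lambda>\<^sub>j \<le> k\<close> is preceded by the entries
  of the earlier such rows and by exactly \<open>k - \<lambda>\<^sub>j\<close> of the first \<open>k\<close> entries, which determines its
  position in the list.
\<close>

lemma exists_k_grassmannian_of_shape:
  assumes "k_strict k lam"
  shows "\<exists>w. k_grassmannian k w \<and> grassmannian_shape k w = lam"
proof -
  have lam0: "lam 0 = 0" and fin: "finite {i. lam i \<noteq> 0}"
    and desc: "\<And>i. i \<ge> 1 \<Longrightarrow> lam (Suc i) \<le> lam i"
    and strict: "\<And>i j. 1 \<le> i \<Longrightarrow> i < j \<Longrightarrow> lam i > k \<Longrightarrow> lam i \<noteq> lam j"
    using assms by (auto simp: k_strict_def is_partition_def)
  have anti: "lam j \<le> lam i" if "1 \<le> i" "i \<le> j" for i j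
    using that(2,1) by (induction j rule: dec_induct) (auto intro: order_trans[OF desc])
  obtain J where J: "\<And>j. lam j \<noteq> 0 \<Longrightarrow> j \<le> J"
    using fin by (metis (mono_tags, lifting) finite_nat_set_iff_bounded_le mem_Collect_eq)
  \<comment> \<open>The parts exceeding \<open>k\<close> are the first \<open>m\<close> ones.\<close>
  define m where "m = Max (insert 0 {j. 1 \<le> j \<and> lam j > k})"
  have finM: "finite {j. 1 \<le> j \<and> lam j > k}"
    by (rule finite_subset[OF _ fin]) auto
  have m: "lam j > k \<longleftrightarrow> j \<le> m" if "1 \<le> j" for j
  proof
    assume "lam j > k"
    then show "j \<le> m" unfolding m_def using finM that by (intro Max_ge) auto
  next
    assume "j \<le> m"
    have "m \<in> insert 0 {j. 1 \<le> j \<and> lam j > k}"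
      unfolding m_def using finM by (intro Max_in) auto
    then have "lam m > k" using \<open>j \<le> m\<close> that by auto
    then show "lam j > k" using anti[OF that \<open>j \<le> m\<close>] by simp
  qed
  have mJ: "m \<le> J"
  proof (cases "m = 0")
    case False
    then have "lam m > k" using m[of m] by simp
    then show ?thesis using J by simp
  qed simp
  \<comment> \<open>Large enough for all parts to fit in the rows up to \<open>n - k\<close> and for all negative entries
    to have absolute value at most \<open>n\<close>.\<close>
  define n where "n = k + J + lam 1"
  have n: "k + m \<le> n" "J \<le> n - k" "k \<le> n" using mJ by (auto simp: n_def)
  have strict_anti: "lam j < lam i" if "1 \<le> i" "i < j" "i \<le> m" for i j
    using anti[of i j] strict[of i j] m[of i] that by fastforce
  define D where "D = (\<lambda>j. lam j - k) ` {1..m}"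
  have D_inj: "inj_on (\<lambda>j. lam j - k) {1..m}"
  proof (rule inj_onI)
    fix i j assume ij: "i \<in> {1..m}" "j \<in> {1..m}" "lam i - k = lam j - k"
    then have "lam i = lam j" using m[of i] m[of j] by auto
    then show "i = j"
      using strict_anti[of i j] strict_anti[of j i] ij by (cases i j rule: linorder_cases) auto
  qed
  have card_D: "card D = m" unfolding D_def using card_image[OF D_inj] by simp
  have D_sub: "D \<subseteq> {1..n}"
  proof
    fix d assume "d \<in> D"
    then obtain j where j: "1 \<le> j" "j \<le> m" "d = lam j - k" by (auto simp: D_def)
    then show "d \<in> {1..n}" using m[of j] anti[of 1 j] by (auto simp: n_def)
  qed
  define P where "P = {1..n} - D"
  define pl where "pl = sorted_list_of_set P"
  have P: "finite P" "card P = n - m"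
    using card_D D_sub by (auto simp: P_def card_Diff_subset finite_subset)
  have pl: "sorted_wrt (<) pl" "length pl = n - m" "set pl = P" "distinct pl"
    using P by (auto simp: pl_def)
  \<comment> \<open>Zero-based position in \<open>pl\<close>: row \<open>j\<close> is preceded by \<open>j - 1 - m\<close> rows with smaller
    positive entries and by \<open>k - lam j\<close> of the entries at positions up to \<open>k\<close>.\<close>
  define idx where "idx j = j - 1 - m + (k - lam j)" for j
  have idx_less: "idx j < n - m" if "m < j" "j \<le> n - k" for j
    using that n(3) by (simp add: idx_def)
  have idx_mono: "idx i < idx j" if "m < i" "i < j" for i j
    using anti[of i j] that by (auto simp: idx_def)
  define b where "b j = pl ! idx j" for j
  have b_mono: "b i < b j" if "m < i" "i < j" "j \<le> n - k" for i j
    unfolding b_def using sorted_wrt_nth_less[OF pl(1) idx_mono] idx_less[of j] that pl(2) by simp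
  have b_P: "b j \<in> P" if "m < j" "j \<le> n - k" for j
    unfolding b_def using idx_less[OF that] pl by (metis nth_mem)
  define B where "B = b ` {m<..n - k}"
  have b_inj: "inj_on b {m<..n - k}"
  proof (rule inj_onI)
    fix i j assume ij: "i \<in> {m<..n - k}" "j \<in> {m<..n - k}" "b i = b j"
    then show "i = j"
      using b_mono[of i j] b_mono[of j i] by (cases i j rule: linorder_cases) auto
  qed
  have card_B: "card B = n - k - m" unfolding B_def using card_image[OF b_inj] by simp
  have B_P: "B \<subseteq> P" using b_P by (auto simp: B_def)
  define A where "A = P - B"
  define al where "al = sorted_list_of_set A"
  have A: "finite A" "card A = k"
    using P B_P card_B n by (auto simp: A_def card_Diff_subset finite_subset)
  have al: "sorted_wrt (<) al" "length al = k" "set al = A" "distinct al"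
    using A by (auto simp: al_def)
  define f where "f q = (if q \<le> k then al ! (q - 1) else if q \<le> k + m then lam (q - k) - k
    else if q \<le> n then b (q - k) else q)" for q
  define neg where "neg q \<longleftrightarrow> k < q \<and> q \<le> k + m" for q
  define w where "w x = sgn x * (if neg (nat \<bar>x\<bar>) then - int (f (nat \<bar>x\<bar>)) else int (f (nat \<bar>x\<bar>)))" for x
  have f_A: "f ` {1..k} = A"
  proof -
    have "f ` {1..k} = (!) al ` {..<k}"
    proof (intro equalityI subsetI)
      fix y assume "y \<in> f ` {1..k}"
      then obtain q where "1 \<le> q" "q \<le> k" "y = al ! (q - 1)" by (auto simp: f_def)
      then show "y \<in> (!) al ` {..<k}" by (intro image_eqI[of _ _ "q - 1"]) auto
    next
      fix y assume "y \<in> (!) al ` {..<k}"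
      then obtain q where "q < k" "y = al ! q" by auto
      then show "y \<in> f ` {1..k}" by (intro image_eqI[of _ _ "Suc q"]) (auto simp: f_def)
    qed
    also have "\<dots> = set al" using al(2) by (auto simp: set_conv_nth)
    finally show ?thesis using al(3) by simp
  qed
  have f_D: "f ` {k<..k + m} = D"
  proof (intro equalityI subsetI)
    fix y assume "y \<in> D"
    then obtain j where "1 \<le> j" "j \<le> m" "y = lam j - k" by (auto simp: D_def)
    then show "y \<in> f ` {k<..k + m}" by (intro image_eqI[of _ _ "k + j"]) (auto simp: f_def)
  qed (force simp: f_def D_def)
  have f_B: "f ` {k + m<..n} = B"
  proof (intro equalityI subsetI)
    fix y assume "y \<in> B"
    then obtain j where "m < j" "j \<le> n - k" "y = b j" by (auto simp: B_def)
    then show "y \<in> f ` {k + m<..n}" by (intro image_eqI[of _ _ "k + j"]) (auto simp: f_def)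
  qed (force simp: f_def B_def)
  have "{1..n} = {1..k} \<union> {k<..k + m} \<union> {k + m<..n}" using n by auto
  then have "f ` {1..n} = A \<union> D \<union> B" by (simp only: image_Un f_A f_D f_B)
  also have "\<dots> = {1..n}" using D_sub B_P by (auto simp: A_def P_def)
  finally have "bij_betw f {1..n} {1..n}"
    by (simp add: bij_betw_def eq_card_imp_inj_on)
  moreover have "f q = q" "\<not> neg q" if "q > n" for q
    using that n by (auto simp: f_def neg_def)
  ultimately have wW: "w \<in> W n"
    unfolding w_def by (intro signed_permutation_in_W) auto
  have w_low: "w (int q) = int (al ! (q - 1))" if "1 \<le> q" "q \<le> k" for q
    using that by (simp add: w_def neg_def f_def)
  have w_neg: "w (int (k + j)) = int k - int (lam j)" if "1 \<le> j" "j \<le> m" for j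
  proof -
    have "lam j > k" using m that by simp
    then show ?thesis using that by (simp add: w_def neg_def f_def nat_add_distrib)
  qed
  have w_mid: "w (int (k + j)) = int (b j)" if "m < j" "j \<le> n - k" for j
  proof -
    have "k + j \<le> n" using that n(3) by simp
    then show ?thesis using that by (simp add: w_def neg_def f_def nat_add_distrib)
  qed
  have w_high: "w (int q) = int q" if "n < q" for q
    using W_D(3)[OF wW] that by simp
  have A_sub: "A \<subseteq> {1..n}" "P \<subseteq> {1..n}" by (auto simp: A_def P_def)
  have b_range: "1 \<le> b j" "b j \<le> n" if "m < j" "j \<le> n - k" for j
    using b_P[OF that] A_sub by auto
  have al_range: "1 \<le> al ! q" "al ! q \<le> n" if "q < k" for q
    using nth_mem[of q al] that al A_sub by auto
  have asc: "ascent w i" if "i \<noteq> k" for i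
  proof -
    consider "i = 0" "0 < k" | "1 \<le> i" "i < k" | "k < i" using \<open>i \<noteq> k\<close> by linarith
    then show ?thesis
    proof cases
      case 1
      then show ?thesis using w_low[of 1] al_range[of 0] by (simp add: ascent_def)
    next
      case 2
      then have "al ! (i - 1) < al ! i"
        using sorted_wrt_nth_less[OF al(1), of "i - 1" i] al(2) by simp
      then show ?thesis using 2 w_low[of i] w_low[of "Suc i"] by (simp add: ascent_def add.commute)
    next
      case 3
      define j where "j = i - k"
      have j: "1 \<le> j" "i = k + j" using 3 by (auto simp: j_def)
      have "w (int (k + j)) < w (int (k + Suc j))"
      proof -
        consider "Suc j \<le> m" | "j = m" "Suc j \<le> n - k" | "m < j" "Suc j \<le> n - k"
          | "j \<le> n - k" "n - k < Suc j" | "n - k < j" by linarith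
        then show ?thesis
        proof cases
          case 1
          then show ?thesis using w_neg[of j] w_neg[of "Suc j"] strict_anti[of j "Suc j"] j by simp
        next
          case 2
          then show ?thesis
            using w_neg[of j] w_mid[of "Suc j"] m[of j] j by simp
        next
          case 3
          then show ?thesis using w_mid[of j] w_mid[of "Suc j"] b_mono[of j "Suc j"] by simp
        next
          case 4
          have "w (int (k + j)) \<le> int n"
            using w_neg[of j] w_mid[of j] m[of j] b_range[of j] j 4 by (cases "j \<le> m") auto
          moreover have "w (int (k + Suc j)) = int (k + Suc j)" using 4 by (intro w_high) simp
          ultimately show ?thesis using 4 by simp
        next
          case 5
          then show ?thesis using w_high[of "k + j"] w_high[of "k + Suc j"] by simp
        qed
      qed
      then show ?thesis using j by (simp add: ascent_def add.assoc add.commute)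
    qed
  qed
  have grass: "k_grassmannian k w"
    using asc wW by (auto simp: k_grassmannian_iff W_inf_def)
  have card_above: "card {p. 1 \<le> p \<and> p \<le> k \<and> w (int p) > int y} = card {a \<in> A. a > y}" for y
  proof -
    have "bij_betw f {p. 1 \<le> p \<and> p \<le> k \<and> w (int p) > int y} {a \<in> A. a > y}"
      unfolding bij_betw_def
    proof
      have "inj_on f {1..k}" by (rule eq_card_imp_inj_on) (simp, unfold f_A A(2), simp)
      then show "inj_on f {p. 1 \<le> p \<and> p \<le> k \<and> w (int p) > int y}"
        by (rule inj_on_subset) auto
      have wf: "w (int p) = int (f p)" if "1 \<le> p" "p \<le> k" for p
        using w_low[OF that] that by (simp add: f_def)
      show "f ` {p. 1 \<le> p \<and> p \<le> k \<and> w (int p) > int y} = {a \<in> A. a > y}"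
        unfolding f_A[symmetric] using wf by auto
    qed
    then show ?thesis by (rule bij_betw_same_card)
  qed
  have shape: "grassmannian_shape k w j = lam j" if j: "1 \<le> j" for j
  proof -
    consider "j \<le> m" | "m < j" "j \<le> n - k" | "n - k < j" by linarith
    then show ?thesis
    proof cases
      case 1
      then have "lam j > k" using m j by simp
      then show ?thesis using w_neg[OF j 1] j by (simp add: grassmannian_shape_def nat_diff_distrib)
    next
      case 2
      have lamk: "lam j \<le> k" using m[OF j] 2 by simp
      have "{x \<in> P. x < b j} = {a \<in> A. a < b j} \<union> b ` {m<..<j}"
      proof (intro equalityI subsetI)
        fix x assume x: "x \<in> {x \<in> P. x < b j}"
        show "x \<in> {a \<in> A. a < b j} \<union> b ` {m<..<j}"
        proof (cases "x \<in> B")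
          case True
          then obtain l where l: "m < l" "l \<le> n - k" "x = b l" by (auto simp: B_def)
          have "l < j"
          proof (rule ccontr)
            assume "\<not> l < j"
            then have "b j \<le> b l" using b_mono[of j l] 2 l by (cases "l = j") auto
            with x l show False by simp
          qed
          then show ?thesis using l by auto
        qed (use x in \<open>auto simp: A_def\<close>)
      next
        fix x assume "x \<in> {a \<in> A. a < b j} \<union> b ` {m<..<j}"
        then show "x \<in> {x \<in> P. x < b j}"
          using b_mono[of _ j] b_P 2 by (auto simp: A_def)
      qed
      moreover have "{a \<in> A. a < b j} \<inter> b ` {m<..<j} = {}"
        using 2 by (auto simp: A_def B_def)
      moreover have "card (b ` {m<..<j}) = j - 1 - m"
      proof -
        have "{m<..<j} \<subseteq> {m<..n - k}" using 2 by auto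
        from card_image[OF inj_on_subset[OF b_inj this]] show ?thesis by simp
      qed
      ultimately have "card {x \<in> P. x < b j} = card {a \<in> A. a < b j} + (j - 1 - m)"
        using A(1) by (simp add: card_Un_disjoint)
      moreover have "card {x \<in> P. x < b j} = idx j"
        unfolding b_def pl_def using card_less_sorted_nth[OF P(1), of "idx j"] idx_less 2 P(2) by simp
      ultimately have below: "card {a \<in> A. a < b j} = k - lam j"
        by (simp add: idx_def)
      have "b j \<notin> A" using 2 by (auto simp: A_def B_def)
      then have "a < b j \<or> a > b j" if "a \<in> A" for a
        using that by (metis linorder_neqE_nat)
      then have "A = {a \<in> A. a < b j} \<union> {a \<in> A. a > b j}" by blast
      moreover have "{a \<in> A. a < b j} \<inter> {a \<in> A. a > b j} = {}" by auto
      ultimately have "card A = card {a \<in> A. a < b j} + card {a \<in> A. a > b j}"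
        using A(1) card_Un_disjoint[of "{a \<in> A. a < b j}" "{a \<in> A. a > b j}"] by simp
      then have "card {a \<in> A. a > b j} = lam j"
        using below A(2) lamk by simp
      then show ?thesis
        using j w_mid[OF 2] card_above[of "b j"] by (simp add: grassmannian_shape_def)
    next
      case 3
      have "w (int (k + j)) = int (k + j)" using 3 by (intro w_high) simp
      moreover have "{a \<in> A. a > k + j} = {}" using A_sub 3 by fastforce
      then have "card {a \<in> A. a > k + j} = 0" by (simp only: card.empty)
      moreover have "lam j = 0" using J[of j] 3 n by linarith
      ultimately show ?thesis
        using j card_above[of "k + j"] by (simp add: grassmannian_shape_def)
    qed
  qed
  have "grassmannian_shape k w = lam"
  proof
    fix j show "grassmannian_shape k w j = lam j"
      using shape[of j] lam0 by (cases "j = 0") (auto simp: grassmannian_shape_def)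
  qed
  with grass show ?thesis by blast
qed

lemma w_of_k_strict:
  assumes "k_strict k lam"
  shows "k_grassmannian k (w_of k lam)" "grassmannian_shape k (w_of k lam) = lam"
proof -
  obtain w where w: "k_grassmannian k w" "grassmannian_shape k w = lam"
    using exists_k_grassmannian_of_shape[OF assms] by blast
  have "w_of k lam = w"
    unfolding w_of_def w(2)[symmetric] using w(1) by (intro the_inv_into_f_f[OF grassmannian_shape_inj]) simp
  with w show "k_grassmannian k (w_of k lam)" "grassmannian_shape k (w_of k lam) = lam" by auto
qed

section \<open>Covering relations by left multiplication\<close>

text \<open>
  For \<open>k\<close>-Grassmannian \<open>u\<close> and \<open>s\<^sub>i u\<close> these are the ways in which \<open>s\<^sub>i u\<close> can be longer than \<open>u\<close>. For
  \<open>i \<ge> 1\<close> the values \<open>i\<close> and \<open>i + 1\<close> of \<open>u\<close> cannot both lie in one of the two increasing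
  parts of \<open>u\<close>, since \<open>s\<^sub>i\<close> would reverse them.
\<close>

definition left_ascent :: "nat \<Rightarrow> nat \<Rightarrow> (int \<Rightarrow> int) \<Rightarrow> bool" where
  "left_ascent k i u \<longleftrightarrow>
     (i = 0 \<and> (\<exists>a\<ge>1. u (int a) = 1)) \<or>
     (i \<ge> 1 \<and> (\<exists>a b. 1 \<le> a \<and> 1 \<le> b \<and> u (int b) = int i + 1 \<and>
        (u (int a) = int i \<and> a \<le> k \<and> k < b \<or> u (int a) = - int i)))"

text \<open>
  The remaining sign patterns for the entries of absolute value \<open>i\<close> and \<open>i + 1\<close> are turned into the
  listed ones by \<open>s\<^sub>i\<close> or contradict monotonicity.
\<close>

lemma left_ascent_cases:
  assumes u: "k_grassmannian k u" and v: "k_grassmannian k v" and vu: "v = simple_refl i \<circ> u"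
  shows "left_ascent k i u \<or> left_ascent k i v"
proof -
  obtain n where n: "u \<in> W n"
    and u_mono: "\<And>p q. 1 \<le> p \<Longrightarrow> p < q \<Longrightarrow> q \<le> k \<Longrightarrow> u (int p) < u (int q)"
    and u_pos: "\<And>p. 1 \<le> p \<Longrightarrow> p \<le> k \<Longrightarrow> 0 < u (int p)"
    and u_gap: "\<And>i j. 1 \<le> i \<Longrightarrow> i \<le> j \<Longrightarrow> u (int (k + i)) + (int j - int i) \<le> u (int (k + j))"
    using k_grassmannian_D[OF u] by metis
  obtain m where m: "v \<in> W m"
    and v_mono: "\<And>p q. 1 \<le> p \<Longrightarrow> p < q \<Longrightarrow> q \<le> k \<Longrightarrow> v (int p) < v (int q)"
    and v_gap: "\<And>i j. 1 \<le> i \<Longrightarrow> i \<le> j \<Longrightarrow> v (int (k + i)) + (int j - int i) \<le> v (int (k + j))"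
    using k_grassmannian_D[OF v] by metis
  have pos_of_abs: "\<exists>a\<ge>1. u (int a) = int y \<or> u (int a) = - int y" if "y \<ge> 1" for y
  proof -
    have "int y > 0" using that by simp
    from W_obtain_abs[OF n this] obtain x where "x > 0" "\<bar>u x\<bar> = int y" by blast
    then show ?thesis by (intro exI[of _ "nat x"]) auto
  qed
  have v_apply: "v x = simple_refl i (u x)" for x by (simp add: vu)
  show ?thesis
  proof (cases "i = 0")
    case True
    obtain a where a: "a \<ge> 1" "u (int a) = 1 \<or> u (int a) = - 1" using pos_of_abs[of 1] by auto
    then have "u (int a) = 1 \<or> v (int a) = 1" by (auto simp: v_apply True simple_refl_apply)
    then show ?thesis using True a(1) by (auto simp: left_ascent_def)
  next
    case False
    obtain a where a: "a \<ge> 1" "u (int a) = int i \<or> u (int a) = - int i"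
      using pos_of_abs[of i] False by auto
    obtain b where b: "b \<ge> 1" "u (int b) = int i + 1 \<or> u (int b) = - int i - 1"
      using pos_of_abs[of "i + 1"] by auto
    have not_order: "(a \<le> k) \<noteq> (b \<le> k)" if "sgn (u (int a)) = sgn (u (int b))"
    proof
      have u_less: "u (int p) < u (int q)" and v_less: "v (int p) < v (int q)"
        if "1 \<le> p" "p < q" "p \<le> k \<longleftrightarrow> q \<le> k" for p q
      proof -
        have "q \<le> k \<or> 1 \<le> p - k \<and> p - k \<le> q - k \<and> k + (p - k) = p \<and> k + (q - k) = q"
          using that by auto
        then show "u (int p) < u (int q)" "v (int p) < v (int q)"
          using that u_mono[of p q] u_gap[of "p - k" "q - k"] v_mono[of p q] v_gap[of "p - k" "q - k"]
          by force+
      qed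
      assume same: "(a \<le> k) = (b \<le> k)"
      have "v (int a) = u (int b) \<and> v (int b) = u (int a) \<and> a \<noteq> b"
        using a(2) b(2) that False by (auto simp: v_apply simple_refl_apply)
      then show False
        using u_less[of a b] u_less[of b a] v_less[of a b] v_less[of b a] a(1) b(1) same
        by (cases a b rule: linorder_cases) auto
    qed
    consider "u (int a) = int i" "u (int b) = int i + 1" | "u (int a) = int i" "u (int b) = - int i - 1"
      | "u (int a) = - int i" "u (int b) = int i + 1" | "u (int a) = - int i" "u (int b) = - int i - 1"
      using a(2) b(2) by blast
    then show ?thesis
    proof cases
      case 1
      then have "(a \<le> k \<and> k < b) \<or> (b \<le> k \<and> k < a)"
        using not_order False by auto
      moreover have "v (int a) = int i + 1" "v (int b) = int i"
        using 1 False by (auto simp: v_apply simple_refl_apply)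
      ultimately show ?thesis
        using a(1) b(1) 1 False unfolding left_ascent_def by (meson not_less_eq_eq One_nat_def le0 less_one not_le)
    next
      case 2
      have "v (int a) = int i + 1" "v (int b) = - int i"
        using 2 False by (auto simp: v_apply simple_refl_apply)
      then show ?thesis
        using a(1) b(1) False unfolding left_ascent_def by (meson less_one not_le)
    next
      case 3
      then show ?thesis
        using a(1) b(1) False unfolding left_ascent_def by (meson less_one not_le)
    next
      case 4
      have "\<not> a \<le> k" "\<not> b \<le> k" using 4 u_pos[of a] u_pos[of b] a(1) b(1) by auto
      then show ?thesis using not_order 4 False by (auto simp: sgn_if)
    qed
  qed
qed

text \<open>
  The index \<open>\<beta>\<^sub>j\<close> has absolute value \<open>i\<close> iff the entry in row \<open>j\<close> is \<open>i\<close> or \<open>-i-1\<close>; these are the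
  rows named in the two alternatives. Membership in \<open>C\<close> and the
  parts in the other rows depend on comparisons of an entry with another one or its negative. By \<open>simple_refl_less_iff\<close> they are unaffected by
  \<open>s\<^sub>i\<close>, unless \<open>s\<^sub>i\<close> interchanges the two numbers that are compared. Two rows with entries \<open>-i\<close> and
  \<open>i + 1\<close> in \<open>u\<close> are the only ones for which this alters membership in \<open>C\<close>.
\<close>

lemma left_ascent_effect:
  assumes u: "k_grassmannian k u" and v: "k_grassmannian k v" and vu: "v = simple_refl i \<circ> u"
    and asc: "left_ascent k i u"
  defines "mu \<equiv> grassmannian_shape k u" and "lam \<equiv> grassmannian_shape k v"
  obtains (one_row) r where "r \<ge> 1" "lam = mu(r := mu r + 1)" "C_set k lam = C_set k mu"
      "\<bar>beta k lam r\<bar> = int i" "\<And>j. j \<ge> 1 \<Longrightarrow> j \<noteq> r \<Longrightarrow> \<bar>beta k lam j\<bar> \<noteq> int i"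
  | (two_rows) r s where "i \<ge> 1" "lam = mu(r := mu r + 1)" "C_set k lam = insert (r, s) (C_set k mu)"
      "(r, s) \<notin> C_set k mu" "beta k lam r = - int i" "beta k lam s = int i"
      "\<And>j. j \<ge> 1 \<Longrightarrow> j \<noteq> r \<Longrightarrow> j \<noteq> s \<Longrightarrow> \<bar>beta k lam j\<bar> \<noteq> int i"
proof -
  obtain n where n: "u \<in> W n"
    and u_pos: "\<And>p. 1 \<le> p \<Longrightarrow> p \<le> k \<Longrightarrow> 0 < u (int p)"
    and u_gap: "\<And>i j. 1 \<le> i \<Longrightarrow> i \<le> j \<Longrightarrow> u (int (k + i)) + (int j - int i) \<le> u (int (k + j))"
    using k_grassmannian_D[OF u] by metis
  obtain m where m: "v \<in> W m"
    and v_pos: "\<And>p. 1 \<le> p \<Longrightarrow> p \<le> k \<Longrightarrow> 0 < v (int p)"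
    using k_grassmannian_D[OF v] by metis
  let ?s = "simple_refl i"
  have v_apply: "v x = ?s (u x)" for x by (simp add: vu)
  have nonzero: "u (int p) \<noteq> 0" "v (int p) \<noteq> 0" if "p \<ge> 1" for p
    using W_eq_0_iff[OF n] W_eq_0_iff[OF m] that by auto
  have u_abs: "\<bar>u (int p)\<bar> = \<bar>u (int q)\<bar> \<longleftrightarrow> p = q" if "p \<ge> 1" "q \<ge> 1" for p q
    using W_abs_eq_iff[OF n, of "int p" "int q"] that by simp
  have beta_iff: "\<bar>beta k lam j\<bar> = int i \<longleftrightarrow> v (int (k + j)) = int i \<or> v (int (k + j)) = - int i - 1"
    if "j \<ge> 1" for j
    unfolding lam_def beta_grassmannian_shape[OF v that] using nonzero(2)[of "k + j"] that by auto
  have beta_i: "beta k lam j = int i" if "j \<ge> 1" "v (int (k + j)) = int i" for j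
    unfolding lam_def beta_grassmannian_shape[OF v that(1)] using that by simp
  have beta_neg: "beta k lam j = - int i" if "j \<ge> 1" "v (int (k + j)) = - int i - 1" for j
    unfolding lam_def beta_grassmannian_shape[OF v that(1)] using that by simp
  have s_abs: "\<bar>?s z\<bar> = int i \<or> \<bar>?s z\<bar> = int i + 1 \<longleftrightarrow> \<bar>z\<bar> = int i \<or> \<bar>z\<bar> = int i + 1" for z
    by (cases "i = 0") (auto simp: simple_refl_apply)
  have s_fix: "?s z = z" if "\<bar>z\<bar> \<noteq> int i" "\<bar>z\<bar> \<noteq> int i + 1" for z
    using that by (auto simp: simple_refl_apply)
  have shape_fixed: "lam j = mu j"
    if "j \<ge> 1" "\<bar>u (int (k + j))\<bar> \<noteq> int i" "\<bar>u (int (k + j))\<bar> \<noteq> int i + 1" for j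
  proof -
    let ?y = "u (int (k + j))"
    have vy: "v (int (k + j)) = ?y" using s_fix that by (simp add: v_apply)
    have "v (int p) > ?y \<longleftrightarrow> u (int p) > ?y" if "1 \<le> p" "p \<le> k" for p
    proof -
      have "?y \<noteq> u (int p)" using u_abs[of "k + j" p] that \<open>j \<ge> 1\<close> by auto
      then show ?thesis
        using simple_refl_less_iff[of ?y "u (int p)" i] vy nonzero(1)[of p] nonzero(1)[of "k + j"]
          that \<open>j \<ge> 1\<close>
        by (simp add: v_apply)
    qed
    then have "{p. 1 \<le> p \<and> p \<le> k \<and> v (int p) > ?y} = {p. 1 \<le> p \<and> p \<le> k \<and> u (int p) > ?y}"
      by blast
    then show ?thesis
      unfolding lam_def mu_def grassmannian_shape_def vy by simp
  qed
  have shape0: "lam 0 = mu 0" by (simp add: lam_def mu_def grassmannian_shape_def)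
  have C_pair: "(x, y) \<in> C_set k lam \<longleftrightarrow> (x, y) \<in> C_set k mu"
    if "\<not> (1 \<le> x \<and> x < y \<and> v (int (k + x)) = - u (int (k + y)))" for x y
  proof (cases "1 \<le> x \<and> x < y")
    case True
    have "- u (int (k + y)) \<noteq> 0" "u (int (k + x)) \<noteq> 0" using nonzero(1)[of "k + x"] nonzero(1)[of "k + y"] True by auto
    from simple_refl_less_iff[OF this(2,1), of i]
    have "v (int (k + x)) < - v (int (k + y)) \<longleftrightarrow> u (int (k + x)) < - u (int (k + y))"
      using that True by (simp add: v_apply simple_refl_uminus)
    then have "v (int (k + x)) + v (int (k + y)) < 0 \<longleftrightarrow> u (int (k + x)) + u (int (k + y)) < 0"
      by linarith
    then show ?thesis
      by (simp add: lam_def mu_def C_set_grassmannian_shape[OF u] C_set_grassmannian_shape[OF v])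
  qed (auto simp: C_set_def)
  have C_special: "(\<bar>u (int (k + x))\<bar> = int i \<and> \<bar>u (int (k + y))\<bar> = int i + 1 \<or>
      \<bar>u (int (k + y))\<bar> = int i \<and> \<bar>u (int (k + x))\<bar> = int i + 1) \<and> i \<ge> 1"
    if "1 \<le> x" "x < y" "v (int (k + x)) = - u (int (k + y))" for x y
  proof -
    have "\<bar>?s (u (int (k + x)))\<bar> = \<bar>u (int (k + y))\<bar>" using that by (simp add: v_apply)
    moreover have "\<bar>u (int (k + x))\<bar> \<noteq> \<bar>u (int (k + y))\<bar>"
      using u_abs[of "k + x" "k + y"] that by simp
    ultimately show ?thesis
      by (cases "i = 0") (auto simp: simple_refl_apply split: if_splits)
  qed
  show thesis
  proof (cases "i = 0")
    case True
    then obtain a where a: "a \<ge> 1" "u (int a) = 1" using asc by (auto simp: left_ascent_def)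
    have va: "v (int a) = - 1" using a True by (simp add: v_apply simple_refl_apply)
    then have "k < a" using v_pos[of a] a by force
    define r where "r = a - k"
    have r: "r \<ge> 1" "k + r = a" using \<open>k < a\<close> by (auto simp: r_def)
    have unique: "\<bar>u (int (k + j))\<bar> \<noteq> 1" "\<bar>v (int (k + j))\<bar> \<noteq> 1" if "j \<ge> 1" "j \<noteq> r" for j
    proof -
      show *: "\<bar>u (int (k + j))\<bar> \<noteq> 1" using u_abs[of "k + j" a] a r that by auto
      then show "\<bar>v (int (k + j))\<bar> \<noteq> 1" using True by (simp add: v_apply simple_refl_apply)
    qed
    have "lam = mu(r := mu r + 1)"
    proof
      fix j
      consider "j = 0" | "j = r" | "j \<ge> 1" "j \<noteq> r" by linarith
      then show "lam j = (mu(r := mu r + 1)) j"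
      proof cases
        case 2
        have "u (int p) > 1" if "1 \<le> p" "p \<le> k" for p
          using u_pos[OF that] u_abs[of p a] a that \<open>k < a\<close> by force
        then have "{p. 1 \<le> p \<and> p \<le> k \<and> u (int p) > 1} = {1..k}" by auto
        then have "mu r = k" using a r by (simp add: mu_def grassmannian_shape_def)
        moreover have "lam r = k + 1" using va r by (simp add: lam_def grassmannian_shape_def)
        ultimately show ?thesis using 2 by simp
      next
        case 3
        then show ?thesis using shape_fixed[of j] unique(1)[of j] nonzero(1)[of "k + j"] True by simp
      qed (use shape0 r in simp)
    qed
    moreover have "C_set k lam = C_set k mu"
      using C_pair C_special True by fastforce
    moreover have "\<bar>beta k lam r\<bar> = int i" using beta_iff[OF r(1)] va r True by simp
    moreover have "\<bar>beta k lam j\<bar> \<noteq> int i" if "j \<ge> 1" "j \<noteq> r" for j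
      using beta_iff[OF that(1)] unique(2)[OF that] nonzero(2)[of "k + j"] that True by auto
    ultimately show thesis using one_row r(1) by blast
  next
    case i: False
    then obtain a b where ab: "1 \<le> a" "1 \<le> b" "u (int b) = int i + 1"
      and a_cases: "u (int a) = int i \<and> a \<le> k \<and> k < b \<or> u (int a) = - int i"
      using asc by (auto simp: left_ascent_def)
    have vb: "v (int b) = int i" using ab i by (simp add: v_apply simple_refl_apply)
    have abs_ab: "\<bar>u (int a)\<bar> = int i" "\<bar>u (int b)\<bar> = int i + 1" using a_cases ab by auto
    have only: "\<bar>u (int p)\<bar> \<noteq> int i" "\<bar>u (int p)\<bar> \<noteq> int i + 1"
      "v (int p) \<noteq> int i" "v (int p) \<noteq> - int i - 1" if "p \<ge> 1" "p \<noteq> a" "p \<noteq> b" for p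
    proof -
      show *: "\<bar>u (int p)\<bar> \<noteq> int i" "\<bar>u (int p)\<bar> \<noteq> int i + 1"
        using u_abs[of p a] u_abs[of p b] abs_ab ab that by auto
      have "v (int p) = u (int p)" using s_fix[OF *] by (simp add: v_apply)
      with * show "v (int p) \<noteq> int i" "v (int p) \<noteq> - int i - 1" by auto
    qed
    have C_eq: "(x, y) \<in> C_set k lam \<longleftrightarrow> (x, y) \<in> C_set k mu"
      if "\<not> (k + x = a \<and> k + y = b)" "\<not> (k + x = b \<and> k + y = a)" for x y
    proof (rule C_pair, rule notI)
      assume xy: "1 \<le> x \<and> x < y \<and> v (int (k + x)) = - u (int (k + y))"
      then have "(k + x = a \<and> k + y = b) \<or> (k + x = b \<and> k + y = a)"
        using C_special[of x y] u_abs[of "k + x" a] u_abs[of "k + y" b] u_abs[of "k + x" b]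
          u_abs[of "k + y" a] abs_ab ab by auto
      with that show False by blast
    qed
    show thesis
    proof (cases "u (int a) = int i")
      case True
      then have ak: "a \<le> k" "k < b" using a_cases i by auto
      have va: "v (int a) = int i + 1" using True i by (simp add: v_apply simple_refl_apply)
      define r where "r = b - k"
      have r: "r \<ge> 1" "k + r = b" using ak by (auto simp: r_def)
      have other: "k + j \<noteq> a \<and> k + j \<noteq> b" if "j \<ge> 1" "j \<noteq> r" for j using that ak r by auto
      have "lam = mu(r := mu r + 1)"
      proof
        fix j
        consider "j = 0" | "j = r" | "j \<ge> 1" "j \<noteq> r" by linarith
        then show "lam j = (mu(r := mu r + 1)) j"
        proof cases
          case 2
          have "v (int p) > int i \<longleftrightarrow> p = a \<or> u (int p) > int i + 1" if "1 \<le> p" "p \<le> k" for p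
          proof (cases "p = a")
            case False
            have "p \<noteq> b" using that ak by simp
            then have *: "\<bar>u (int p)\<bar> \<noteq> int i" "\<bar>u (int p)\<bar> \<noteq> int i + 1"
              using only that False by auto
            then show ?thesis using s_fix[OF *] False by (auto simp: v_apply)
          qed (use va in simp)
          then have "{p. 1 \<le> p \<and> p \<le> k \<and> v (int p) > int i} =
              insert a {p. 1 \<le> p \<and> p \<le> k \<and> u (int p) > int i + 1}"
            using ak ab by auto
          moreover have "finite {p. 1 \<le> p \<and> p \<le> k \<and> u (int p) > int i + 1}" by simp
          ultimately have "card {p. 1 \<le> p \<and> p \<le> k \<and> v (int p) > int i} =
              Suc (card {p. 1 \<le> p \<and> p \<le> k \<and> u (int p) > int i + 1})"
            using True by simp
          then show ?thesis using 2 r ab vb by (simp add: lam_def mu_def grassmannian_shape_def)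
        next
          case 3
          then show ?thesis using shape_fixed[of j] only[of "k + j"] other[of j] by simp
        qed (use shape0 r in simp)
      qed
      moreover have "C_set k lam = C_set k mu"
      proof (intro set_eqI, clarify)
        fix x y
        show "(x, y) \<in> C_set k lam \<longleftrightarrow> (x, y) \<in> C_set k mu"
          using C_eq[of x y] ak by (cases "1 \<le> x \<and> x < y") (auto simp: C_set_def)
      qed
      moreover have "\<bar>beta k lam r\<bar> = int i" using beta_iff[OF r(1)] vb r by simp
      moreover have "\<bar>beta k lam j\<bar> \<noteq> int i" if "j \<ge> 1" "j \<noteq> r" for j
        using beta_iff[OF that(1)] only(3,4)[of "k + j"] other[OF that] that by simp
      ultimately show thesis using one_row r(1) by blast
    next
      case False
      then have ua: "u (int a) = - int i" using a_cases by blast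
      have va: "v (int a) = - int i - 1" using ua i by (simp add: v_apply simple_refl_apply)
      have "k < a" using u_pos[of a] ab ua by force
      define r where "r = a - k"
      have r: "r \<ge> 1" "k + r = a" using \<open>k < a\<close> by (auto simp: r_def)
      have lam: "lam = mu(r := mu r + 1)"
      proof
        fix j
        consider "j = 0" | "j = r" | "j \<ge> 1" "j \<noteq> r" "k + j = b" | "j \<ge> 1" "j \<noteq> r" "k + j \<noteq> b"
          by linarith
        then show "lam j = (mu(r := mu r + 1)) j"
        proof cases
          case 2
          then show ?thesis
            using r ua va i by (simp add: lam_def mu_def grassmannian_shape_def nat_add_distrib)
        next
          case 3
          have "v (int p) > int i \<longleftrightarrow> u (int p) > int i + 1" if "1 \<le> p" "p \<le> k" for p
          proof -
            have "p \<noteq> a" "p \<noteq> b" using that \<open>k < a\<close> 3 by auto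
            then have *: "\<bar>u (int p)\<bar> \<noteq> int i" "\<bar>u (int p)\<bar> \<noteq> int i + 1"
              using only that by auto
            then show ?thesis using s_fix[OF *] by (auto simp: v_apply)
          qed
          then have "{p. 1 \<le> p \<and> p \<le> k \<and> v (int p) > int i} =
              {p. 1 \<le> p \<and> p \<le> k \<and> u (int p) > int i + 1}" by blast
          then show ?thesis using 3 ab vb by (simp add: lam_def mu_def grassmannian_shape_def)
        next
          case 4
          then show ?thesis using shape_fixed[of j] only[of "k + j"] r by simp
        qed (use shape0 r in simp)
      qed
      show thesis
      proof (cases "b \<le> k")
        case True
        have "C_set k lam = C_set k mu"
        proof (intro set_eqI, clarify)
          fix x y
          show "(x, y) \<in> C_set k lam \<longleftrightarrow> (x, y) \<in> C_set k mu"
            using C_eq[of x y] True by (cases "1 \<le> x \<and> x < y") (auto simp: C_set_def)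
        qed
        moreover have "\<bar>beta k lam r\<bar> = int i" using beta_iff[OF r(1)] va r by simp
        moreover have "\<bar>beta k lam j\<bar> \<noteq> int i" if "j \<ge> 1" "j \<noteq> r" for j
          using beta_iff[OF that(1)] only(3,4)[of "k + j"] r True that by simp
        ultimately show thesis using one_row r(1) lam by blast
      next
        case False
        define s where "s = b - k"
        have s: "s \<ge> 1" "k + s = b" using False by (auto simp: s_def)
        have "r < s"
        proof (rule ccontr)
          assume "\<not> r < s"
          then show False using u_gap[of s r] r s ua ab by simp
        qed
        have notin: "(r, s) \<notin> C_set k mu"
        proof -
          have "\<not> u (int (k + r)) + u (int (k + s)) < 0"
            unfolding r(2) s(2) ua ab(3) by simp
          then show ?thesis unfolding mu_def C_set_grassmannian_shape[OF u] by blast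
        qed
        have isin: "(r, s) \<in> C_set k lam"
        proof -
          have "v (int (k + r)) + v (int (k + s)) < 0"
            unfolding r(2) s(2) va vb by simp
          then show ?thesis
            unfolding lam_def C_set_grassmannian_shape[OF v] using r(1) \<open>r < s\<close> by blast
        qed
        have "C_set k lam = insert (r, s) (C_set k mu)"
        proof (intro set_eqI, clarify)
          fix x y
          show "(x, y) \<in> C_set k lam \<longleftrightarrow> (x, y) \<in> insert (r, s) (C_set k mu)"
          proof (cases "(x, y) = (r, s)")
            case False
            have "\<not> (k + x = a \<and> k + y = b)" using False r s by auto
            moreover have "(x, y) \<in> C_set k lam \<longleftrightarrow> (x, y) \<in> C_set k mu" if "\<not> x < y"
              using that by (simp add: C_set_def)
            moreover have "\<not> (k + x = b \<and> k + y = a)" if "x < y"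
              using that \<open>r < s\<close> r s by auto
            ultimately show ?thesis using C_eq[of x y] False by blast
          qed (use isin in simp)
        qed
        moreover have "beta k lam r = - int i" "beta k lam s = int i"
          using beta_neg[OF r(1)] beta_i[OF s(1)] va vb r s by auto
        moreover have "\<bar>beta k lam j\<bar> \<noteq> int i" if "j \<ge> 1" "j \<noteq> r" "j \<noteq> s" for j
          using beta_iff[OF that(1)] only(3,4)[of "k + j"] r s that by auto
        ultimately show thesis using two_rows lam notin i by (metis One_nat_def Suc_leI neq0_conv)
      qed
    qed
  qed
qed

lemma partition_size_add_box:
  assumes "finite {j. mu j \<noteq> 0}"
  shows "partition_size (mu(r := mu r + 1)) = partition_size mu + 1"
proof -
  let ?S = "insert r {j. mu j \<noteq> 0}"
  have "partition_size nu = (\<Sum>j\<in>?S. nu j)" if "{j. nu j \<noteq> 0} \<subseteq> ?S" for nu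
    unfolding partition_size_def by (rule sum.mono_neutral_left) (use assms that in auto)
  note this[of "mu(r := mu r + 1)"] this[of mu]
  moreover have "{j. (mu(r := mu r + 1)) j \<noteq> 0} \<subseteq> ?S" "{j. mu j \<noteq> 0} \<subseteq> ?S" by auto
  ultimately have "partition_size (mu(r := mu r + 1)) = (\<Sum>j\<in>?S. (mu(r := mu r + 1)) j)"
    and "partition_size mu = (\<Sum>j\<in>?S. mu j)" by blast+
  moreover have "(\<Sum>j\<in>?S. (mu(r := mu r + 1)) j) = (\<Sum>j\<in>?S. mu j + (if j = r then 1 else 0))"
    by (rule sum.cong) auto
  moreover have "\<dots> = (\<Sum>j\<in>?S. mu j) + 1"
    using assms by (subst sum.distrib) simp
  ultimately show ?thesis by (simp only:)
qed

theorem proposition5: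
  fixes k i :: nat and lam mu :: "nat \<Rightarrow> nat"
  assumes "k_strict k lam" and "k_strict k mu"
    and "partition_size lam = partition_size mu + 1"
    and "w_of k lam = simple_refl i \<circ> w_of k mu"
  shows "divided_diff i (double_theta k lam) = double_theta k mu"
proof -
  let ?u = "w_of k mu" and ?v = "w_of k lam"
  note u = w_of_k_strict[OF assms(2)] and v = w_of_k_strict[OF assms(1)]
  have fin: "finite {j. lam j \<noteq> 0}" "finite {j. mu j \<noteq> 0}"
    using assms(1,2) by (auto simp: k_strict_def is_partition_def)
  have fin_mu: "finite {j. j \<ge> 1 \<and> mu j \<noteq> 0}"
    by (rule finite_subset[OF _ fin(2)]) auto
  have uv: "?u = simple_refl i \<circ> ?v"
    unfolding assms(4) by (simp add: comp_assoc[symmetric])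
  \<comment> \<open>The relation between \<open>u\<close> and \<open>v\<close> is symmetric; the sizes of the shapes tell which one is longer.\<close>
  have "\<not> left_ascent k i ?v"
  proof
    assume asc: "left_ascent k i ?v"
    have "\<exists>r. mu = lam(r := lam r + 1)"
    proof (cases rule: left_ascent_effect[OF v(1) u(1) uv asc, case_names one_row two_rows])
      case (one_row r)
      show ?thesis by (rule exI[of _ r], rule one_row(2)[unfolded u(2) v(2)])
    next
      case (two_rows r s)
      show ?thesis by (rule exI[of _ r], rule two_rows(2)[unfolded u(2) v(2)])
    qed
    then obtain r where r: "mu = lam(r := lam r + 1)" by blast
    have "partition_size mu = partition_size lam + 1"
      unfolding r by (rule partition_size_add_box[OF fin(1)])
    with assms(3) show False by simp
  qed
  then have asc: "left_ascent k i ?u"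
    using left_ascent_cases[OF u(1) v(1) assms(4)] by blast
  show ?thesis
  proof (cases rule: left_ascent_effect[OF u(1) v(1) assms(4) asc, case_names one_row two_rows])
    case (one_row r)
    note facts = one_row[unfolded u(2) v(2)]
    show ?thesis
      by (rule divided_diff_double_theta_one_row[where r = r, OF fin_mu facts(1-4)]) (fact facts(5))
  next
    case (two_rows r s)
    note facts = two_rows[unfolded u(2) v(2)]
    show ?thesis
      by (rule divided_diff_double_theta_two_rows[where r = r and s = s, OF fin_mu facts(1-6)])
         (fact facts(7))
  qed
qed

end
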